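(* Let $1<p<N$ and $0\le\mu<\left(\frac{N-p}{p}\right)^p$. Let $\Omega$ be an exterior domain in $\mathbb{R}^N$ such that $\Omega^c=\mathbb{R}^N\setminus\Omega$ is bounded, and let $f\in L^{\frac Np}(\Omega)$ satisfy $f(x)\le A|x|^{-\alpha}$ in $\Omega$ for some given constants $A,\alpha$ with $A>0$ and $p<\alpha$. If $u\in\mathcal{D}^{1,p}(\Omega)$ is a weak subsolution of $$-\Delta_p u-\frac{\mu}{|x|^p}|u|^{p-2}u=f|u|^{p-2}u\quad\text{in }\Omega,$$ then there exists a positive constant $C$ depending only on $N,p,\mu,A$ and $\alpha$ such that $$u(x)\le CM|x|^{-\gamma_2}\quad\text{for } x\in\mathbb{R}^N\setminus B_{R_1}(0),$$ where $M=\sup_{\partial B_{R_1}(0)}u^+$ and $R_1>1$ is a constant depending on $N,p,\mu,A,\alpha$.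
   Context: $\Delta_p u=\sum_{i=1}^N\partial_{x_i}(|\nabla u|^{p-2}\partial_{x_i}u)$ is the $p$-Laplacian, $p^*=\frac{Np}{N-p}$, $u^+=\max(u,0)$, and $B_R(0)$ is the ball of radius $R$ centered at the origin. $\mathcal{D}^{1,p}(\Omega)=\{v\in L^{p^*}(\Omega): v\text{ is weakly differentiable and }\nabla v\in L^p(\Omega)\}$, equipped with the seminorm $\|\nabla v\|_{L^p(\Omega)}$. A function $u\in\mathcal{D}^{1,p}(\Omega)$ is a weak subsolution of the equation in $\Omega$ if for all nonnegative $\varphi\in C_0^\infty(\Omega)$, $$\int_{\Omega}\Big(|\nabla u|^{p-2}\nabla u\cdot\nabla\varphi-\frac{\mu}{|x|^p}|u|^{p-2}u\varphi\Big)\le\int_{\Omega}f|u|^{p-2}u\varphi .$$ $\gamma_1,\gamma_2\in[0,\infty)$, $\gamma_1<\gamma_2$, are the two roots of $\gamma^{p-2}[(p-1)\gamma^2-(N-p)\gamma]+\mu=0$. They satisfy $0\le\gamma_1<\frac{N-p}{p}<\gamma_2\le\frac{N-p}{p-1}$; in the case $\mu=0$, $\gamma_1=0$ and $\gamma_2=\frac{N-p}{p-1}$.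
   Formalization: Ω^c is assumed to lie in B_{R_1}(0) (else u is undefined on part of R^N∖B_{R_1}(0)); R_1 may be any number ≥ a threshold R_0>1 fixed by N,p,μ,A,α, and C may depend also on R_1. Values of u are those of its upper semicontinuous representative. *)

theory Defs
  imports "HOL-Analysis.Analysis" "HOL-Probability.Essential_Supremum"
begin

text \<open>
  Elements of \<open>L\<^sup>q(\<Omega>)\<close> and of Sobolev spaces are represented by functions on the whole space, of
  which only the values on \<open>\<Omega>\<close>, up to Lebesgue null sets, are ever used.
\<close>

definition Lp_on :: "real \<Rightarrow> 'a::euclidean_space set \<Rightarrow> ('a \<Rightarrow> 'b::euclidean_space) set" where
  "Lp_on q \<Omega> = {v. v \<in> borel_measurable (lebesgue_on \<Omega>)
                  \<and> integrable (lebesgue_on \<Omega>) (\<lambda>x. norm (v x) powr q)}"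

definition locally_integrable_on :: "'a::euclidean_space set \<Rightarrow> ('a \<Rightarrow> 'b::euclidean_space) \<Rightarrow> bool" where
  "locally_integrable_on \<Omega> v \<longleftrightarrow> (\<forall>K. compact K \<and> K \<subseteq> \<Omega> \<longrightarrow> v absolutely_integrable_on K)"

definition grad :: "('a::euclidean_space \<Rightarrow> real) \<Rightarrow> 'a \<Rightarrow> 'a" where
  "grad \<phi> x = (\<Sum>i\<in>Basis. frechet_derivative \<phi> (at x) i *\<^sub>R i)"

fun C_diff :: "nat \<Rightarrow> ('a::euclidean_space \<Rightarrow> real) \<Rightarrow> bool" where
  "C_diff 0 \<phi> \<longleftrightarrow> continuous_on UNIV \<phi>"
| "C_diff (Suc k) \<phi> \<longleftrightarrow> (\<forall>x. \<phi> differentiable (at x))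
     \<and> (\<forall>i\<in>Basis. C_diff k (\<lambda>x. frechet_derivative \<phi> (at x) i))"

text \<open>\<open>C\<^sub>0\<^sup>\<infinity>(\<Omega>)\<close>, its members being extended by zero to the whole space.\<close>

definition test_functions :: "'a::euclidean_space set \<Rightarrow> ('a \<Rightarrow> real) set" where
  "test_functions \<Omega> = {\<phi>. (\<forall>k. C_diff k \<phi>)
      \<and> compact (closure {x. \<phi> x \<noteq> 0}) \<and> closure {x. \<phi> x \<noteq> 0} \<subseteq> \<Omega>}"

definition is_weak_gradient :: "'a::euclidean_space set \<Rightarrow> ('a \<Rightarrow> real) \<Rightarrow> ('a \<Rightarrow> 'a) \<Rightarrow> bool" where
  "is_weak_gradient \<Omega> v g \<longleftrightarrow> locally_integrable_on \<Omega> v \<and> locally_integrable_on \<Omega> g \<and>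
     (\<forall>\<phi>\<in>test_functions \<Omega>. \<forall>i\<in>Basis.
        (\<integral>x. v x * frechet_derivative \<phi> (at x) i \<partial>lebesgue_on \<Omega>)
          = - (\<integral>x. (g x \<bullet> i) * \<phi> x \<partial>lebesgue_on \<Omega>))"

definition weakly_differentiable_on :: "'a::euclidean_space set \<Rightarrow> ('a \<Rightarrow> real) \<Rightarrow> bool" where
  "weakly_differentiable_on \<Omega> v \<longleftrightarrow> (\<exists>g. is_weak_gradient \<Omega> v g)"

text \<open>
  On an open set weak gradients are unique almost everywhere, so the choice below does not matter.
\<close>

definition weak_grad :: "'a::euclidean_space set \<Rightarrow> ('a \<Rightarrow> real) \<Rightarrow> 'a \<Rightarrow> 'a" where
  "weak_grad \<Omega> v = (SOME g. is_weak_gradient \<Omega> v g)"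

definition sobolev_conj :: "'a::euclidean_space itself \<Rightarrow> real \<Rightarrow> real" where
  "sobolev_conj T p = real DIM('a) * p / (real DIM('a) - p)"

definition D1p :: "real \<Rightarrow> 'a::euclidean_space set \<Rightarrow> ('a \<Rightarrow> real) set" where
  "D1p p \<Omega> = {v. v \<in> Lp_on (sobolev_conj TYPE('a) p) \<Omega> \<and> weakly_differentiable_on \<Omega> v
                  \<and> weak_grad \<Omega> v \<in> Lp_on p \<Omega>}"

text \<open>
  Weak subsolutions of \<open>-\<Delta>\<^sub>p u - \<mu>|x|\<^sup>-\<^sup>p|u|\<^sup>p\<^sup>-\<^sup>2u = f|u|\<^sup>p\<^sup>-\<^sup>2u\<close>.
  For \<open>1 < p < DIM('a)\<close>, \<open>u \<in> D1p p \<Omega>\<close> and \<open>f \<in> Lp_on (DIM('a)/p) \<Omega>\<close> all integrands are integrable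
  by Hoelder's inequality, so the Bochner integrals do not take their default value.
  Since \<open>0 powr a = 0\<close>, the factors \<open>\<bar>t\<bar> powr (p - 2) * t\<close> vanish at \<open>t = 0\<close> for \<open>p < 2\<close> as well.
\<close>

definition weak_subsolution ::
    "real \<Rightarrow> real \<Rightarrow> ('a::euclidean_space \<Rightarrow> real) \<Rightarrow> 'a set \<Rightarrow> ('a \<Rightarrow> real) \<Rightarrow> bool" where
  "weak_subsolution p \<mu> f \<Omega> u \<longleftrightarrow> u \<in> D1p p \<Omega> \<and>
     (\<forall>\<phi>\<in>test_functions \<Omega>. (\<forall>x. 0 \<le> \<phi> x) \<longrightarrow>
        (\<integral>x. norm (weak_grad \<Omega> u x) powr (p - 2) * (weak_grad \<Omega> u x \<bullet> grad \<phi> x)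
              - \<mu> / norm x powr p * \<bar>u x\<bar> powr (p - 2) * u x * \<phi> x \<partial>lebesgue_on \<Omega>)
        \<le> (\<integral>x. f x * \<bar>u x\<bar> powr (p - 2) * u x * \<phi> x \<partial>lebesgue_on \<Omega>))"

text \<open>
  Pointwise values of a class of functions modulo null sets: the upper semicontinuous representative
  \<open>x \<mapsto> lim\<^sub>r\<^sub>\<rightarrow>\<^sub>0 ess sup {u y | y \<in> \<Omega>, |y - x| < r}\<close>, the usual one for subsolutions.  It does not
  depend on the representative \<open>u\<close>, and agrees with \<open>u\<close> on \<open>\<Omega>\<close> if \<open>u\<close> is continuous there
  and \<open>\<Omega>\<close> is open.
\<close>

definition usc_rep :: "'a::euclidean_space set \<Rightarrow> ('a \<Rightarrow> real) \<Rightarrow> 'a \<Rightarrow> ereal" where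
  "usc_rep \<Omega> u x = (INF r\<in>{0<..}. esssup (lebesgue_on (ball x r \<inter> \<Omega>)) (\<lambda>y. ereal (u y)))"

end

theory Submission
  imports Defs
begin

text \<open>
  A radial function \<open>v\<close> behaving like \<open>|x|\<^sup>-\<^sup>\<gamma>\<close> with \<open>\<gamma> = \<gamma>\<^sub>2\<close> is a supersolution of the equation with
  \<open>f\<close> replaced by its bound \<open>A|x|\<^sup>-\<^sup>\<alpha>\<close>, and after scaling it exceeds \<open>u\<close> near the sphere of radius \<open>R\<^sub>1\<close>.
  With \<open>t = u / v\<close>, test the inequality for \<open>u\<close> with \<open>u H(t) \<eta>\<close> and that for \<open>v\<close> with \<open>v t\<^sup>p H(t) \<eta>\<close>,
  where \<open>H\<close> is bounded, increasing for \<open>t > 1\<close> and zero for \<open>t \<le> 1\<close>, and \<open>\<eta>\<close> is a cutoff at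
  infinity.  The zeroth order terms have the favourable sign; the gradient terms are the sum of
  \<open>H\<close> times a Picone expression and of \<open>t H'(t)\<close> times the monotonicity expression of the
  \<open>p\<close>-Laplacian, hence nonnegative; the terms with \<open>\<nabla>\<eta>\<close> vanish in the limit because
  \<open>u \<in> L\<^sup>q\<close> for the critical exponent \<open>q\<close> and \<open>\<nabla>u \<in> L\<^sup>p\<close>.  So \<open>\<nabla>t = 0\<close> where \<open>t > 1\<close>, and
  as \<open>t < 1\<close> near the sphere, \<open>u \<le> v\<close>.  No local boundedness of \<open>u\<close> is needed, since the claim is
  trivial if the supremum over the sphere is infinite.
\<close>


section \<open>Smooth mollifiers\<close>

text \<open>The pure power with exponent \<open>\<gamma>\<^sub>2\<close> solves the equation with f
  = 0 exactly, which leaves nothing to absorb f. The barrier therefore has logarithmic slope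
  \<open>\<gamma>\<^sub>2 - k * r powr (- \<beta>)\<close> with \<beta> = \<alpha> - p: the
  derivative of the slope yields a term v^(p-1) r^(-\<alpha>), exactly the order of the bound on f,
  and k is matched to A. The price is a factor between 0 and 1 that tends to 1 at infinity. The
  obstacle is that u is merely a Sobolev function. A test function has the form zeta(|x|) Q(u / v),
  with u mollified first; Q vanishes for t <= 1, hence near the sphere, and the limit is taken under
  a majorant built from |u|^s and |grad u|^p. This is where the bound on H enters: u H(t) grows
  linearly in u, while t^p H(t) is paired only with the explicit flux of v. That grad t = 0 on {t >
  1} excludes t > 1 altogether is again shown by a test function: a radial field x z(|x|), whose
  divergence is negative inside a ball, is paired with \<open>excess t\<close>, and integration by
  parts leaves an integrand of one sign.\<close>

lemma C_diff_SucD: "C_diff (Suc k) \<phi> \<Longrightarrow> C_diff k \<phi>"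
proof (induction k arbitrary: \<phi>)
  case 0
  then show ?case
    by (auto intro!: differentiable_imp_continuous_on simp: differentiable_on_def
        intro: differentiable_at_withinI)
next
  case (Suc k)
  then show ?case by (metis C_diff.simps(2))
qed

lemma C_diff_continuous: "C_diff k \<phi> \<Longrightarrow> continuous_on UNIV \<phi>"
  by (induction k) (use C_diff_SucD C_diff.simps(1) in blast)+

lemma frechet_derivative_eqI:
  "(\<phi> has_derivative f') (at x) \<Longrightarrow> frechet_derivative \<phi> (at x) i = f' i"
  using frechet_derivative_at by metis

lemma C_diff_SucI:
  assumes "\<And>x. (\<phi> has_derivative f' x) (at x)" and "\<And>i. i \<in> Basis \<Longrightarrow> C_diff k (\<lambda>x. f' x i)"
  shows "C_diff (Suc k) \<phi>"
proof -
  have "(\<lambda>x. frechet_derivative \<phi> (at x) i) = (\<lambda>x. f' x i)" for i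
    using assms(1) frechet_derivative_eqI by blast
  then show ?thesis using assms by (auto simp: differentiable_def)
qed

lemma C_diff_has_derivative:
  "C_diff (Suc k) \<phi> \<Longrightarrow> (\<phi> has_derivative frechet_derivative \<phi> (at x)) (at x)"
  by (simp add: frechet_derivative_works)

lemma C_diff_const [simp]: "C_diff k (\<lambda>x. c)"
  by (induction k arbitrary: c) (auto intro!: C_diff_SucI derivative_eq_intros simp del: C_diff.simps(2))

lemma C_diff_add: "C_diff k \<phi> \<Longrightarrow> C_diff k \<psi> \<Longrightarrow> C_diff k (\<lambda>x. \<phi> x + \<psi> x)"
proof (induction k arbitrary: \<phi> \<psi>)
  case 0
  then show ?case by (auto intro: continuous_on_add)
next
  case (Suc k)
  show ?case
    by (rule C_diff_SucI[OF has_derivative_add[OF C_diff_has_derivative[OF Suc.prems(1)]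
            C_diff_has_derivative[OF Suc.prems(2)]]]) (use Suc in auto)
qed

lemma C_diff_mult: "C_diff k \<phi> \<Longrightarrow> C_diff k \<psi> \<Longrightarrow> C_diff k (\<lambda>x. \<phi> x * \<psi> x)"
proof (induction k arbitrary: \<phi> \<psi>)
  case 0
  then show ?case by (auto intro: continuous_on_mult)
next
  case (Suc k)
  show ?case
  proof (rule C_diff_SucI[OF has_derivative_mult[OF C_diff_has_derivative[OF Suc.prems(1)]
            C_diff_has_derivative[OF Suc.prems(2)]]])
    fix i :: 'a assume "i \<in> Basis"
    then show "C_diff k (\<lambda>x. \<phi> x * frechet_derivative \<psi> (at x) i + frechet_derivative \<phi> (at x) i * \<psi> x)"
      using Suc.prems Suc.prems[THEN C_diff_SucD] by (intro C_diff_add Suc.IH) auto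
  qed
qed

lemma C_diff_inner_left: "C_diff k (\<lambda>x. (x - a) \<bullet> i)"
proof (cases k)
  case 0
  then show ?thesis by (auto intro!: continuous_intros)
next
  case (Suc m)
  have "C_diff (Suc m) (\<lambda>x. (x - a) \<bullet> i)"
  proof (rule C_diff_SucI[where f' = "\<lambda>x h. h \<bullet> i"])
    show "((\<lambda>x. (x - a) \<bullet> i) has_derivative (\<lambda>h. h \<bullet> i)) (at x)" for x
      by (auto intro!: derivative_eq_intros)
  qed simp
  with Suc show ?thesis by simp
qed

section \<open>Flat exponentials, bump functions and normalised kernels\<close>

definition flat_exp :: "nat \<Rightarrow> real \<Rightarrow> real" where
  "flat_exp m t = (if t > 0 then exp (- (1 / t)) / t ^ m else 0)"

text \<open>A single term of the exponential series suffices: exp (1 / t) is at least its term of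
  index m + 2. The two surplus powers of t make the difference quotient at 0 vanish for every
  m.\<close>

lemma flat_exp_le: "\<bar>flat_exp m t\<bar> \<le> fact (m + 2) * t\<^sup>2"
proof (cases "t > 0")
  case True
  have "(1 / t) ^ (m + 2) / fact (m + 2) \<le> exp (1 / t)"
    using sum_le_suminf[OF summable_exp_generic, of "{m + 2}" "1 / t"] True
    by (simp add: exp_def divide_inverse mult.commute del: fact_Suc)
  moreover define F :: real where "F = fact (m + 2)"
  ultimately have "1 / (F * t ^ (m + 2)) \<le> exp (1 / t)" "F > 0"
    by (simp_all add: power_divide mult.commute del: fact_Suc)
  then have "exp (- (1 / t)) \<le> F * t ^ (m + 2)"
    using True by (simp add: exp_minus divide_simps mult.commute del: power_Suc)
  then have "exp (- (1 / t)) / t ^ m \<le> F * t ^ (m + 2) / t ^ m"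
    using True by (intro divide_right_mono) auto
  then show ?thesis using True by (simp add: flat_exp_def power_add F_def power2_eq_square mult.assoc)
next
  case False
  then show ?thesis by (simp add: flat_exp_def)
qed

text \<open>Differentiation maps the family into its own span, which is why \<open>flat_exp\<close>
  carries the exponent m. At t = 0 both sides are 0 by the quadratic bound.\<close>

lemma DERIV_flat_exp:
  "(flat_exp m has_real_derivative flat_exp (m + 2) t - real m * flat_exp (m + 1) t) (at t)"
proof -
  consider "t > 0" | "t < 0" | "t = 0" by linarith
  then show ?thesis
  proof cases
    case 1
    have "((\<lambda>t. exp (- (1 / t)) * (1 / t) ^ m) has_real_derivative
        exp (- (1 / t)) * (1 / t)\<^sup>2 * (1 / t) ^ m
          + exp (- (1 / t)) * (real m * (1 / t) ^ (m - 1) * - ((1 / t)\<^sup>2))) (at t)"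
    proof -
      have "((\<lambda>t. 1 / t) has_real_derivative - ((1 / t)\<^sup>2)) (at t)"
        using 1 by (auto intro!: derivative_eq_intros simp: power2_eq_square)
      note d = this
      show ?thesis
        using DERIV_mult[OF DERIV_fun_exp[OF DERIV_minus[OF d]] DERIV_power[OF d, of m]] 1
        by (simp add: mult_ac add.commute)
    qed
    also have "exp (- (1 / t)) * (1 / t)\<^sup>2 * (1 / t) ^ m
        + exp (- (1 / t)) * (real m * (1 / t) ^ (m - 1) * - ((1 / t)\<^sup>2))
        = flat_exp (m + 2) t - real m * flat_exp (m + 1) t"
    proof (cases m)
      case 0
      then show ?thesis using 1 by (simp add: flat_exp_def power_divide power2_eq_square)
    next
      case (Suc k)
      then show ?thesis using 1 by (simp add: flat_exp_def power_divide power2_eq_square mult_ac)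
    qed
    finally have "((\<lambda>t. exp (- (1 / t)) / t ^ m) has_real_derivative
        flat_exp (m + 2) t - real m * flat_exp (m + 1) t) (at t)"
      by (simp add: power_divide)
    then show ?thesis
      by (rule has_field_derivative_transform_within_open[where S = "{0<..}"])
        (use 1 in \<open>auto simp: flat_exp_def\<close>)
  next
    case 2
    have "((\<lambda>t. 0) has_real_derivative flat_exp (m + 2) t - real m * flat_exp (m + 1) t) (at t)"
      using 2 by (auto simp: flat_exp_def)
    then show ?thesis
      by (rule has_field_derivative_transform_within_open[where S = "{..<0}"])
        (use 2 in \<open>auto simp: flat_exp_def\<close>)
  next
    case 3
    have "((\<lambda>h. flat_exp m h / h) \<longlongrightarrow> 0) (at 0)"
    proof (rule Lim_null_comparison)
      have "norm (flat_exp m h / h) \<le> fact (m + 2) * \<bar>h\<bar>" if "h \<noteq> 0" for h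
        using flat_exp_le[of m h] that
        by (simp add: abs_divide divide_le_eq power2_eq_square mult.assoc del: fact_Suc flip: abs_mult)
      then show "\<forall>\<^sub>F h in at 0. norm (flat_exp m h / h) \<le> fact (m + 2) * \<bar>h\<bar>"
        by (auto simp: eventually_at_filter)
      show "((\<lambda>h. fact (m + 2) * \<bar>h\<bar>) \<longlongrightarrow> (0::real)) (at 0)"
        by (auto intro!: tendsto_eq_intros)
    qed
    then show ?thesis using 3 by (simp add: DERIV_def flat_exp_def)
  qed
qed

text \<open>The induction runs over all m at once, since each derivative raises m. The argument
  involves the squared distance, a polynomial, so the centre a is no exceptional point.\<close>

lemma C_diff_flat_exp:
  "C_diff k (\<lambda>x::'a::euclidean_space. flat_exp m (c - (x - a) \<bullet> (x - a)))"
proof (induction k arbitrary: m)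
  case 0
  have "continuous_on UNIV (flat_exp m)"
    by (rule DERIV_continuous_on[OF has_field_derivative_at_within[OF DERIV_flat_exp]])
  then show ?case
    by (auto intro!: continuous_on_compose2[of UNIV "flat_exp m"] continuous_intros)
next
  case (Suc k)
  let ?s = "\<lambda>x::'a. c - (x - a) \<bullet> (x - a)"
  let ?f = "\<lambda>x. flat_exp (m + 2) (?s x) + (- real m) * flat_exp (m + 1) (?s x)"
  show ?case
  proof (rule C_diff_SucI[where f' = "\<lambda>x h. ?f x * (-2 * ((x - a) \<bullet> h))"])
    fix x :: 'a
    have "(?s has_derivative (\<lambda>h. -2 * ((x - a) \<bullet> h))) (at x)"
      by (auto intro!: derivative_eq_intros simp: inner_commute)
    from has_derivative_compose[OF this DERIV_flat_exp[unfolded has_field_derivative_def]]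
    show "((\<lambda>x. flat_exp m (?s x)) has_derivative (\<lambda>h. ?f x * (-2 * ((x - a) \<bullet> h)))) (at x)"
      by (simp add: algebra_simps)
  next
    fix i :: 'a
    show "C_diff k (\<lambda>x. ?f x * (-2 * ((x - a) \<bullet> i)))"
      by (rule C_diff_mult[OF C_diff_add[OF Suc.IH C_diff_mult[OF C_diff_const Suc.IH]]
            C_diff_mult[OF C_diff_const C_diff_inner_left]])
  qed
qed

definition bump :: "real \<Rightarrow> 'a::euclidean_space \<Rightarrow> real" where
  "bump r x = flat_exp 0 (r\<^sup>2 - x \<bullet> x)"

lemma bump_nonneg: "0 \<le> bump r x"
  by (simp add: bump_def flat_exp_def)

lemma bump_eq_0: "r > 0 \<Longrightarrow> r \<le> norm x \<Longrightarrow> bump r x = 0"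
  by (auto simp: bump_def flat_exp_def dot_square_norm not_less intro: power_mono)

lemma continuous_on_bump: "continuous_on A (bump r)"
  using C_diff_continuous[OF C_diff_flat_exp[of 0 0 "r\<^sup>2" 0]] continuous_on_subset
  by (fastforce simp: bump_def[abs_def])

lemma integrable_continuous_compact_support:
  fixes f :: "'a::euclidean_space \<Rightarrow> 'b::{banach,second_countable_topology}"
  assumes "continuous_on UNIV f" and "\<And>x. r \<le> norm x \<Longrightarrow> f x = 0"
  shows "integrable lborel f"
proof -
  have "integrable lborel (\<lambda>x. indicator (cball 0 r) x *\<^sub>R f x)"
    using borel_integrable_compact[of "cball 0 r" f] assms(1) continuous_on_subset
    by (auto simp: set_integrable_def)
  also have "(\<lambda>x. indicator (cball 0 r) x *\<^sub>R f x) = f"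
    using assms(2) by (force simp: indicator_def)
  finally show ?thesis .
qed

lemma integral_bump_pos:
  assumes "r > 0" shows "0 < integral\<^sup>L lborel (bump r :: 'a::euclidean_space \<Rightarrow> real)"
proof (rule ccontr)
  let ?b = "bump r :: 'a \<Rightarrow> real"
  have i: "integrable lborel ?b"
    using integrable_continuous_compact_support continuous_on_bump bump_eq_0[OF assms] by blast
  assume "\<not> ?thesis"
  then have "integral\<^sup>L lborel ?b = 0"
    by (smt (verit) Bochner_Integration.integral_nonneg bump_nonneg)
  then have "AE x in lborel. ?b x = 0"
    using integral_nonneg_eq_0_iff_AE[OF i] bump_nonneg by auto
  then have "AE x in lborel. x \<notin> ball (0::'a) r"
    by eventually_elim (auto simp: bump_def flat_exp_def dot_square_norm power_strict_mono split: if_splits)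
  then have "ball (0::'a) r \<in> null_sets lborel"
    by (subst AE_iff_null_sets) auto
  then have "negligible (ball (0::'a) r)"
    by (simp add: negligible_iff_null_sets null_sets_completionI)
  then show False using open_not_negligible[of "ball (0::'a) r"] assms by simp
qed

text \<open>The radius enters the profile itself instead of rescaling one fixed kernel, and the mass
  is normalised for each r separately. What matters is smoothness, unit mass, nonnegativity,
  evenness and support in the ball of radius r.\<close>

definition mollifier :: "real \<Rightarrow> 'a::euclidean_space \<Rightarrow> real" where
  "mollifier r x = bump r x / integral\<^sup>L lborel (bump r :: 'a \<Rightarrow> real)"

lemma mollifier_nonneg: "r > 0 \<Longrightarrow> 0 \<le> mollifier r x"
  unfolding mollifier_def by (intro divide_nonneg_pos bump_nonneg integral_bump_pos)

lemma mollifier_eq_0: "r > 0 \<Longrightarrow> r \<le> norm x \<Longrightarrow> mollifier r x = 0"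
  by (simp add: mollifier_def bump_eq_0)

lemma integral_mollifier: "r > 0 \<Longrightarrow> integral\<^sup>L lborel (mollifier r :: 'a::euclidean_space \<Rightarrow> real) = 1"
  unfolding mollifier_def using integral_bump_pos[of r, where 'a='a] by simp

lemma C_diff_mollifier: "C_diff k (mollifier r)"
proof -
  have "C_diff k (\<lambda>x::'a. flat_exp 0 (r\<^sup>2 - (x - 0) \<bullet> (x - 0)) * (1 / integral\<^sup>L lborel (bump r :: 'a \<Rightarrow> real)))"
    by (rule C_diff_mult[OF C_diff_flat_exp C_diff_const])
  then show ?thesis by (simp add: mollifier_def[abs_def] bump_def)
qed

lemma mollifier_minus: "mollifier r (- x) = mollifier r x"
  by (simp add: mollifier_def bump_def)

lemma C_diff_mollifier_shift: "C_diff k (\<lambda>y. mollifier r (a - y))"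
proof -
  have "C_diff k (\<lambda>x::'a. flat_exp 0 (r\<^sup>2 - (x - a) \<bullet> (x - a)) * (1 / integral\<^sup>L lborel (bump r :: 'a \<Rightarrow> real)))"
    by (rule C_diff_mult[OF C_diff_flat_exp C_diff_const])
  moreover have "(a - y) \<bullet> (a - y) = (y - a) \<bullet> (y - a)" for y
    by (simp add: inner_diff_left inner_diff_right)
  ultimately show ?thesis by (simp add: mollifier_def[abs_def] bump_def)
qed

lemma borel_measurable_mollifier [measurable]: "mollifier r \<in> borel_measurable borel"
  using C_diff_continuous[OF C_diff_mollifier] borel_measurable_continuous_onI by blast

lemma integrable_mollifier: "r > 0 \<Longrightarrow> integrable lborel (mollifier r)"
  using integrable_continuous_compact_support C_diff_continuous[OF C_diff_mollifier] mollifier_eq_0 by blast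

section \<open>Convolution and integration by parts\<close>

text \<open>The gradient is a second argument, so that explicit formulas coming from product,
  quotient and chain rules can be carried along and glued.\<close>

definition C1_grad :: "('a::euclidean_space \<Rightarrow> real) \<Rightarrow> ('a \<Rightarrow> 'a) \<Rightarrow> bool" where
  "C1_grad w W \<longleftrightarrow> (\<forall>x. (w has_derivative (\<lambda>h. W x \<bullet> h)) (at x)) \<and> continuous_on UNIV W"

lemma C1_gradD:
  assumes "C1_grad w W"
  shows "(w has_derivative (\<lambda>h. W x \<bullet> h)) (at x)" "continuous_on A W" "continuous_on A w"
proof -
  show d: "(w has_derivative (\<lambda>h. W x \<bullet> h)) (at x)" for x
    using assms by (simp add: C1_grad_def)
  show "continuous_on A W"
    using assms continuous_on_subset by (auto simp: C1_grad_def)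
  show "continuous_on A w"
    by (intro continuous_at_imp_continuous_on ballI has_derivative_continuous[OF d])
qed

lemma grad_eqI: "(w has_derivative (\<lambda>h. W \<bullet> h)) (at x) \<Longrightarrow> grad w x = W"
  by (simp add: grad_def frechet_derivative_eqI[where f' = "\<lambda>h. W \<bullet> h"] euclidean_representation)

lemma C1_grad_grad:
  assumes "C_diff (Suc 0) \<phi>" shows "C1_grad \<phi> (grad \<phi>)"
proof -
  have "frechet_derivative \<phi> (at x) = (\<lambda>h. grad \<phi> x \<bullet> h)" for x
  proof
    fix h :: 'a
    interpret linear "frechet_derivative \<phi> (at x)"
      using C_diff_has_derivative[OF assms] has_derivative_linear by blast
    have "frechet_derivative \<phi> (at x) h = frechet_derivative \<phi> (at x) (\<Sum>i\<in>Basis. (h \<bullet> i) *\<^sub>R i)"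
      by (simp add: euclidean_representation)
    also have "\<dots> = grad \<phi> x \<bullet> h"
      unfolding sum scale grad_def
      by (subst euclidean_inner) (simp add: mult.commute inner_sum_left inner_Basis sum.delta if_distrib cong: if_cong)
    finally show "frechet_derivative \<phi> (at x) h = grad \<phi> x \<bullet> h" .
  qed
  moreover have "continuous_on UNIV (grad \<phi>)"
    unfolding grad_def using assms by (auto intro!: continuous_intros)
  ultimately show ?thesis
    using C_diff_has_derivative[OF assms] by (simp add: C1_grad_def)
qed

lemma compact_support_bounded:
  fixes f :: "'a::euclidean_space \<Rightarrow> 'b::real_normed_vector"
  assumes "continuous_on UNIV f" and "\<And>x. r \<le> norm x \<Longrightarrow> f x = 0"
  obtains B where "B > 0" and "\<And>x. norm (f x) \<le> B"
proof -
  have "bounded (f ` cball 0 r)"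
    using assms(1) compact_continuous_image[of "cball 0 r" f] continuous_on_subset
    by (auto intro: compact_imp_bounded)
  then obtain B where B: "B > 0" "\<And>x. x \<in> cball 0 r \<Longrightarrow> norm (f x) \<le> B"
    by (auto simp: bounded_pos)
  have "norm (f x) \<le> B" for x
    using B assms(2)[of x] by (cases "norm x \<le> r") (auto simp: less_imp_le)
  with B(1) show ?thesis by (rule that)
qed

text \<open>The strict inequality puts x into an open set on which w is 0. Where a closed condition
  is wanted later, the radius is enlarged to r + 1.\<close>

lemma C1_grad_support:
  assumes "C1_grad w W" and "\<And>x. r \<le> norm x \<Longrightarrow> w x = 0" and "r < norm x"
  shows "W x = 0"
proof -
  have "open {x::'a. r < norm x}"
    by (intro open_Collect_less continuous_intros)
  from has_derivative_transform_within_open[OF C1_gradD(1)[OF assms(1)] this, of x "\<lambda>_. 0"]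
  have "((\<lambda>_. 0) has_derivative (\<lambda>h. W x \<bullet> h)) (at x)"
    using assms by auto
  then have "(\<lambda>h. W x \<bullet> h) = (\<lambda>h. 0)"
    using has_derivative_unique has_derivative_const by blast
  then have "W x \<bullet> W x = 0" by meson
  then show ?thesis by simp
qed

text \<open>A first order Taylor expansion with an error uniform in x, by compactness of the
  support. It feeds differentiation under the convolution integral and the difference quotients in
  \<open>integral_grad_eq_0\<close>.\<close>

lemma C1_grad_uniform:
  assumes C: "C1_grad w W" and "\<And>x. r \<le> norm x \<Longrightarrow> w x = 0" and "e > 0"
  shows "\<exists>d>0. \<forall>x y. norm (y - x) < d \<longrightarrow>
    norm (W y - W x) \<le> e \<and> \<bar>w y - w x - W x \<bullet> (y - x)\<bar> \<le> e * norm (y - x)"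
proof -
  have "uniformly_continuous_on (cball 0 (r + 2)) W"
    using C1_gradD(2)[OF C] by (intro compact_uniformly_continuous) auto
  then obtain d0 where d0: "d0 > 0"
    "\<And>x y. x \<in> cball 0 (r + 2) \<Longrightarrow> y \<in> cball 0 (r + 2) \<Longrightarrow> dist y x < d0 \<Longrightarrow> dist (W y) (W x) < e"
    unfolding uniformly_continuous_on_def using \<open>e > 0\<close> by metis
  \<comment> \<open>Steps shorter than 1: either x lies within radius r + 1 and y within r + 2, or
    both lie outside radius r, where W is 0.\<close>
  define d where "d = min d0 1"
  have 1: "norm (W y - W x) \<le> e" if "norm (y - x) < d" for x y
  proof (cases "norm x \<le> r + 1")
    case True
    then have "norm y \<le> r + 2"
      using that norm_triangle_ineq2[of y x] by (simp add: d_def)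
    then show ?thesis
      using d0(2)[of x y] True that by (simp add: d_def dist_norm less_imp_le)
  next
    case False
    then have "r < norm y"
      using that norm_triangle_ineq2[of x y] by (simp add: d_def norm_minus_commute)
    then show ?thesis
      using C1_grad_support[OF C assms(2)] False \<open>e > 0\<close> by simp
  qed
  have "\<bar>w y - w x - W x \<bullet> (y - x)\<bar> \<le> norm (y - x) * e" if "norm (y - x) < d" for x y
  proof -
    have "norm (w y - w x - W x \<bullet> (y - x)) \<le> norm (y - x) * e"
    proof (rule differentiable_bound_linearization[where S = "ball x d" and f' = "\<lambda>z h. W z \<bullet> h"])
      show "x + t *\<^sub>R (y - x) \<in> ball x d" if "t \<in> {0..1}" for t
      proof -
        have "t * norm (y - x) \<le> norm (y - x)"
          using that by (intro mult_left_le_one_le) auto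
        then show ?thesis
          using that \<open>norm (y - x) < d\<close> by (simp add: dist_norm)
      qed
      show "(w has_derivative (\<lambda>h. W z \<bullet> h)) (at z within ball x d)" for z
        using C1_gradD(1)[OF C] has_derivative_at_withinI by blast
      show "onorm ((\<lambda>h. W z \<bullet> h) - (\<lambda>h. W x \<bullet> h)) \<le> e" if "z \<in> ball x d" for z
      proof (rule onorm_le)
        fix h
        have "norm (((\<lambda>h. W z \<bullet> h) - (\<lambda>h. W x \<bullet> h)) h) = \<bar>(W z - W x) \<bullet> h\<bar>"
          by (simp add: inner_diff_left)
        also have "\<dots> \<le> norm (W z - W x) * norm h" by (rule Cauchy_Schwarz_ineq2)
        also have "\<dots> \<le> e * norm h"
          using 1[of z x] that by (intro mult_right_mono) (auto simp: dist_norm norm_minus_commute)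
        finally show "norm (((\<lambda>h. W z \<bullet> h) - (\<lambda>h. W x \<bullet> h)) h) \<le> e * norm h" .
      qed
      show "x \<in> ball x d" using d0(1) by (simp add: d_def)
    qed
    then show ?thesis by simp
  qed
  with 1 show ?thesis
    by (intro exI[of _ d]) (use d0(1) in \<open>auto simp: d_def mult.commute\<close>)
qed

section \<open>Convolution with a compactly supported kernel\<close>

lemma integrable_const_cball: "integrable lborel (\<lambda>x::'a::euclidean_space. (c::real) * indicator (cball a r) x)"
  by (intro integrable_mult_right integrable_real_indicator emeasure_lborel_cball_finite) auto

text \<open>The kernel is scalar and the convolved function may be vector valued, so that a function
  and its gradient are smoothed by the same operator.\<close>

definition conv :: "('a::euclidean_space \<Rightarrow> real) \<Rightarrow> ('a \<Rightarrow> 'b::euclidean_space) \<Rightarrow> 'a \<Rightarrow> 'b" where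
  "conv K h x = (\<integral>y. K (x - y) *\<^sub>R h y \<partial>lborel)"

lemma integrable_conv:
  fixes h :: "'a::euclidean_space \<Rightarrow> 'b::euclidean_space"
  assumes "continuous_on UNIV K" and "\<And>x. r \<le> norm x \<Longrightarrow> K x = 0" and h: "integrable lborel h"
  shows "integrable lborel (\<lambda>y. K (x - y) *\<^sub>R h y)"
proof -
  have [measurable]: "K \<in> borel_measurable borel"
    using assms(1) borel_measurable_continuous_onI by blast
  obtain B where B: "B > 0" "\<And>x. norm (K x) \<le> B"
    using compact_support_bounded[OF assms(1,2)] by blast
  have [measurable]: "h \<in> borel_measurable borel" using h by auto
  show ?thesis
    by (rule Bochner_Integration.integrable_bound[of _ "\<lambda>y. B *\<^sub>R h y"])
      (use h B in \<open>auto intro!: mult_right_mono order_trans[OF B(2)]\<close>)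
qed

text \<open>The increment of the kernel is replaced by its linear part at a cost uniform in y; the
  total error is this cost times the L1 norm of h.\<close>

lemma conv_has_derivative:
  fixes h :: "'a::euclidean_space \<Rightarrow> real"
  assumes C: "C1_grad K G" and K0: "\<And>x. r \<le> norm x \<Longrightarrow> K x = 0" and h: "integrable lborel h"
  shows "(conv K h has_derivative (\<lambda>d. (\<integral>y. h y *\<^sub>R G (x - y) \<partial>lborel) \<bullet> d)) (at x)"
proof -
  have G0: "G x = 0" if "r + 1 \<le> norm x" for x
    using C1_grad_support[OF C K0] that by auto
  have Gc: "continuous_on UNIV G" using C1_gradD(2)[OF C] .
  have [measurable]: "G \<in> borel_measurable borel" "h \<in> borel_measurable borel"
    using Gc borel_measurable_continuous_onI h by auto
  obtain B where B: "B > 0" "\<And>x. norm (G x) \<le> B"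
    using compact_support_bounded[OF Gc G0] by blast
  have iG: "integrable lborel (\<lambda>y. h y *\<^sub>R G (x - y))" for x
    by (rule Bochner_Integration.integrable_bound[of _ "\<lambda>y. B *\<^sub>R h y"])
      (use h B in \<open>auto intro!: AE_I2 mult_left_mono simp: abs_mult mult.commute[of B]\<close>)
  have iK: "integrable lborel (\<lambda>y. K (x - y) * h y)" for x
    using integrable_conv[OF C1_gradD(3)[OF C] K0 h] by simp
  have iGd: "integrable lborel (\<lambda>y. h y * (G (x - y) \<bullet> d))" for x d
    using integrable_inner_left[of d lborel "\<lambda>y. h y *\<^sub>R G (x - y)"] iG by simp
  let ?I = "\<integral>y. \<bar>h y\<bar> \<partial>lborel"
  have I: "?I \<ge> 0" by simp
  show ?thesis
    unfolding has_derivative_at_alt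
  proof (intro conjI allI impI bounded_linear_inner_right)
    fix e :: real assume "e > 0"
    define e' where "e' = e / (1 + ?I)"
    have e': "e' > 0" using \<open>e > 0\<close> unfolding e'_def by (intro divide_pos_pos add_pos_nonneg I) auto
    obtain d where d: "d > 0"
      "\<And>x y. norm (y - x) < d \<Longrightarrow> \<bar>K y - K x - G x \<bullet> (y - x)\<bar> \<le> e' * norm (y - x)"
      using C1_grad_uniform[OF C K0 e'] by metis
    show "\<exists>d>0. \<forall>y. norm (y - x) < d \<longrightarrow>
        norm (conv K h y - conv K h x - (\<integral>y. h y *\<^sub>R G (x - y) \<partial>lborel) \<bullet> (y - x)) \<le> e * norm (y - x)"
    proof (intro exI[of _ d] conjI d(1) allI impI)
      fix z assume z: "norm (z - x) < d"
      have eq: "conv K h z - conv K h x - (\<integral>y. h y *\<^sub>R G (x - y) \<partial>lborel) \<bullet> (z - x)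
          = (\<integral>y. (K (z - y) - K (x - y) - G (x - y) \<bullet> (z - x)) * h y \<partial>lborel)"
        unfolding conv_def
        using iK[of z] iK[of x] iG[of x] iGd[of x "z - x"]
        by (simp add: left_diff_distrib mult.commute[of _ "h _"] right_diff_distrib flip: integral_inner_left)
      have i2: "integrable lborel (\<lambda>y. (K (z - y) - K (x - y) - G (x - y) \<bullet> (z - x)) * h y)"
        using iK[of z] iK[of x] iGd[of x "z - x"]
        by (simp add: right_diff_distrib mult.commute[of _ "h _"])
      have "norm (\<integral>y. (K (z - y) - K (x - y) - G (x - y) \<bullet> (z - x)) * h y \<partial>lborel)
          \<le> (\<integral>y. e' * norm (z - x) * \<bar>h y\<bar> \<partial>lborel)"
      proof (rule Bochner_Integration.integral_norm_bound_integral[OF i2])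
        show "integrable lborel (\<lambda>y. e' * norm (z - x) * \<bar>h y\<bar>)" using h by simp
        fix y
        show "norm ((K (z - y) - K (x - y) - G (x - y) \<bullet> (z - x)) * h y) \<le> e' * norm (z - x) * \<bar>h y\<bar>"
          using d(2)[of "z - y" "x - y"] z by (auto simp: abs_mult intro!: mult_right_mono)
      qed
      also have "\<dots> = (e' * ?I) * norm (z - x)" by simp
      also have "\<dots> \<le> e * norm (z - x)"
      proof (intro mult_right_mono norm_ge_zero)
        have "1 + ?I > 0" using I by linarith
        then have "e' * (1 + ?I) = e" by (simp add: e'_def)
        then show "e' * ?I \<le> e" using e' by (simp add: distrib_left)
      qed
      finally show "norm (conv K h z - conv K h x - (\<integral>y. h y *\<^sub>R G (x - y) \<partial>lborel) \<bullet> (z - x))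
          \<le> e * norm (z - x)" unfolding eq .
    qed
  qed
qed

text \<open>All derivatives fall on the kernel. Each partial derivative of K is again a smooth
  kernel, supported in radius r + 1, and the induction continues with it in place of K.\<close>

lemma C_diff_conv:
  fixes h :: "'a::euclidean_space \<Rightarrow> real"
  assumes "\<And>k. C_diff k K" and "\<And>x. r \<le> norm x \<Longrightarrow> K x = 0" and h: "integrable lborel h"
  shows "C_diff k (conv K h)"
  using assms(1,2)
proof (induction k arbitrary: K r)
  case 0
  have "continuous_on UNIV (conv K h)"
    by (intro continuous_at_imp_continuous_on ballI
        has_derivative_continuous[OF conv_has_derivative[OF C1_grad_grad[OF 0(1)] 0(2) h]])
  then show ?case by simp
next
  case (Suc k)
  have C: "C1_grad K (grad K)" using C1_grad_grad Suc.prems(1) by blast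
  show ?case
  proof (rule C_diff_SucI)
    show "(conv K h has_derivative (\<lambda>d. (\<integral>y. h y *\<^sub>R grad K (x - y) \<partial>lborel) \<bullet> d)) (at x)" for x
      using conv_has_derivative[OF C Suc.prems(2) h] .
    fix i :: 'a assume i: "i \<in> Basis"
    have eq: "(\<lambda>z. grad K z \<bullet> i) = (\<lambda>z. frechet_derivative K (at z) i)"
      using frechet_derivative_eqI[OF C1_gradD(1)[OF C]] by auto
    have G0: "grad K x = 0" if "r + 1 \<le> norm x" for x
      using C1_grad_support[OF C Suc.prems(2)] that by auto
    have Gc: "continuous_on UNIV (grad K)" using C1_gradD(2)[OF C] .
    have "integrable lborel (\<lambda>y. (grad K (x - y) \<bullet> j) * h y)" if "j \<in> Basis" for x j
      using integrable_conv[of "\<lambda>z. grad K z \<bullet> j" "r + 1" h x] Gc G0 h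
      by (simp add: continuous_on_inner continuous_on_const)
    then have "integrable lborel (\<lambda>y. \<Sum>j\<in>Basis. ((grad K (x - y) \<bullet> j) * h y) *\<^sub>R j)" for x
      by (intro Bochner_Integration.integrable_sum) auto
    moreover have "(\<Sum>j\<in>Basis. ((grad K (x - y) \<bullet> j) * h y) *\<^sub>R j) = h y *\<^sub>R grad K (x - y)" for x y
      by (subst euclidean_representation[of "grad K (x - y)", symmetric])
        (simp add: scaleR_sum_right mult.commute del: euclidean_representation)
    ultimately have "integrable lborel (\<lambda>y. h y *\<^sub>R grad K (x - y))" for x by simp
    then have "(\<lambda>x. (\<integral>y. h y *\<^sub>R grad K (x - y) \<partial>lborel) \<bullet> i) = conv (\<lambda>z. grad K z \<bullet> i) h"
      by (auto simp: conv_def mult.commute simp flip: integral_inner_left)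
    moreover have "C_diff k (conv (\<lambda>z. grad K z \<bullet> i) h)"
    proof (rule Suc.IH)
      show "C_diff m (\<lambda>z. grad K z \<bullet> i)" for m
        using Suc.prems(1)[of "Suc m"] i by (simp add: eq)
      show "grad K x \<bullet> i = 0" if "r + 1 \<le> norm x" for x using G0[OF that] by simp
    qed
    ultimately show "C_diff k (\<lambda>x. (\<integral>y. h y *\<^sub>R grad K (x - y) \<partial>lborel) \<bullet> i)" by simp
  qed
qed

section \<open>Translation invariance and integration by parts\<close>

lemma integral_lborel_translate:
  fixes f :: "'a::euclidean_space \<Rightarrow> 'b::euclidean_space"
  assumes "f \<in> borel_measurable borel"
  shows "(\<integral>x. f (a + x) \<partial>lborel) = integral\<^sup>L lborel f"
proof -
  have "integral\<^sup>L lborel f = integral\<^sup>L (distr lborel borel ((+) a)) f"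
    by (simp add: lborel_distr_plus)
  also have "\<dots> = (\<integral>x. f (a + x) \<partial>lborel)"
    using assms by (intro integral_distr) auto
  finally show ?thesis by simp
qed

lemma integral_lborel_reflect:
  fixes f :: "'a::euclidean_space \<Rightarrow> 'b::euclidean_space"
  assumes [measurable]: "f \<in> borel_measurable borel"
  shows "(\<integral>x. f (a - x) \<partial>lborel) = integral\<^sup>L lborel f"
proof -
  have "(\<integral>x. f (a - x) \<partial>lborel) = integral\<^sup>L (distr lborel borel uminus) (\<lambda>x. f (a + x))"
    by (subst integral_distr) auto
  also have "distr lborel borel uminus = (lborel :: 'a measure)"
    using lborel_affine[of "-1" "0::'a"] by (simp add: density_1)
  finally show ?thesis using integral_lborel_translate[OF assms] by simp
qed

lemma conv_commute:
  fixes h :: "'a::euclidean_space \<Rightarrow> real"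
  assumes [measurable]: "K \<in> borel_measurable borel" "h \<in> borel_measurable borel"
  shows "conv K h x = conv h K x"
  unfolding conv_def
  using integral_lborel_reflect[of "\<lambda>y. h (x - y) * K y" x] by (simp add: mult.commute)

text \<open>By translation invariance the integral of w(x + s i) - w(x) is 0. Its Taylor expansion
  is s times the integral of W . i up to an error that is o(s) uniformly and supported in a fixed
  ball; dividing by s gives the claim.\<close>

lemma integral_grad_eq_0:
  assumes C: "C1_grad w W" and w0: "\<And>x. r \<le> norm x \<Longrightarrow> w x = 0"
  shows "(\<integral>x. W x \<bullet> i \<partial>lborel) = 0"
proof -
  have wc: "continuous_on UNIV w" and Wc: "continuous_on UNIV W" using C1_gradD[OF C] by auto
  have W0: "W x = 0" if "r + 1 \<le> norm x" for x
    using C1_grad_support[OF C w0] that by auto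
  have [measurable]: "w \<in> borel_measurable borel" "W \<in> borel_measurable borel"
    using wc Wc borel_measurable_continuous_onI by blast+
  have iw: "integrable lborel w" using integrable_continuous_compact_support[OF wc w0] .
  have iW: "integrable lborel (\<lambda>x. W x \<bullet> i)"
    using integrable_continuous_compact_support[OF Wc W0] by simp
  have "norm (\<integral>x. W x \<bullet> i \<partial>lborel) \<le> e" if "e > 0" for e
  proof -
    \<comment> \<open>The ball contains the supports of w, of W and of every translate of w by
      \<open>s *\<^sub>R i\<close> with s at most 1; c is the factor that the uniform Taylor error
      picks up on integration.\<close>
    define c where "c = measure lborel (cball (0::'a) (r + norm i + 2)) * norm i"
    have c: "c \<ge> 0" by (simp add: c_def)
    define e' where "e' = e / (1 + c)"
    have e': "e' > 0" using that c by (simp add: e'_def)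
    obtain d where d: "d > 0"
      "\<And>x y. norm (y - x) < d \<Longrightarrow> \<bar>w y - w x - W x \<bullet> (y - x)\<bar> \<le> e' * norm (y - x)"
      using C1_grad_uniform[OF C w0 e'] by metis
    define s where "s = min 1 (d / (1 + norm i)) / 2"
    have s: "s > 0" "s \<le> 1" using d(1) by (auto simp: s_def add_pos_nonneg)
    have "s * (1 + norm i) < d"
    proof -
      have "s < d / (1 + norm i)"
        using d(1) by (auto simp: s_def min_def add_pos_nonneg divide_simps)
      then show ?thesis by (simp add: pos_less_divide_eq add_pos_nonneg)
    qed
    then have sd: "s * norm i < d" using s by (simp add: algebra_simps)
    have iw': "integrable lborel (\<lambda>x. w (s *\<^sub>R i + x))"
    proof (rule integrable_continuous_compact_support)
      show "continuous_on UNIV (\<lambda>x. w (s *\<^sub>R i + x))"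
        by (intro continuous_on_compose2[OF wc] continuous_intros) auto
      show "w (s *\<^sub>R i + x) = 0" if "r + norm i \<le> norm x" for x
      proof (rule w0)
        have "norm (s *\<^sub>R i) \<le> norm i" using s by (simp add: mult_left_le_one_le)
        then show "r \<le> norm (s *\<^sub>R i + x)"
          using that norm_triangle_ineq2[of x "- (s *\<^sub>R i)"] by (simp add: add.commute)
      qed
    qed
    have "s * (\<integral>x. W x \<bullet> i \<partial>lborel)
        = - (\<integral>x. w (s *\<^sub>R i + x) - w x - s * (W x \<bullet> i) \<partial>lborel)"
      using iw iw' iW integral_lborel_translate[of w "s *\<^sub>R i"] by simp
    also have "norm \<dots> \<le> (\<integral>x. e' * s * norm i * indicator (cball (0::'a) (r + norm i + 2)) x \<partial>lborel)"
      unfolding norm_minus_cancel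
    proof (rule Bochner_Integration.integral_norm_bound_integral)
      show "integrable lborel (\<lambda>x. w (s *\<^sub>R i + x) - w x - s * (W x \<bullet> i))"
        using iw iw' iW by simp
      show "integrable lborel (\<lambda>x::'a. e' * s * norm i * indicator (cball 0 (r + norm i + 2)) x)"
        by (rule integrable_const_cball)
      fix x :: 'a
      show "norm (w (s *\<^sub>R i + x) - w x - s * (W x \<bullet> i)) \<le> e' * s * norm i * indicator (cball 0 (r + norm i + 2)) x"
      proof (cases "norm x \<le> r + norm i + 2")
        case True
        then show ?thesis using d(2)[of "s *\<^sub>R i + x" x] sd s by simp
      next
        case False
        have "norm (s *\<^sub>R i) \<le> norm i" using s by (simp add: mult_left_le_one_le)
        then have "r \<le> norm (s *\<^sub>R i + x)"
          using False norm_triangle_ineq2[of x "- (s *\<^sub>R i)"] by (simp add: add.commute)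
        moreover have "r + 1 \<le> norm x" using False norm_ge_zero[of i] by linarith
        ultimately show ?thesis using w0 W0 False by simp
      qed
    qed
    also have "\<dots> = s * (e' * c)" by (simp add: c_def)
    finally have "s * norm (\<integral>x. W x \<bullet> i \<partial>lborel) \<le> s * (e' * c)"
      using s by (simp add: abs_mult)
    then have "norm (\<integral>x. W x \<bullet> i \<partial>lborel) \<le> e' * c" using s by simp
    also have "\<dots> \<le> e" using that c by (simp add: e'_def field_simps)
    finally show ?thesis .
  qed
  then have "norm (\<integral>x. W x \<bullet> i \<partial>lborel) \<le> 0"
    by (rule dense_ge)
  then show ?thesis by simp
qed

text \<open>The divergence theorem for the field w(x) x: the previous result is applied to w times
  each coordinate and summed. A radial field h(|x|) x is covered by putting h into w, so this
  identity carries every integration by parts that involves the barrier.\<close>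

lemma integral_euler_eq_0:
  fixes w :: "'a::euclidean_space \<Rightarrow> real"
  assumes C: "C1_grad w W" and w0: "\<And>x. r \<le> norm x \<Longrightarrow> w x = 0"
  shows "(\<integral>x. DIM('a) * w x + W x \<bullet> x \<partial>lborel) = 0"
proof -
  have wc: "continuous_on UNIV w" and Wc: "continuous_on UNIV W" using C1_gradD[OF C] by auto
  have W0: "W x = 0" if "r + 1 \<le> norm x" for x
    using C1_grad_support[OF C w0] that by auto
  let ?W = "\<lambda>i x. (x \<bullet> i) *\<^sub>R W x + w x *\<^sub>R i"
  have C': "C1_grad (\<lambda>x. w x * (x \<bullet> i)) (?W i)" for i
    unfolding C1_grad_def
  proof (intro conjI allI)
    show "((\<lambda>x. w x * (x \<bullet> i)) has_derivative (\<lambda>h. ?W i x \<bullet> h)) (at x)" for x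
      using C1_gradD(1)[OF C]
      by (auto intro!: derivative_eq_intros simp: algebra_simps inner_commute)
    show "continuous_on UNIV (?W i)" using wc Wc by (intro continuous_intros)
  qed
  have 0: "(\<integral>x. ?W i x \<bullet> i \<partial>lborel) = 0" for i
    by (rule integral_grad_eq_0[OF C', of r]) (simp add: w0)
  have "integrable lborel (?W i)" for i
    by (rule integrable_continuous_compact_support[where r = "r + 1"])
      (use wc Wc W0 w0 in \<open>auto intro!: continuous_intros\<close>)
  then have "(\<Sum>i\<in>Basis. \<integral>x. ?W i x \<bullet> i \<partial>lborel) = (\<integral>x. (\<Sum>i\<in>Basis. ?W i x \<bullet> i) \<partial>lborel)"
    by (intro Bochner_Integration.integral_sum[symmetric] integrable_inner_left) auto
  also have "(\<lambda>x. \<Sum>i\<in>Basis. ?W i x \<bullet> i) = (\<lambda>x. DIM('a) * w x + W x \<bullet> x)"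
  proof
    fix x :: 'a
    have "(\<Sum>i\<in>Basis. (x \<bullet> i) * (W x \<bullet> i)) = W x \<bullet> x"
      unfolding euclidean_inner[of "W x" x] by (intro sum.cong mult.commute refl)
    then show "(\<Sum>i\<in>Basis. ?W i x \<bullet> i) = DIM('a) * w x + W x \<bullet> x"
      by (simp add: inner_add_left sum.distrib)
  qed
  finally show ?thesis using 0 by simp
qed

section \<open>Mollification in L1\<close>

text \<open>Convexity: the power lies above its tangent at b. This is the common source of Jensen's
  inequality for mollifications and of the Picone inequality. Zero arguments are split off, since
  the tangent argument runs on the open half line.\<close>

lemma powr_tangent:
  fixes a b q :: real
  assumes "1 < q" "0 \<le> a" "0 \<le> b"
  shows "b powr q + q * b powr (q - 1) * (a - b) \<le> a powr q"
proof (cases "b = 0 \<or> a = 0")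
  case True
  then show ?thesis
  proof
    assume "a = 0"
    have "b powr q = b powr (q - 1) * b"
      using assms powr_mult_base[of b "q - 1"] by (simp add: mult.commute)
    then have "b powr q + q * b powr (q - 1) * (a - b) = - (q - 1) * b powr q"
      using \<open>a = 0\<close> by (simp add: algebra_simps)
    also have "\<dots> \<le> 0" using assms by (simp add: mult_nonpos_nonneg)
    finally show ?thesis using \<open>a = 0\<close> assms by simp
  qed (use assms in auto)
next
  case False
  with assms have pos: "a > 0" "b > 0" by auto
  have "q * b powr (q - 1) * (a - b) \<le> a powr q - b powr q"
  proof (rule convex_on_imp_above_tangent[where f = "\<lambda>x. x powr q" and A = "{0<..}"])
    show "convex_on {0<..} (\<lambda>x. x powr q)"
      using assms(1) by (intro convex_on_subset[OF powr_convex]) auto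
    show "((\<lambda>x. x powr q) has_real_derivative q * b powr (q - 1)) (at b within {0<..})"
      using pos by (auto intro!: derivative_eq_intros)
    show "connected {0::real<..}" "b \<in> interior {0<..}" "a \<in> {0<..}"
      using pos by (auto simp: interior_open)
  qed
  then show ?thesis by simp
qed

lemma integrable_conv_mollifier:
  fixes h :: "'a::euclidean_space \<Rightarrow> 'b::euclidean_space"
  assumes "r > 0" "integrable lborel h"
  shows "integrable lborel (\<lambda>y. mollifier r (x - y) *\<^sub>R h y)"
  using integrable_conv[OF C_diff_continuous[OF C_diff_mollifier] mollifier_eq_0[OF assms(1)] assms(2)] .

lemma mollifier_shift:
  fixes x :: "'a::euclidean_space"
  assumes "r > 0"
  shows "(\<integral>y. mollifier r (x - y) \<partial>lborel) = 1" "integrable lborel (\<lambda>y. mollifier r (x - y))"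
proof -
  show 1: "(\<integral>y. mollifier r (x - y) \<partial>lborel) = 1"
    using integral_lborel_reflect[of "mollifier r" x] integral_mollifier[OF assms] by simp
  then show "integrable lborel (\<lambda>y. mollifier r (x - y))"
    using not_integrable_integral_eq by force
qed

text \<open>A weighted mean of values of h over a ball inherits any bound on their distance to z.
  Suitable z and e give supports (both 0), uniform bounds (z = 0) and convergence (z = h x).\<close>

lemma conv_mollifier_close:
  fixes h :: "'a::euclidean_space \<Rightarrow> 'b::euclidean_space"
  assumes r: "r > 0" and h: "integrable lborel h"
    and le: "\<And>y. norm (x - y) < r \<Longrightarrow> norm (h y - z) \<le> e"
  shows "norm (conv (mollifier r) h x - z) \<le> e"
proof -
  have i: "integrable lborel (\<lambda>y. mollifier r (x - y) *\<^sub>R (h y - z))"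
    using integrable_conv_mollifier[OF r h] mollifier_shift(2)[OF r, of x] by (simp add: scaleR_diff_right)
  have "conv (mollifier r) h x - z = (\<integral>y. mollifier r (x - y) *\<^sub>R (h y - z) \<partial>lborel)"
    unfolding conv_def
    using integrable_conv_mollifier[OF r h] mollifier_shift[OF r, of x] by (simp add: scaleR_diff_right)
  also have "norm \<dots> \<le> (\<integral>y. e * mollifier r (x - y) \<partial>lborel)"
  proof (rule Bochner_Integration.integral_norm_bound_integral[OF i])
    show "integrable lborel (\<lambda>y. e * mollifier r (x - y))" using mollifier_shift(2)[OF r, of x] by simp
    show "norm (mollifier r (x - y) *\<^sub>R (h y - z)) \<le> e * mollifier r (x - y)" for y
      using le[of y] mollifier_nonneg[OF r, of "x - y"] mollifier_eq_0[OF r, of "x - y"]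
      by (cases "norm (x - y) < r") (auto simp: mult.commute[of e] intro!: mult_left_mono)
  qed
  also have "\<dots> = e" using mollifier_shift[OF r, of x] by simp
  finally show ?thesis .
qed

text \<open>The bound on h is asked for almost everywhere because it will be the essential bound on
  u near the sphere.\<close>

lemma conv_mollifier_le:
  fixes h :: "'a::euclidean_space \<Rightarrow> real"
  assumes r: "r > 0" and h: "integrable lborel h"
    and le: "AE y in lborel. norm (x - y) < r \<longrightarrow> h y \<le> c"
  shows "conv (mollifier r) h x \<le> c"
proof -
  have "conv (mollifier r) h x \<le> (\<integral>y. mollifier r (x - y) * c \<partial>lborel)"
    unfolding conv_def real_scaleR_def
  proof (rule integral_mono_AE)
    show "integrable lborel (\<lambda>y. mollifier r (x - y) * h y)"
      using integrable_conv_mollifier[OF r h] by simp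
    show "integrable lborel (\<lambda>y. mollifier r (x - y) * c)" using mollifier_shift(2)[OF r, of x] by simp
    show "AE y in lborel. mollifier r (x - y) * h y \<le> mollifier r (x - y) * c"
      using le
    proof eventually_elim
      case (elim y)
      then show ?case
        using mollifier_nonneg[OF r, of "x - y"] mollifier_eq_0[OF r, of "x - y"]
        by (cases "norm (x - y) < r") (auto intro!: mult_left_mono)
    qed
  qed
  then show ?thesis using mollifier_shift[OF r, of x] by simp
qed

lemma conv_mollifier_nonneg:
  fixes h :: "'a::euclidean_space \<Rightarrow> real"
  assumes "r > 0" and "\<And>y. 0 \<le> h y"
  shows "0 \<le> conv (mollifier r) h x"
  unfolding conv_def using assms mollifier_nonneg
  by (auto intro!: Bochner_Integration.integral_nonneg mult_nonneg_nonneg)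

text \<open>Jensen's inequality: the tangent inequality at the mean c of |h| is integrated against
  the kernel, and the linear term integrates to 0.\<close>

lemma norm_conv_powr_le:
  fixes h :: "'a::euclidean_space \<Rightarrow> 'b::euclidean_space"
  assumes r: "r > 0" and q: "1 < q" and h: "integrable lborel h"
    and hq: "integrable lborel (\<lambda>y. norm (h y) powr q)"
  shows "norm (conv (mollifier r) h x) powr q \<le> conv (mollifier r) (\<lambda>y. norm (h y) powr q) x"
proof -
  define c where "c = (\<integral>y. mollifier r (x - y) * norm (h y) \<partial>lborel)"
  note nn = mollifier_nonneg[OF r, where 'a = 'a]
  have ih: "integrable lborel (\<lambda>y. mollifier r (x - y) * norm (h y))"
    using integrable_conv_mollifier[OF r integrable_norm[OF h]] by simp
  have "norm (conv (mollifier r) h x) \<le> (\<integral>y. norm (mollifier r (x - y) *\<^sub>R h y) \<partial>lborel)"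
    unfolding conv_def by (rule integral_norm_bound)
  also have "\<dots> = c" using nn by (simp add: c_def)
  finally have le: "norm (conv (mollifier r) h x) powr q \<le> c powr q"
    using q by (intro powr_mono2) auto
  have eq: "mollifier r (x - y) * (c powr q + q * c powr (q - 1) * (norm (h y) - c))
      = (c powr q - q * c powr (q - 1) * c) * mollifier r (x - y)
        + (q * c powr (q - 1)) * (mollifier r (x - y) * norm (h y))" for y
    by (simp add: algebra_simps)
  have "c powr q = (\<integral>y. mollifier r (x - y) * (c powr q + q * c powr (q - 1) * (norm (h y) - c)) \<partial>lborel)"
    unfolding eq using ih mollifier_shift[OF r, of x] by (simp flip: c_def)
  also have "\<dots> \<le> conv (mollifier r) (\<lambda>y. norm (h y) powr q) x"
    unfolding conv_def real_scaleR_def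
  proof (rule integral_mono)
    have "c \<ge> 0" unfolding c_def using nn by (intro Bochner_Integration.integral_nonneg) auto
    then show "mollifier r (x - y) * (c powr q + q * c powr (q - 1) * (norm (h y) - c))
        \<le> mollifier r (x - y) * norm (h y) powr q" for y
      using powr_tangent[OF q, of "norm (h y)" c] nn by (intro mult_left_mono) auto
    show "integrable lborel (\<lambda>y. mollifier r (x - y) * (c powr q + q * c powr (q - 1) * (norm (h y) - c)))"
      unfolding eq using ih mollifier_shift(2)[OF r, of x] by simp
    show "integrable lborel (\<lambda>y. mollifier r (x - y) * norm (h y) powr q)"
      using integrable_conv_mollifier[OF r hq] by simp
  qed
  finally show ?thesis using le by simp
qed

lemma borel_measurable_conv [measurable]:
  fixes h :: "'a::euclidean_space \<Rightarrow> 'b::euclidean_space"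
  assumes [measurable]: "h \<in> borel_measurable borel" "K \<in> borel_measurable borel"
  shows "conv K h \<in> borel_measurable borel"
proof -
  have "conv K h \<in> borel_measurable lborel"
    unfolding conv_def[abs_def] by (rule lborel.borel_measurable_lebesgue_integral) measurable
  then show ?thesis by simp
qed

text \<open>Tonelli's theorem; the kernel has unit mass in x as well as in y because it is
  even.\<close>

lemma nn_integral_conv_le:
  fixes h :: "'a::euclidean_space \<Rightarrow> 'b::euclidean_space"
  assumes r: "r > 0" and h: "integrable lborel h"
  shows "(\<integral>\<^sup>+x. norm (conv (mollifier r) h x) \<partial>lborel) \<le> (\<integral>\<^sup>+x. norm (h x) \<partial>lborel)"
proof -
  have [measurable]: "h \<in> borel_measurable borel" using h by auto
  note nn = mollifier_nonneg[OF r, where 'a = 'a]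
  have one: "(\<integral>\<^sup>+x. ennreal (mollifier r (x - y)) \<partial>lborel) = 1" for y :: 'a
  proof -
    have eq: "mollifier r (x - y) = mollifier r (y - x)" for x
      using mollifier_minus[of r "y - x"] by simp
    have "(\<integral>\<^sup>+x. ennreal (mollifier r (x - y)) \<partial>lborel) = ennreal (\<integral>x. mollifier r (y - x) \<partial>lborel)"
      unfolding eq by (rule nn_integral_eq_integral[OF mollifier_shift(2)[OF r]]) (use nn in auto)
    then show ?thesis using mollifier_shift(1)[OF r] by simp
  qed
  have "(\<integral>\<^sup>+x. norm (conv (mollifier r) h x) \<partial>lborel)
      \<le> (\<integral>\<^sup>+x. \<integral>\<^sup>+y. ennreal (mollifier r (x - y)) * ennreal (norm (h y)) \<partial>lborel \<partial>lborel)"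
  proof (intro nn_integral_mono)
    fix x
    have "ennreal (norm (conv (mollifier r) h x)) \<le> (\<integral>\<^sup>+y. norm (mollifier r (x - y) *\<^sub>R h y) \<partial>lborel)"
      unfolding conv_def by (rule integral_norm_bound_ennreal[OF integrable_conv_mollifier[OF r h]])
    then show "ennreal (norm (conv (mollifier r) h x))
        \<le> (\<integral>\<^sup>+y. ennreal (mollifier r (x - y)) * ennreal (norm (h y)) \<partial>lborel)"
      using nn by (simp add: ennreal_mult)
  qed
  also have "\<dots> = (\<integral>\<^sup>+y. \<integral>\<^sup>+x. ennreal (mollifier r (x - y)) * ennreal (norm (h y)) \<partial>lborel \<partial>lborel)"
    by (rule lborel_pair.Fubini'[symmetric]) measurable
  also have "\<dots> = (\<integral>\<^sup>+y. ennreal (norm (h y)) * (\<integral>\<^sup>+x. ennreal (mollifier r (x - y)) \<partial>lborel) \<partial>lborel)"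
    by (intro nn_integral_cong, subst mult.commute, rule nn_integral_cmult) measurable
  also have "\<dots> = (\<integral>\<^sup>+x. norm (h x) \<partial>lborel)" by (simp add: one)
  finally show ?thesis .
qed

lemma integrable_conv_L1:
  fixes h :: "'a::euclidean_space \<Rightarrow> 'b::euclidean_space"
  assumes r: "r > 0" and h: "integrable lborel h"
  shows "integrable lborel (conv (mollifier r) h)"
proof (rule integrableI_bounded)
  show "conv (mollifier r) h \<in> borel_measurable lborel" using h by auto
  show "(\<integral>\<^sup>+x. norm (conv (mollifier r) h x) \<partial>lborel) < \<infinity>"
    using nn_integral_conv_le[OF r h] h by (auto simp: integrable_iff_bounded)
qed

lemma integral_norm_conv_le:
  fixes h :: "'a::euclidean_space \<Rightarrow> 'b::euclidean_space"
  assumes r: "r > 0" and h: "integrable lborel h"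
  shows "(\<integral>x. norm (conv (mollifier r) h x) \<partial>lborel) \<le> (\<integral>x. norm (h x) \<partial>lborel)"
  using nn_integral_conv_le[OF r h] h integrable_conv_L1[OF r h]
  by (simp add: nn_integral_eq_integral Bochner_Integration.integral_nonneg)

lemma conv_diff:
  fixes h k :: "'a::euclidean_space \<Rightarrow> 'b::euclidean_space"
  assumes "r > 0" "integrable lborel h" "integrable lborel k"
  shows "conv (mollifier r) (\<lambda>x. h x - k x) x = conv (mollifier r) h x - conv (mollifier r) k x"
  unfolding conv_def using assms by (simp add: scaleR_diff_right integrable_conv_mollifier)

text \<open>Truncation in position and size reduces to a bounded function of bounded support. This
  is an almost everywhere limit of continuous functions, and dominated convergence turns that into
  L1 convergence.\<close>

lemma L1_approx_continuous:
  fixes h :: "'a::euclidean_space \<Rightarrow> 'b::euclidean_space"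
  assumes h: "integrable lborel h" and e: "e > 0"
  obtains c R where "continuous_on UNIV c" "\<And>x. R \<le> norm x \<Longrightarrow> c x = 0"
    "(\<integral>x. norm (h x - c x) \<partial>lborel) < e"
proof -
  have [measurable]: "h \<in> borel_measurable borel" using h by auto
  define hk where "hk k x = (if norm x \<le> real k \<and> norm (h x) \<le> real k then h x else 0)" for k x
  have hk_meas [measurable]: "hk k \<in> borel_measurable borel" for k
    unfolding hk_def[abs_def] by measurable
  have "(\<lambda>k. \<integral>x. norm (h x - hk k x) \<partial>lborel) \<longlonglongrightarrow> integral\<^sup>L lborel (\<lambda>x::'a. 0)"
  proof (rule integral_dominated_convergence[where w = "\<lambda>x. norm (h x)"])
    show "AE x in lborel. (\<lambda>k. norm (h x - hk k x)) \<longlonglongrightarrow> 0"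
    proof (rule AE_I2)
      fix x
      have "\<forall>\<^sub>F k in sequentially. norm (h x - hk k x) = 0"
        using eventually_ge_at_top[of "nat \<lceil>max (norm x) (norm (h x))\<rceil>"]
        by eventually_elim (auto simp: hk_def ceiling_le_iff nat_le_iff)
      then show "(\<lambda>k. norm (h x - hk k x)) \<longlonglongrightarrow> 0" by (rule tendsto_eventually)
    qed
    show "AE x in lborel. norm (norm (h x - hk k x)) \<le> norm (h x)" for k
      by (rule AE_I2) (simp add: hk_def)
  qed (use h in auto)
  then obtain k where k: "(\<integral>x. norm (h x - hk k x) \<partial>lborel) < e / 2"
    using e by (auto simp: LIMSEQ_iff dest!: spec[of _ "e / 2"])
  have "hk k \<in> borel_measurable lebesgue"
    by (rule measurable_completion) simp
  then have "hk k measurable_on UNIV"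
    by (intro lebesgue_measurable_imp_measurable_on) auto
  then obtain N g where N: "negligible N" and gc: "\<And>n. continuous_on UNIV (g n)"
    and gl: "\<And>x. x \<notin> N \<Longrightarrow> (\<lambda>n. g n x) \<longlonglongrightarrow> hk k x"
    unfolding measurable_on_def by auto
  \<comment> \<open>Projection onto the ball of radius k and the spatial cutoff provide a common
    bound and a common support. Both leave \<open>hk k x\<close> unchanged, so the limit stays the
    same.\<close>
  define c where "c n x = max 0 (min 1 (real k + 1 - norm x)) *\<^sub>R closest_point (cball 0 (real k)) (g n x)"
    for n x
  have cp: "continuous_on A (closest_point (cball (0::'b) (real k)))" for A
    by (intro continuous_on_closest_point) auto
  have cc: "continuous_on UNIV (c n)" for n
    unfolding c_def by (intro continuous_intros continuous_on_compose2[OF cp gc]) auto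
  have c0: "c n x = 0" if "real k + 1 \<le> norm x" for n x using that by (simp add: c_def)
  have cb: "norm (c n x) \<le> real k * indicator (cball 0 (real k + 1)) x" for n x
  proof (cases "norm x \<le> real k + 1")
    case True
    have "closest_point (cball 0 (real k)) (g n x) \<in> cball 0 (real k)"
      by (intro closest_point_in_set) auto
    then have "max 0 (min 1 (real k + 1 - norm x)) * norm (closest_point (cball 0 (real k)) (g n x)) \<le> 1 * real k"
      by (intro mult_mono) auto
    then show ?thesis using True by (simp add: c_def)
  qed (simp add: c0)
  have [measurable]: "c n \<in> borel_measurable borel" for n
    using cc borel_measurable_continuous_onI by blast
  have lim: "(\<lambda>n. c n x) \<longlonglongrightarrow> hk k x" if "x \<notin> N" for x
  proof -
    have "(\<lambda>n. c n x) \<longlonglongrightarrow> max 0 (min 1 (real k + 1 - norm x)) *\<^sub>R closest_point (cball 0 (real k)) (hk k x)"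
      unfolding c_def
      by (intro tendsto_intros continuous_on_tendsto_compose[OF cp[of UNIV] gl[OF that]]) auto
    also have "closest_point (cball 0 (real k)) (hk k x) = hk k x"
      by (intro closest_point_self) (simp add: hk_def)
    also have "max 0 (min 1 (real k + 1 - norm x)) *\<^sub>R hk k x = hk k x"
      by (simp add: hk_def)
    finally show ?thesis .
  qed
  have AEN: "AE x in lborel. x \<notin> N"
    using AE_not_in[of N lebesgue] N by (simp add: negligible_iff_null_sets AE_completion_iff)
  have ik: "integrable lborel (hk k)"
    by (rule Bochner_Integration.integrable_bound[OF h]) (auto simp: hk_def)
  have bint: "integrable lborel (\<lambda>x::'a. real k * indicator (cball 0 (real k + 1)) x)"
    by (rule integrable_const_cball)
  have "(\<lambda>n. \<integral>x. norm (hk k x - c n x) \<partial>lborel) \<longlonglongrightarrow> integral\<^sup>L lborel (\<lambda>x::'a. 0)"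
  proof (rule integral_dominated_convergence
      [where w = "\<lambda>x. norm (hk k x) + real k * indicator (cball 0 (real k + 1)) x"])
    show "AE x in lborel. (\<lambda>n. norm (hk k x - c n x)) \<longlonglongrightarrow> 0"
      using AEN
    proof eventually_elim
      case (elim x)
      have "(\<lambda>n. norm (hk k x - c n x)) \<longlonglongrightarrow> norm (hk k x - hk k x)"
        by (intro tendsto_intros lim elim)
      then show ?case by simp
    qed
    show "AE x in lborel. norm (norm (hk k x - c n x))
        \<le> norm (hk k x) + real k * indicator (cball 0 (real k + 1)) x" for n
      using cb[of n] by (auto intro!: AE_I2 order_trans[OF norm_triangle_ineq4] add_left_mono)
  qed (use ik bint in auto)
  then obtain n where n: "(\<integral>x. norm (hk k x - c n x) \<partial>lborel) < e / 2"
    using e by (auto simp: LIMSEQ_iff dest!: spec[of _ "e / 2"])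
  have ic: "integrable lborel (c n)"
    using integrable_continuous_compact_support[OF cc c0] .
  have "(\<integral>x. norm (h x - c n x) \<partial>lborel) \<le> (\<integral>x. norm (h x - hk k x) + norm (hk k x - c n x) \<partial>lborel)"
    using h ik ic by (intro integral_mono) (auto intro: norm_diff_triangle_ineq order_trans[OF _ norm_triangle_ineq])
  also have "\<dots> < e" using h ik ic n k by simp
  finally show thesis using that[OF cc c0] by blast
qed

text \<open>For a continuous c of compact support the convergence is uniform and confined to a fixed
  ball. Mollification does not increase the L1 norm, so the approximation error h - c is merely
  counted twice; three quarters of e are spent.\<close>

lemma conv_mollifier_L1:
  fixes h :: "'a::euclidean_space \<Rightarrow> 'b::euclidean_space"
  assumes h: "integrable lborel h" and e: "e > 0"
  shows "\<exists>d>0. \<forall>r. 0 < r \<and> r < d \<longrightarrow> (\<integral>x. norm (conv (mollifier r) h x - h x) \<partial>lborel) < e"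
proof -
  obtain c R where cc: "continuous_on UNIV c" and c0: "\<And>x. R \<le> norm x \<Longrightarrow> c x = 0"
    and hc: "(\<integral>x. norm (h x - c x) \<partial>lborel) < e / 4"
    using L1_approx_continuous[OF h, of "e / 4"] e by auto
  have ic: "integrable lborel c" using integrable_continuous_compact_support[OF cc c0] .
  define V where "V = measure lborel (cball (0::'a) (R + 1))"
  define e' where "e' = e / (4 * (1 + V))"
  have V: "V \<ge> 0" by (simp add: V_def)
  have e': "e' > 0" using e V by (simp add: e'_def)
  have "uniformly_continuous_on (cball 0 (R + 2)) c"
    using cc continuous_on_subset by (intro compact_uniformly_continuous) auto
  then obtain d0 where d0: "d0 > 0"
    "\<And>x y. x \<in> cball 0 (R + 2) \<Longrightarrow> y \<in> cball 0 (R + 2) \<Longrightarrow> dist y x < d0 \<Longrightarrow> dist (c y) (c x) < e'"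
    unfolding uniformly_continuous_on_def using e' by metis
  show ?thesis
  proof (intro exI[of _ "min d0 1"] conjI allI impI)
    show "min d0 1 > 0" using d0(1) by simp
    fix r assume r: "0 < r \<and> r < min d0 1"
    let ?m = "conv (mollifier r)"
    have r0: "r > 0" using r by simp
    have im: "integrable lborel (?m h)" "integrable lborel (?m c)"
      and imd: "integrable lborel (?m (\<lambda>x. h x - c x))"
      using r0 h ic by (auto intro!: integrable_conv_L1)
    have close: "norm (?m c x - c x) \<le> e' * indicator (cball 0 (R + 1)) x" for x
    proof (cases "norm x \<le> R + 1")
      case True
      have "norm (?m c x - c x) \<le> e'"
      proof (rule conv_mollifier_close[OF r0 ic])
        fix y assume y: "norm (x - y) < r"
        then have "norm y \<le> R + 2"
          using True r norm_triangle_ineq2[of y x] by (simp add: norm_minus_commute)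
        then show "norm (c y - c x) \<le> e'"
          using d0(2)[of x y] y True r by (simp add: dist_norm norm_minus_commute less_imp_le)
      qed
      then show ?thesis using True by simp
    next
      case False
      have "norm (?m c x - 0) \<le> 0"
      proof (rule conv_mollifier_close[OF r0 ic])
        fix y assume y: "norm (x - y) < r"
        then have "R \<le> norm y"
          using False r norm_triangle_ineq2[of x y] by simp
        then show "norm (c y - 0) \<le> 0" using c0 by simp
      qed
      then show ?thesis using False c0[of x] by simp
    qed
    have "(\<integral>x. norm (?m h x - h x) \<partial>lborel)
        \<le> (\<integral>x. norm (?m (\<lambda>x. h x - c x) x) + norm (?m c x - c x) + norm (h x - c x) \<partial>lborel)"
    proof (rule integral_mono)
      show "norm (?m h x - h x) \<le> norm (?m (\<lambda>x. h x - c x) x) + norm (?m c x - c x) + norm (h x - c x)" for x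
      proof -
        have "?m h x - h x = ?m (\<lambda>x. h x - c x) x + (?m c x - c x) - (h x - c x)"
          using conv_diff[OF r0 h ic, of x] by simp
        then show ?thesis
          using norm_triangle_ineq4[of "?m (\<lambda>x. h x - c x) x + (?m c x - c x)" "h x - c x"]
            norm_triangle_ineq[of "?m (\<lambda>x. h x - c x) x" "?m c x - c x"] by simp
      qed
    qed (use h ic im imd in auto)
    also have "\<dots> = (\<integral>x. norm (?m (\<lambda>x. h x - c x) x) \<partial>lborel) + (\<integral>x. norm (?m c x - c x) \<partial>lborel)
        + (\<integral>x. norm (h x - c x) \<partial>lborel)"
      using h ic im imd by simp
    also have "(\<integral>x. norm (?m (\<lambda>x. h x - c x) x) \<partial>lborel) \<le> (\<integral>x. norm (h x - c x) \<partial>lborel)"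
      using h ic by (intro integral_norm_conv_le[OF r0]) auto
    also have "(\<integral>x. norm (?m c x - c x) \<partial>lborel) \<le> (\<integral>x. e' * indicator (cball (0::'a) (R + 1)) x \<partial>lborel)"
      using im ic close by (intro integral_mono integrable_const_cball) auto
    also have "\<dots> = e' * V" by (simp add: V_def)
    also have "\<dots> \<le> e / 4"
    proof -
      have "e' * (1 + V) = e / 4" using V by (simp add: e'_def field_simps)
      then show ?thesis using e' by (simp add: distrib_left)
    qed
    finally show "(\<integral>x. norm (?m h x - h x) \<partial>lborel) < e" using hc e by simp
  qed
qed

text \<open>L1 convergence alone gives no majorant. With summable norms the pointwise sum of the
  sequence is integrable, dominates each term and forces the terms to 0 almost everywhere.\<close>

lemma L1_fast_dominated:
  fixes d :: "nat \<Rightarrow> 'a \<Rightarrow> real"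
  assumes int: "\<And>n. integrable M (d n)" and nn: "\<And>n x. 0 \<le> d n x"
    and le: "\<And>n. integral\<^sup>L M (d n) \<le> (1 / 2) ^ n"
  obtains D where "integrable M D" "\<And>x. 0 \<le> D x"
    "AE x in M. (\<forall>n. d n x \<le> D x) \<and> (\<lambda>n. d n x) \<longlonglongrightarrow> 0"
proof -
  have [measurable]: "d n \<in> borel_measurable M" for n using int by auto
  have "(\<integral>\<^sup>+x. (\<Sum>n. ennreal (d n x)) \<partial>M) = (\<Sum>n. \<integral>\<^sup>+x. ennreal (d n x) \<partial>M)"
    by (rule nn_integral_suminf) measurable
  also have "\<dots> \<le> (\<Sum>n. ennreal ((1 / 2) ^ n))"
  proof (rule suminf_le)
    show "(\<integral>\<^sup>+x. ennreal (d n x) \<partial>M) \<le> ennreal ((1 / 2) ^ n)" for n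
      using nn_integral_eq_integral[OF int AE_I2[OF nn], of n] ennreal_leI[OF le[of n]] by simp
  qed auto
  also have "\<dots> = ennreal 2"
  proof -
    have "(\<lambda>n. (1 / 2 :: real) ^ n) sums 2" using geometric_sums[of "1 / 2 :: real"] by simp
    then show ?thesis
      using suminf_ennreal2[OF _ sums_summable, of "\<lambda>n. (1 / 2) ^ n" 2] sums_unique by fastforce
  qed
  also have "\<dots> < \<infinity>" by simp
  finally have fin: "(\<integral>\<^sup>+x. (\<Sum>n. ennreal (d n x)) \<partial>M) < \<infinity>" .
  then have "AE x in M. (\<Sum>n. ennreal (d n x)) \<noteq> \<infinity>"
    by (intro nn_integral_PInf_AE) auto
  then have summ: "AE x in M. summable (\<lambda>n. d n x)"
    by eventually_elim (use nn summable_suminf_not_top in auto)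
  define D where "D x = enn2real (\<Sum>n. ennreal (d n x))" for x
  have [measurable]: "D \<in> borel_measurable M" unfolding D_def[abs_def] by measurable
  have "AE x in M. ennreal (D x) = (\<Sum>n. ennreal (d n x))"
    using \<open>AE x in M. (\<Sum>n. ennreal (d n x)) \<noteq> \<infinity>\<close>
    by eventually_elim (simp add: D_def less_top)
  then have "(\<integral>\<^sup>+x. ennreal (D x) \<partial>M) = (\<integral>\<^sup>+x. (\<Sum>n. ennreal (d n x)) \<partial>M)"
    by (rule nn_integral_cong_AE)
  then have "integrable M D"
    using fin by (intro integrableI_bounded) (auto simp: D_def)
  moreover have "AE x in M. (\<forall>n. d n x \<le> D x) \<and> (\<lambda>n. d n x) \<longlonglongrightarrow> 0"
    using summ
  proof eventually_elim
    case (elim x)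
    have "(\<Sum>n. ennreal (d n x)) = ennreal (\<Sum>n. d n x)"
      using suminf_ennreal2[OF nn elim] .
    then have "D x = (\<Sum>n. d n x)"
      using nn elim by (simp add: D_def suminf_nonneg)
    moreover have "d n x \<le> (\<Sum>n. d n x)" for n
      using sum_le_suminf[OF elim, of "{n}"] nn by simp
    ultimately show ?case using elim summable_LIMSEQ_zero by auto
  qed
  ultimately show ?thesis using that[of D] by (simp add: D_def)
qed

text \<open>By Jensen, |u_n|^s and |g_n|^p are at most the mollifications of |u|^s and |g|^p, and
  these converge in L1. Radii shrinking fast enough make all four L1 errors summable, which produces
  one integrable majorant for both powers.\<close>

lemma mollify_dominated:
  fixes u :: "'a::euclidean_space \<Rightarrow> real" and g :: "'a \<Rightarrow> 'a"
  assumes u: "integrable lborel u" and g: "integrable lborel g"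
    and us: "integrable lborel (\<lambda>x. \<bar>u x\<bar> powr s)" and gp: "integrable lborel (\<lambda>x. norm (g x) powr p)"
    and s: "1 < s" and p: "1 < p"
  obtains r D where "\<And>n. 0 < r n" "r \<longlonglongrightarrow> 0" "integrable lborel D"
    "AE x in lborel. (\<lambda>n. conv (mollifier (r n)) u x) \<longlonglongrightarrow> u x \<and> (\<lambda>n. conv (mollifier (r n)) g x) \<longlonglongrightarrow> g x
      \<and> (\<forall>n. \<bar>conv (mollifier (r n)) u x\<bar> powr s \<le> D x \<and> norm (conv (mollifier (r n)) g x) powr p \<le> D x)"
proof -
  let ?us = "\<lambda>x. \<bar>u x\<bar> powr s" and ?gp = "\<lambda>x. norm (g x) powr p"
  define d where "d r x = norm (conv (mollifier r) u x - u x) + norm (conv (mollifier r) g x - g x)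
    + norm (conv (mollifier r) ?us x - ?us x) + norm (conv (mollifier r) ?gp x - ?gp x)" for r x
  have dint: "integrable lborel (d r)" if "r > 0" for r
    unfolding d_def[abs_def] using that u g us gp
    by (intro Bochner_Integration.integrable_add integrable_norm Bochner_Integration.integrable_diff
        integrable_conv_L1)
  have "\<exists>r. 0 < r \<and> r < 1 / real (Suc n) \<and> integral\<^sup>L lborel (d r) \<le> (1 / 2) ^ n" for n
  proof -
    \<comment> \<open>A quarter for each of the four differences that make up
      \<open>d r\<close>.\<close>
    define e :: real where "e = (1 / 2) ^ n / 4"
    have e: "e > 0" by (simp add: e_def)
    obtain d1 where d1: "d1 > 0" "\<And>r. 0 < r \<Longrightarrow> r < d1 \<Longrightarrow> (\<integral>x. norm (conv (mollifier r) u x - u x) \<partial>lborel) < e"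
      using conv_mollifier_L1[OF u e] by auto
    obtain d2 where d2: "d2 > 0" "\<And>r. 0 < r \<Longrightarrow> r < d2 \<Longrightarrow> (\<integral>x. norm (conv (mollifier r) g x - g x) \<partial>lborel) < e"
      using conv_mollifier_L1[OF g e] by auto
    obtain d3 where d3: "d3 > 0" "\<And>r. 0 < r \<Longrightarrow> r < d3 \<Longrightarrow> (\<integral>x. norm (conv (mollifier r) ?us x - ?us x) \<partial>lborel) < e"
      using conv_mollifier_L1[OF us e] by auto
    obtain d4 where d4: "d4 > 0" "\<And>r. 0 < r \<Longrightarrow> r < d4 \<Longrightarrow> (\<integral>x. norm (conv (mollifier r) ?gp x - ?gp x) \<partial>lborel) < e"
      using conv_mollifier_L1[OF gp e] by auto
    obtain r where r: "0 < r" "r < Min {d1, d2, d3, d4, 1 / real (Suc n)}"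
      using dense[of 0 "Min {d1, d2, d3, d4, 1 / real (Suc n)}"] d1(1) d2(1) d3(1) d4(1) by auto
    have "integral\<^sup>L lborel (d r) = (\<integral>x. norm (conv (mollifier r) u x - u x) \<partial>lborel)
      + (\<integral>x. norm (conv (mollifier r) g x - g x) \<partial>lborel)
      + (\<integral>x. norm (conv (mollifier r) ?us x - ?us x) \<partial>lborel)
      + (\<integral>x. norm (conv (mollifier r) ?gp x - ?gp x) \<partial>lborel)"
      unfolding d_def[abs_def]
      using integrable_conv_L1[OF r(1) u] integrable_conv_L1[OF r(1) g] integrable_conv_L1[OF r(1) us]
        integrable_conv_L1[OF r(1) gp] u g us gp by simp
    also have "\<dots> \<le> (1 / 2) ^ n"
      using d1(2)[of r] d2(2)[of r] d3(2)[of r] d4(2)[of r] r by (simp add: e_def)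
    finally show ?thesis using r by auto
  qed
  then obtain r where r: "\<And>n. 0 < r n" "\<And>n. r n < 1 / real (Suc n)"
    "\<And>n. integral\<^sup>L lborel (d (r n)) \<le> (1 / 2) ^ n"
    by metis
  obtain D where D: "integrable lborel D" "\<And>x. 0 \<le> D x"
    "AE x in lborel. (\<forall>n. d (r n) x \<le> D x) \<and> (\<lambda>n. d (r n) x) \<longlonglongrightarrow> 0"
    using L1_fast_dominated[of lborel "\<lambda>n. d (r n)"] dint[OF r(1)] r(3)
    by (auto simp: d_def)
  have lim: "r \<longlonglongrightarrow> 0"
  proof (rule tendsto_sandwich)
    show "\<forall>\<^sub>F n in sequentially. 0 \<le> r n" "\<forall>\<^sub>F n in sequentially. r n \<le> 1 / real (Suc n)"
      using r(1,2) by (auto intro!: always_eventually less_imp_le simp del: of_nat_Suc)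
    show "(\<lambda>n. 1 / real (Suc n)) \<longlonglongrightarrow> 0" using LIMSEQ_inverse_real_of_nat by (simp add: inverse_eq_divide)
  qed auto
  show thesis
  proof (rule that[of r "\<lambda>x. ?us x + ?gp x + D x"])
    show "integrable lborel (\<lambda>x. ?us x + ?gp x + D x)" using us gp D(1) by simp
    show "AE x in lborel. (\<lambda>n. conv (mollifier (r n)) u x) \<longlonglongrightarrow> u x \<and> (\<lambda>n. conv (mollifier (r n)) g x) \<longlonglongrightarrow> g x
      \<and> (\<forall>n. \<bar>conv (mollifier (r n)) u x\<bar> powr s \<le> ?us x + ?gp x + D x
          \<and> norm (conv (mollifier (r n)) g x) powr p \<le> ?us x + ?gp x + D x)"
      using D(3)
    proof eventually_elim
      case (elim x)
      have "(\<lambda>n. conv (mollifier (r n)) u x) \<longlonglongrightarrow> u x"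
        by (rule LIM_zero_cancel, rule Lim_null_comparison[OF _ elim[THEN conjunct2]])
          (simp add: d_def)
      moreover have "(\<lambda>n. conv (mollifier (r n)) g x) \<longlonglongrightarrow> g x"
        by (rule LIM_zero_cancel, rule Lim_null_comparison[OF _ elim[THEN conjunct2]])
          (simp add: d_def)
      moreover have "\<bar>conv (mollifier (r n)) u x\<bar> powr s \<le> ?us x + ?gp x + D x" for n
      proof -
        have "\<bar>conv (mollifier (r n)) u x\<bar> powr s \<le> conv (mollifier (r n)) ?us x"
          using norm_conv_powr_le[OF r(1) s u] us by simp
        also have "\<dots> \<le> ?us x + d (r n) x" unfolding d_def real_norm_def by (smt (verit) norm_ge_zero)
        also have "\<dots> \<le> ?us x + D x" using elim by simp
        finally show ?thesis using powr_ge_zero[of "norm (g x)" p] by linarith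
      qed
      moreover have "norm (conv (mollifier (r n)) g x) powr p \<le> ?us x + ?gp x + D x" for n
      proof -
        have "norm (conv (mollifier (r n)) g x) powr p \<le> conv (mollifier (r n)) ?gp x"
          using norm_conv_powr_le[OF r(1) p g gp] .
        also have "\<dots> \<le> ?gp x + d (r n) x" unfolding d_def real_norm_def by (smt (verit) norm_ge_zero)
        also have "\<dots> \<le> ?gp x + D x" using elim by simp
        finally show ?thesis using powr_ge_zero[of "\<bar>u x\<bar>" s] by linarith
      qed
      ultimately show ?case by blast
    qed
  qed (use r(1) lim in auto)
qed

section \<open>Continuously differentiable test functions\<close>

lemma grad_conv_mollifier:
  fixes w :: "'a::euclidean_space \<Rightarrow> real"
  assumes r: "r > 0" and C: "C1_grad w W" and w0: "\<And>x. R \<le> norm x \<Longrightarrow> w x = 0"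
  shows "grad (conv (mollifier r) w) x = conv (mollifier r) W x"
proof -
  have [measurable]: "w \<in> borel_measurable borel" "W \<in> borel_measurable borel"
    using C1_gradD[OF C] borel_measurable_continuous_onI by blast+
  have eq: "conv (mollifier r) w = conv w (mollifier r)"
    by (intro ext conv_commute) auto
  have "grad (conv w (mollifier r)) x = (\<integral>y. mollifier r y *\<^sub>R W (x - y) \<partial>lborel)"
    by (rule grad_eqI[OF conv_has_derivative[OF C w0 integrable_mollifier[OF r]]])
  also have "\<dots> = conv (mollifier r) W x"
    unfolding conv_def
    using integral_lborel_reflect[of "\<lambda>y. mollifier r (x - y) *\<^sub>R W y" x] by simp
  finally show ?thesis unfolding eq .
qed

text \<open>The gap between a and b leaves room to mollify w inside the exterior region. As w and W
  are continuous, the mollified functions and their gradients converge pointwise under uniform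
  bounds, so local integrability of P and q gives the limit.\<close>

lemma C1_test_extension:
  fixes P :: "'a::euclidean_space \<Rightarrow> 'a" and q :: "'a \<Rightarrow> real"
  assumes [measurable]: "P \<in> borel_measurable borel" "q \<in> borel_measurable borel"
    and int: "\<And>L. integrable lborel (\<lambda>x. indicator {x. a < norm x \<and> norm x \<le> L} x * (norm (P x) + \<bar>q x\<bar>))"
    and test: "\<And>\<phi>. \<phi> \<in> test_functions {x. a < norm x} \<Longrightarrow> (\<And>x. 0 \<le> \<phi> x) \<Longrightarrow>
      (\<integral>x. P x \<bullet> grad \<phi> x + q x * \<phi> x \<partial>lborel) \<le> 0"
    and C: "C1_grad w W" and nn: "\<And>x. 0 \<le> w x" and ab: "a < b"
    and wb: "\<And>x. norm x \<le> b \<Longrightarrow> w x = 0" and wR: "\<And>x. R \<le> norm x \<Longrightarrow> w x = 0"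
  shows "(\<integral>x. P x \<bullet> W x + q x * w x \<partial>lborel) \<le> 0"
proof -
  have wc: "continuous_on UNIV w" and Wc: "continuous_on UNIV W" using C1_gradD[OF C] by auto
  have [measurable]: "w \<in> borel_measurable borel" "W \<in> borel_measurable borel"
    using wc Wc borel_measurable_continuous_onI by blast+
  have WR: "W x = 0" if "R + 1 \<le> norm x" for x
    using C1_grad_support[OF C wR] that by auto
  have iw: "integrable lborel w" by (rule integrable_continuous_compact_support[OF wc wR])
  have iW: "integrable lborel W" by (rule integrable_continuous_compact_support[OF Wc WR])
  obtain B1 where B1: "B1 > 0" "\<And>x. norm (w x) \<le> B1" using compact_support_bounded[OF wc wR] by blast
  obtain B2 where B2: "B2 > 0" "\<And>x. norm (W x) \<le> B2" using compact_support_bounded[OF Wc WR] by blast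
  define B where "B = max B1 B2"
  have B: "norm (w x) \<le> B" "norm (W x) \<le> B" for x
    using B1(2)[of x] B2(2)[of x] by (auto simp: B_def)
  \<comment> \<open>Half of the gap keeps the supports outside radius (a + b) / 2; the bound 1 keeps
    functions within radius R + 1 and gradients within R + 2.\<close>
  define m where "m = min 1 ((b - a) / 2)"
  have m: "0 < m" using ab by (simp add: m_def)
  define r where "r n = m * inverse (real (Suc n))" for n
  have r0: "r n > 0" for n using m by (simp add: r_def)
  have r1: "r n \<le> min 1 ((b - a) / 2)" for n
    using m mult_left_mono[of "inverse (real (Suc n))" 1 m] by (simp add: r_def m_def inverse_le_1_iff)
  have "(\<lambda>n. m * inverse (real (Suc n))) \<longlonglongrightarrow> m * 0"
    by (intro tendsto_intros LIMSEQ_inverse_real_of_nat)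
  then have rlim: "r \<longlonglongrightarrow> 0"
    unfolding r_def[abs_def] by simp
  define \<psi> where "\<psi> n = conv (mollifier (r n)) w" for n
  have grad\<psi>: "grad (\<psi> n) = conv (mollifier (r n)) W" for n
    unfolding \<psi>_def using grad_conv_mollifier[OF r0 C wR] by blast
  have \<psi>0: "\<psi> n x = 0" if "norm x \<le> (a + b) / 2 \<or> R + 1 \<le> norm x" for n x
  proof -
    have "norm (\<psi> n x - 0) \<le> 0"
      unfolding \<psi>_def
    proof (rule conv_mollifier_close[OF r0 iw])
      fix y assume y: "norm (x - y) < r n"
      have "norm x \<le> (a + b) / 2 \<Longrightarrow> norm y \<le> b" "R + 1 \<le> norm x \<Longrightarrow> R \<le> norm y"
        using y r1[of n] norm_triangle_ineq2[of y x] norm_triangle_ineq2[of x y]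
        by (auto simp: norm_minus_commute field_simps)
      then show "norm (w y - 0) \<le> 0" using wb wR that by auto
    qed
    then show ?thesis by simp
  qed
  have grad0: "grad (\<psi> n) x = 0" if "norm x \<le> a \<or> R + 2 \<le> norm x" for n x
  proof -
    have "norm (grad (\<psi> n) x - 0) \<le> 0"
      unfolding grad\<psi>
    proof (rule conv_mollifier_close[OF r0 iW])
      fix y assume y: "norm (x - y) < r n"
      have "norm x \<le> a \<Longrightarrow> norm y < b" "R + 2 \<le> norm x \<Longrightarrow> R + 1 \<le> norm y"
        using y r1[of n] ab norm_triangle_ineq2[of y x] norm_triangle_ineq2[of x y]
        by (auto simp: norm_minus_commute field_simps)
      moreover have "W y = 0" if "norm y < b"
      proof -
        have "open {x::'a. norm x < b}" by (intro open_Collect_less continuous_intros)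
        from has_derivative_transform_within_open[OF C1_gradD(1)[OF C] this, of y "\<lambda>_. 0"]
        have "((\<lambda>_. 0) has_derivative (\<lambda>h. W y \<bullet> h)) (at y)" using that wb by auto
        then have "grad (\<lambda>_. 0) y = W y" by (rule grad_eqI)
        moreover have "grad (\<lambda>_::'a. 0::real) y = 0" by (rule grad_eqI) simp
        ultimately show ?thesis by simp
      qed
      ultimately show "norm (W y - 0) \<le> 0" using that WR by auto
    qed
    then show ?thesis by simp
  qed
  have sub: "closure {x. \<psi> n x \<noteq> 0} \<subseteq> {x. (a + b) / 2 \<le> norm x} \<inter> cball 0 (R + 1)" for n
  proof (rule closure_minimal)
    show "{x. \<psi> n x \<noteq> 0} \<subseteq> {x. (a + b) / 2 \<le> norm x} \<inter> cball 0 (R + 1)"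
      using \<psi>0 by (force simp: not_le[symmetric])
    show "closed ({x::'a. (a + b) / 2 \<le> norm x} \<inter> cball 0 (R + 1))"
      by (intro closed_Int closed_Collect_le closed_cball continuous_intros)
  qed
  have "\<psi> n \<in> test_functions {x. a < norm x}" for n
    unfolding test_functions_def
  proof (intro CollectI conjI allI)
    show "C_diff k (\<psi> n)" for k
      unfolding \<psi>_def by (rule C_diff_conv[OF C_diff_mollifier mollifier_eq_0[OF r0] iw])
    have "bounded (closure {x. \<psi> n x \<noteq> 0})"
      using sub[of n] bounded_subset[OF bounded_cball] by blast
    then show "compact (closure {x. \<psi> n x \<noteq> 0})" by (simp add: compact_eq_bounded_closed)
    have "{x::'a. (a + b) / 2 \<le> norm x} \<subseteq> {x. a < norm x}" using ab by auto
    then show "closure {x. \<psi> n x \<noteq> 0} \<subseteq> {x. a < norm x}" using sub[of n] by blast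
  qed
  moreover have "0 \<le> \<psi> n x" for n x
    unfolding \<psi>_def using conv_mollifier_nonneg[OF r0 nn] .
  ultimately have le: "(\<integral>x. P x \<bullet> grad (\<psi> n) x + q x * \<psi> n x \<partial>lborel) \<le> 0" for n
    by (rule test)
  have [measurable]: "\<psi> n \<in> borel_measurable borel" "grad (\<psi> n) \<in> borel_measurable borel" for n
    unfolding grad\<psi> unfolding \<psi>_def by measurable
  have "(\<lambda>n. \<integral>x. P x \<bullet> grad (\<psi> n) x + q x * \<psi> n x \<partial>lborel) \<longlonglongrightarrow> (\<integral>x. P x \<bullet> W x + q x * w x \<partial>lborel)"
  proof (rule integral_dominated_convergence
      [where w = "\<lambda>x. B * (indicator {x. a < norm x \<and> norm x \<le> R + 2} x * (norm (P x) + \<bar>q x\<bar>))"])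
    show "integrable lborel (\<lambda>x. B * (indicator {x. a < norm x \<and> norm x \<le> R + 2} x * (norm (P x) + \<bar>q x\<bar>)))"
      using int by simp
    show "AE x in lborel. (\<lambda>n. P x \<bullet> grad (\<psi> n) x + q x * \<psi> n x) \<longlonglongrightarrow> P x \<bullet> W x + q x * w x"
    proof (rule AE_I2)
      fix x
      have lims: "(\<lambda>n. conv (mollifier (r n)) h x) \<longlonglongrightarrow> h x"
        if h: "integrable lborel h" and hc: "continuous_on UNIV h" for h :: "'a \<Rightarrow> 'c::euclidean_space"
      proof (rule LIMSEQ_I)
        fix e :: real assume "e > 0"
        have "isCont h x" using hc by (simp add: continuous_on_eq_continuous_at)
        then obtain d where d: "d > 0" "\<And>y. dist y x < d \<Longrightarrow> dist (h y) (h x) < e / 2"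
          using \<open>e > 0\<close> unfolding continuous_at_eps_delta by (meson half_gt_zero)
        obtain N where N: "\<And>n. n \<ge> N \<Longrightarrow> r n < d"
          using order_tendstoD(2)[OF rlim d(1)] by (auto simp: eventually_sequentially)
        have close: "norm (conv (mollifier (r n)) h x - h x) \<le> e / 2" if "n \<ge> N" for n
        proof (rule conv_mollifier_close[OF r0 h])
          fix y assume "norm (x - y) < r n"
          then have "dist y x < d" using N[OF that] by (simp add: dist_norm norm_minus_commute)
          from d(2)[OF this] show "norm (h y - h x) \<le> e / 2" by (simp add: dist_norm)
        qed
        show "\<exists>N. \<forall>n\<ge>N. norm (conv (mollifier (r n)) h x - h x) < e"
        proof (intro exI[of _ N] allI impI)
          fix n assume "N \<le> n"
          from close[OF this] \<open>e > 0\<close> show "norm (conv (mollifier (r n)) h x - h x) < e" by linarith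
        qed
      qed
      show "(\<lambda>n. P x \<bullet> grad (\<psi> n) x + q x * \<psi> n x) \<longlonglongrightarrow> P x \<bullet> W x + q x * w x"
        unfolding grad\<psi> unfolding \<psi>_def by (intro tendsto_intros lims iw iW wc Wc)
    qed
    show "AE x in lborel. norm (P x \<bullet> grad (\<psi> n) x + q x * \<psi> n x)
        \<le> B * (indicator {x. a < norm x \<and> norm x \<le> R + 2} x * (norm (P x) + \<bar>q x\<bar>))" for n
    proof (rule AE_I2)
      fix x
      show "norm (P x \<bullet> grad (\<psi> n) x + q x * \<psi> n x)
        \<le> B * (indicator {x. a < norm x \<and> norm x \<le> R + 2} x * (norm (P x) + \<bar>q x\<bar>))"
      proof (cases "a < norm x \<and> norm x \<le> R + 2")
        case True
        have "norm (\<psi> n x - 0) \<le> B" unfolding \<psi>_def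
          by (rule conv_mollifier_close[OF r0 iw]) (use B in simp)
        then have 1: "\<bar>q x * \<psi> n x\<bar> \<le> \<bar>q x\<bar> * B" by (auto simp: abs_mult intro: mult_left_mono)
        have "norm (grad (\<psi> n) x - 0) \<le> B" unfolding grad\<psi>
          by (rule conv_mollifier_close[OF r0 iW]) (use B in simp)
        then have "norm (P x) * norm (grad (\<psi> n) x) \<le> norm (P x) * B"
          by (intro mult_left_mono) auto
        then have "\<bar>P x \<bullet> grad (\<psi> n) x\<bar> \<le> norm (P x) * B"
          using Cauchy_Schwarz_ineq2 order_trans by blast
        with 1 show ?thesis using True by (simp add: algebra_simps)
      next
        case False
        have "grad (\<psi> n) x = 0" using grad0[of x n] False by auto
        moreover have "\<psi> n x = 0"
          using \<psi>0[of x n] False ab by (auto simp: field_simps)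
        ultimately show ?thesis using False by simp
      qed
    qed
  qed measurable
  then show ?thesis by (rule LIMSEQ_le_const2) (use le in auto)
qed

text \<open>On the annulus between b and b' both formulas give 0, so each of two overlapping open
  sets that cover the space carries a single expression.\<close>

lemma C1_grad_glue:
  fixes w :: "'a::euclidean_space \<Rightarrow> real"
  assumes b: "b < b'"
    and d: "\<And>x. b < norm x \<Longrightarrow> (w has_derivative (\<lambda>h. W x \<bullet> h)) (at x)"
    and c: "continuous_on {x. b < norm x} W"
    and z: "\<And>x. b < norm x \<Longrightarrow> norm x < b' \<Longrightarrow> w x = 0 \<and> W x = 0"
  shows "C1_grad (\<lambda>x. if norm x \<le> b then 0 else w x) (\<lambda>x. if norm x \<le> b then 0 else W x)"
proof -
  let ?w = "\<lambda>x. if norm x \<le> b then 0 else w x" and ?W = "\<lambda>x. if norm x \<le> b then 0 else W x"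
  have o: "open {x::'a. b < norm x}" "open {x::'a. norm x < b'}"
    by (intro open_Collect_less continuous_intros)+
  have "(?w has_derivative (\<lambda>h. ?W x \<bullet> h)) (at x)" for x
  proof (cases "b < norm x")
    case True
    show ?thesis
      by (rule has_derivative_transform_within_open[OF _ o(1)]) (use d[OF True] True in auto)
  next
    case False
    have "((\<lambda>_. 0) has_derivative (\<lambda>h. ?W x \<bullet> h)) (at x)" using False by simp
    then show ?thesis
      by (rule has_derivative_transform_within_open[OF _ o(2)]) (use False b z in auto)
  qed
  moreover have "continuous_on ({x. b < norm x} \<union> {x. norm x < b'}) ?W"
  proof (rule continuous_on_open_Un[OF o])
    show "continuous_on {x. b < norm x} ?W"
      using c by (rule continuous_on_eq) auto
    show "continuous_on {x. norm x < b'} ?W"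
      using continuous_on_const[of _ 0] by (rule continuous_on_eq) (use z in auto)
  qed
  moreover have "{x::'a. b < norm x} \<union> {x. norm x < b'} = UNIV" using b by auto
  ultimately show ?thesis by (simp add: C1_grad_def)
qed

section \<open>Functions with a weak gradient outside a ball\<close>

lemma powr_ge_self:
  fixes q t :: real
  assumes "1 < q" "0 \<le> t"
  shows "t \<le> 1 + t powr q"
proof (cases "t \<le> 1")
  case True
  then show ?thesis using powr_ge_zero[of t q] by linarith
next
  case False
  have "t powr 1 \<le> t powr q" using False assms(1) by (intro powr_mono) auto
  then show ?thesis using False by simp
qed

text \<open>The function g is tied to u only through test functions supported in a < |x|; inside the
  ball the two are unrelated. Borel functions on the whole space allow all integrals to be taken
  over \<open>lborel\<close>.\<close>

locale exterior_sobolev =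
  fixes a s p :: real and u :: "'a::euclidean_space \<Rightarrow> real" and g :: "'a \<Rightarrow> 'a"
  assumes a: "0 < a" and s: "1 < s" and p: "1 < p"
    and u_borel [measurable]: "u \<in> borel_measurable borel"
    and g_borel [measurable]: "g \<in> borel_measurable borel"
    and u_int: "integrable lborel (\<lambda>x. \<bar>u x\<bar> powr s)"
    and g_int: "integrable lborel (\<lambda>x. norm (g x) powr p)"
    and weak_gradient: "\<And>\<phi> i. \<phi> \<in> test_functions {x. a < norm x} \<Longrightarrow> i \<in> Basis \<Longrightarrow>
      (\<integral>x. u x * frechet_derivative \<phi> (at x) i \<partial>lborel) = - (\<integral>x. (g x \<bullet> i) * \<phi> x \<partial>lborel)"
begin

lemma integrable_cball_u: "integrable lborel (\<lambda>x. indicator (cball 0 L) x * u x)"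
proof (rule Bochner_Integration.integrable_bound
    [where f = "\<lambda>x. 1 * indicator (cball 0 L) x + \<bar>u x\<bar> powr s"])
  show "integrable lborel (\<lambda>x. 1 * indicator (cball 0 L) x + \<bar>u x\<bar> powr s)"
    by (intro Bochner_Integration.integrable_add integrable_const_cball u_int)
  show "AE x in lborel. norm (indicator (cball 0 L) x * u x)
      \<le> norm (1 * indicator (cball 0 L) x + \<bar>u x\<bar> powr s)"
    using powr_ge_self[OF s, of "\<bar>u _\<bar>"] by (auto simp: indicator_def)
next
  have "cball 0 L \<in> sets borel" by simp
  then show "(\<lambda>x. indicator (cball 0 L) x * u x) \<in> borel_measurable lborel" by measurable
qed

lemma integrable_cball_g: "integrable lborel (\<lambda>x. indicator (cball 0 L) x *\<^sub>R g x)"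
proof (rule Bochner_Integration.integrable_bound
    [where f = "\<lambda>x. 1 * indicator (cball 0 L) x + norm (g x) powr p"])
  show "integrable lborel (\<lambda>x. 1 * indicator (cball 0 L) x + norm (g x) powr p)"
    by (intro Bochner_Integration.integrable_add integrable_const_cball g_int)
  show "AE x in lborel. norm (indicator (cball 0 L) x *\<^sub>R g x)
      \<le> norm (1 * indicator (cball 0 L) x + norm (g x) powr p)"
    using powr_ge_self[OF p, of "norm (g _)"] by (auto simp: indicator_def)
next
  have "cball 0 L \<in> sets borel" by simp
  then show "(\<lambda>x. indicator (cball 0 L) x *\<^sub>R g x) \<in> borel_measurable lborel" by measurable
qed

text \<open>For x at distance more than r from the ball, the shifted kernel is an admissible test
  function, and the weak gradient identity moves the derivative from the kernel to g. Truncation to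
  radius L provides integrability and is not felt at x.\<close>

lemma grad_conv:
  assumes r: "r > 0" and x: "a + r < norm x" "norm x + r < L"
  shows "grad (conv (mollifier r) (\<lambda>x. indicator (cball 0 L) x * u x)) x
    = conv (mollifier r) (\<lambda>x. indicator (cball 0 L) x *\<^sub>R g x) x" (is "grad (conv _ ?u) x = conv _ ?g x")
proof (rule euclidean_eqI)
  fix i :: 'a assume i: "i \<in> Basis"
  let ?\<kappa> = "mollifier r :: 'a \<Rightarrow> real"
  have C: "C1_grad ?\<kappa> (grad ?\<kappa>)" by (rule C1_grad_grad[OF C_diff_mollifier])
  define \<phi> where "\<phi> y = ?\<kappa> (x - y)" for y
  have in_ball: "a < norm y \<and> norm y < L" if "norm (x - y) \<le> r" for y
    using that x norm_triangle_ineq2[of x y] norm_triangle_ineq2[of y x]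
    by (auto simp: norm_minus_commute)
  have sub: "closure {y. \<phi> y \<noteq> 0} \<subseteq> cball x r"
    by (rule closure_minimal) (use mollifier_eq_0[OF r] in \<open>force simp: \<phi>_def dist_norm\<close>)+
  have test: "\<phi> \<in> test_functions {x. a < norm x}"
    unfolding test_functions_def
  proof (intro CollectI conjI allI)
    show "C_diff k \<phi>" for k unfolding \<phi>_def[abs_def] by (rule C_diff_mollifier_shift)
    show "compact (closure {y. \<phi> y \<noteq> 0})"
      using sub bounded_subset[OF bounded_cball] by (auto simp: compact_eq_bounded_closed)
    have "cball x r \<subseteq> {x. a < norm x}" using in_ball by (auto simp: dist_norm)
    then show "closure {y. \<phi> y \<noteq> 0} \<subseteq> {x. a < norm x}" using sub by blast
  qed
  have fd: "frechet_derivative \<phi> (at y) i = - (grad ?\<kappa> (x - y) \<bullet> i)" for y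
  proof (rule frechet_derivative_eqI)
    have "((\<lambda>y. x - y) has_derivative (\<lambda>h. - h)) (at y)"
      by (auto intro!: derivative_eq_intros)
    from has_derivative_compose[OF this C1_gradD(1)[OF C]]
    show "(\<phi> has_derivative (\<lambda>i. - (grad ?\<kappa> (x - y) \<bullet> i))) (at y)"
      by (simp add: \<phi>_def[abs_def])
  qed
  have gz: "grad ?\<kappa> (x - y) = 0" if "r < norm (x - y)" for y
    by (rule C1_grad_support[where r = r, OF C mollifier_eq_0[OF r]]) (use that in auto)
  have int: "integrable lborel (\<lambda>y. ?u y *\<^sub>R grad ?\<kappa> (x - y))"
  proof -
    have [measurable]: "grad ?\<kappa> \<in> borel_measurable borel"
      using C1_gradD(2)[OF C] borel_measurable_continuous_onI by blast
    have "grad ?\<kappa> x = 0" if "r + 1 \<le> norm x" for x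
      by (rule C1_grad_support[where r = r, OF C mollifier_eq_0[OF r]]) (use that in auto)
    then obtain B where B: "B > 0" "\<And>x. norm (grad ?\<kappa> x) \<le> B"
      using compact_support_bounded[OF C1_gradD(2)[OF C], of "r + 1"] by metis
    show ?thesis
    proof (rule Bochner_Integration.integrable_bound[where f = "\<lambda>y. B * ?u y"])
      show "(\<lambda>y. ?u y *\<^sub>R grad ?\<kappa> (x - y)) \<in> borel_measurable lborel"
        using borel_measurable_integrable[OF integrable_cball_u] by measurable
      show "integrable lborel (\<lambda>y. B * ?u y)" using integrable_cball_u by simp
      show "AE y in lborel. norm (?u y *\<^sub>R grad ?\<kappa> (x - y)) \<le> norm (B * ?u y)"
        using B by (auto simp: abs_mult mult.commute[of B] intro!: AE_I2 mult_left_mono)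
    qed
  qed
  have ig: "integrable lborel (\<lambda>y. ?\<kappa> (x - y) *\<^sub>R ?g y)"
    by (rule integrable_conv_mollifier[OF r integrable_cball_g])
  have "grad (conv ?\<kappa> ?u) x = (\<integral>y. ?u y *\<^sub>R grad ?\<kappa> (x - y) \<partial>lborel)"
    by (rule grad_eqI[OF conv_has_derivative[OF C mollifier_eq_0[OF r] integrable_cball_u]])
  then have "grad (conv ?\<kappa> ?u) x \<bullet> i = (\<integral>y. ?u y *\<^sub>R grad ?\<kappa> (x - y) \<bullet> i \<partial>lborel)"
    by (simp only: integral_inner_left[OF int])
  also have "\<dots> = - (\<integral>y. u y * frechet_derivative \<phi> (at y) i \<partial>lborel)"
    unfolding fd Bochner_Integration.integral_minus[symmetric]
  proof (intro Bochner_Integration.integral_cong refl)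
    fix y
    show "?u y *\<^sub>R grad ?\<kappa> (x - y) \<bullet> i = - (u y * - (grad ?\<kappa> (x - y) \<bullet> i))"
      using in_ball[of y] gz[of y] by (cases "norm (x - y) \<le> r") (auto simp: indicator_def)
  qed
  also have "\<dots> = (\<integral>y. (g y \<bullet> i) * \<phi> y \<partial>lborel)"
    using weak_gradient[OF test i] by simp
  also have "\<dots> = (\<integral>y. (?\<kappa> (x - y) *\<^sub>R ?g y) \<bullet> i \<partial>lborel)"
  proof (intro Bochner_Integration.integral_cong refl)
    fix y
    show "(g y \<bullet> i) * \<phi> y = (?\<kappa> (x - y) *\<^sub>R ?g y) \<bullet> i"
      using in_ball[of y] mollifier_eq_0[OF r, of "x - y"]
      by (cases "norm (x - y) \<le> r") (auto simp: indicator_def \<phi>_def)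
  qed
  also have "\<dots> = conv ?\<kappa> ?g x \<bullet> i"
    unfolding conv_def by (rule integral_inner_left[OF ig])
  finally show "grad (conv ?\<kappa> ?u) x \<bullet> i = conv ?\<kappa> ?g x \<bullet> i" .
qed

end

section \<open>Test functions depending on a quotient\<close>

lemma grad_form_mult:
  assumes "(f has_derivative (\<lambda>h. F \<bullet> h)) (at x)" "(k has_derivative (\<lambda>h. G \<bullet> h)) (at x)"
  shows "((\<lambda>x. f x * k x) has_derivative (\<lambda>h. (f x *\<^sub>R G + k x *\<^sub>R F) \<bullet> h)) (at x)"
  by (rule has_derivative_eq_rhs[OF has_derivative_mult[OF assms]])
    (auto simp: inner_add_left algebra_simps)

lemma grad_form_divide:
  fixes f k :: "'a::euclidean_space \<Rightarrow> real"
  assumes "(f has_derivative (\<lambda>h. F \<bullet> h)) (at x)" "(k has_derivative (\<lambda>h. G \<bullet> h)) (at x)" "k x \<noteq> 0"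
  shows "((\<lambda>x. f x / k x) has_derivative (\<lambda>h. ((1 / k x) *\<^sub>R (F - (f x / k x) *\<^sub>R G)) \<bullet> h)) (at x)"
  by (rule has_derivative_eq_rhs[OF has_derivative_divide'[OF assms]])
    (use assms(3) in \<open>auto simp: inner_diff_left field_simps\<close>)

lemma grad_form_compose:
  assumes "(f has_derivative (\<lambda>h. F \<bullet> h)) (at x)" "(\<phi> has_real_derivative c) (at (f x))"
  shows "((\<lambda>x. \<phi> (f x)) has_derivative (\<lambda>h. (c *\<^sub>R F) \<bullet> h)) (at x)"
  using has_derivative_compose[OF assms(1) assms(2)[unfolded has_field_derivative_def]]
  by simp

lemma grad_form_radial:
  fixes x :: "'a::euclidean_space"
  assumes "x \<noteq> 0" "(\<phi> has_real_derivative c) (at (norm x))"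
  shows "((\<lambda>x. \<phi> (norm x)) has_derivative (\<lambda>h. ((c / norm x) *\<^sub>R x) \<bullet> h)) (at x)"
proof -
  have "(norm has_derivative (\<lambda>h. sgn x \<bullet> h)) (at x)"
    using GDERIV_norm[OF assms(1)] by (simp add: gderiv_def inner_commute)
  from grad_form_compose[OF this assms(2)] show ?thesis
    by (simp add: sgn_div_norm divide_inverse)
qed

context exterior_sobolev
begin

text \<open>The gradient of u / v for radial v whose profile has derivative v', with g in place of
  the gradient of u.\<close>

definition quot_grad :: "(real \<Rightarrow> real) \<Rightarrow> (real \<Rightarrow> real) \<Rightarrow> 'a \<Rightarrow> 'a" where
  "quot_grad v v' x = (1 / v (norm x)) *\<^sub>R (g x - (u x / v (norm x) * v' (norm x) / norm x) *\<^sub>R x)"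

text \<open>This is P . W + q w for w = zeta(|x|) Q(u / v), with W expanded by the chain rule. As u
  is only weakly differentiable, the expanded expression is the definition, and it is reached as a
  limit of mollified versions.\<close>

definition chain_integrand ::
    "('a \<Rightarrow> 'a) \<Rightarrow> ('a \<Rightarrow> real) \<Rightarrow> (real \<Rightarrow> real) \<Rightarrow> (real \<Rightarrow> real) \<Rightarrow> (real \<Rightarrow> real) \<Rightarrow> (real \<Rightarrow> real)
      \<Rightarrow> (real \<Rightarrow> real) \<Rightarrow> (real \<Rightarrow> real) \<Rightarrow> 'a \<Rightarrow> real" where
  "chain_integrand P q v v' \<zeta> \<zeta>' Q Q' x = (if a < norm x then
      P x \<bullet> ((\<zeta> (norm x) * Q' (u x / v (norm x))) *\<^sub>R quot_grad v v' x
        + (Q (u x / v (norm x)) * \<zeta>' (norm x) / norm x) *\<^sub>R x)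
      + q x * (Q (u x / v (norm x)) * \<zeta> (norm x)) else 0)"

text \<open>
  Test functions \<open>\<zeta>(|x|) Q(u / v)\<close>, where \<open>v\<close> is a smooth radial barrier and \<open>u < v\<close> near the
  sphere \<open>|x| = a\<close>: the composition with \<open>Q\<close> removes the need for a cutoff there.
\<close>

lemma chain_test:
  fixes P :: "'a \<Rightarrow> 'a" and q :: "'a \<Rightarrow> real"
  assumes Pq [measurable]: "P \<in> borel_measurable borel" "q \<in> borel_measurable borel"
    and J: "\<And>w W b R. C1_grad w W \<Longrightarrow> (\<And>x. 0 \<le> w x) \<Longrightarrow> a < b \<Longrightarrow> (\<And>x. norm x \<le> b \<Longrightarrow> w x = 0) \<Longrightarrow>
      (\<And>x. R \<le> norm x \<Longrightarrow> w x = 0) \<Longrightarrow> (\<integral>x. P x \<bullet> W x + q x * w x \<partial>lborel) \<le> 0"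
    and [measurable]: "v \<in> borel_measurable borel" "v' \<in> borel_measurable borel"
      "\<zeta> \<in> borel_measurable borel" "\<zeta>' \<in> borel_measurable borel"
    and v: "\<And>r. a \<le> r \<Longrightarrow> 0 < v r" "\<And>r. a \<le> r \<Longrightarrow> (v has_real_derivative v' r) (at r)"
      "continuous_on {a..} v'"
    and \<zeta>: "\<And>r. a \<le> r \<Longrightarrow> 0 \<le> \<zeta> r" "\<And>r. a \<le> r \<Longrightarrow> (\<zeta> has_real_derivative \<zeta>' r) (at r)"
      "continuous_on {a..} \<zeta>'" "\<And>r. R \<le> r \<Longrightarrow> \<zeta> r = 0" "\<And>r. R \<le> r \<Longrightarrow> \<zeta>' r = 0"
    and Q: "\<And>t. 0 \<le> Q t" "\<And>t. (Q has_real_derivative Q' t) (at t)" "continuous_on UNIV Q'"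
      "\<And>t. t \<le> 1 \<Longrightarrow> Q t = 0" "\<And>t. t \<le> 1 \<Longrightarrow> Q' t = 0"
    and near: "0 < \<delta>" "AE x in lborel. a < norm x \<and> norm x < a + \<delta> \<longrightarrow> u x \<le> c"
      "\<And>r. a < r \<Longrightarrow> r < a + \<delta> \<Longrightarrow> c \<le> v r"
    and dom: "integrable lborel W0"
      "\<And>x \<alpha> \<beta> d. a < norm x \<Longrightarrow> norm x \<le> R \<Longrightarrow> \<bar>\<alpha>\<bar> powr s \<le> d \<Longrightarrow> 0 \<le> \<beta> \<Longrightarrow> \<beta> powr p \<le> d \<Longrightarrow>
        norm (P x) * (\<bar>Q' (\<alpha> / v (norm x))\<bar> * (\<beta> + \<bar>\<alpha>\<bar>) + \<bar>Q (\<alpha> / v (norm x))\<bar>)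
          + \<bar>q x\<bar> * \<bar>Q (\<alpha> / v (norm x))\<bar> \<le> W0 x + K * d"
  shows "integrable lborel (chain_integrand P q v v' \<zeta> \<zeta>' Q Q')"
    and "integral\<^sup>L lborel (chain_integrand P q v v' \<zeta> \<zeta>' Q Q') \<le> 0"
proof -
  let ?F = "chain_integrand P q v v' \<zeta> \<zeta>' Q Q'"
  have [measurable]: "Q \<in> borel_measurable borel" "Q' \<in> borel_measurable borel"
    using Q(3) borel_measurable_continuous_onI DERIV_continuous_on[OF has_field_derivative_at_within[OF Q(2)]]
    by blast+
  have vc: "continuous_on {a..} v"
    by (rule DERIV_continuous_on[OF has_field_derivative_at_within[OF v(2)]]) simp
  have \<zeta>c: "continuous_on {a..} \<zeta>"
    by (rule DERIV_continuous_on[OF has_field_derivative_at_within[OF \<zeta>(2)]]) simp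
  have Qc: "continuous_on UNIV Q"
    by (rule DERIV_continuous_on[OF has_field_derivative_at_within[OF Q(2)]])
  \<comment> \<open>Mollification radii stay below 1, so for |x| at most R the truncation to radius
    L is not felt.\<close>
  define L where "L = R + 2"
  define uL where "uL x = indicator (cball 0 L) x * u x" for x
  define gL where "gL x = indicator (cball 0 L) x *\<^sub>R g x" for x
  have uL: "integrable lborel uL" and gL: "integrable lborel gL"
    using integrable_cball_u[of L] integrable_cball_g[of L] by (simp_all add: uL_def[abs_def] gL_def[abs_def])
  have [measurable]: "uL \<in> borel_measurable borel" "gL \<in> borel_measurable borel"
    using uL gL by auto
  have uLs: "integrable lborel (\<lambda>x. \<bar>uL x\<bar> powr s)"
    by (rule Bochner_Integration.integrable_bound[OF u_int]) (auto simp: uL_def indicator_def)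
  have gLp: "integrable lborel (\<lambda>x. norm (gL x) powr p)"
    by (rule Bochner_Integration.integrable_bound[OF g_int]) (auto simp: gL_def indicator_def)
  obtain r0 D where r0: "\<And>n. 0 < r0 n" "r0 \<longlonglongrightarrow> 0" and D: "integrable lborel D"
    and AE0: "AE x in lborel. (\<lambda>n. conv (mollifier (r0 n)) uL x) \<longlonglongrightarrow> uL x
      \<and> (\<lambda>n. conv (mollifier (r0 n)) gL x) \<longlonglongrightarrow> gL x
      \<and> (\<forall>n. \<bar>conv (mollifier (r0 n)) uL x\<bar> powr s \<le> D x \<and> norm (conv (mollifier (r0 n)) gL x) powr p \<le> D x)"
    by (rule mollify_dominated[OF uL gL uLs gLp s p], rule that)
  \<comment> \<open>Early terms are dropped until the radius is below \<delta>/4, so that the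
    mollified u inherits the bound c for a + \<delta>/4 < |x| < a + \<delta>/2.\<close>
  obtain n0 where n0: "\<And>n. n0 \<le> n \<Longrightarrow> r0 n < min 1 (\<delta> / 4)"
    using order_tendstoD(2)[OF r0(2), of "min 1 (\<delta> / 4)"] near(1) by (auto simp: eventually_sequentially)
  define r where "r n = r0 (n + n0)" for n
  have r: "r n > 0" "r n < 1" "r n < \<delta> / 4" for n
    using r0(1) n0[of "n + n0"] by (auto simp: r_def)
  define un where "un n = conv (mollifier (r n)) uL" for n
  define gn where "gn n = conv (mollifier (r n)) gL" for n
  have AE1: "AE x in lborel. (\<lambda>n. un n x) \<longlonglongrightarrow> uL x \<and> (\<lambda>n. gn n x) \<longlonglongrightarrow> gL x
      \<and> (\<forall>n. \<bar>un n x\<bar> powr s \<le> D x \<and> norm (gn n x) powr p \<le> D x)"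
    using AE0
  proof eventually_elim
    case (elim x)
    then show ?case
      using LIMSEQ_ignore_initial_segment[of "\<lambda>n. conv (mollifier (r0 n)) uL x" _ n0]
        LIMSEQ_ignore_initial_segment[of "\<lambda>n. conv (mollifier (r0 n)) gL x" _ n0]
      by (simp add: un_def gn_def r_def)
  qed
  have unC: "C1_grad (un n) (grad (un n))" for n
    unfolding un_def by (intro C1_grad_grad C_diff_conv[OF C_diff_mollifier mollifier_eq_0 uL] r)
  have gradun: "grad (un n) x = gn n x" if "a + \<delta> / 4 < norm x" "norm x \<le> R" for n x
    unfolding un_def gn_def uL_def[abs_def] gL_def[abs_def]
    by (rule grad_conv) (use that r[of n] in \<open>auto simp: L_def\<close>)
  have un_le: "un n x \<le> c" if "a + \<delta> / 4 < norm x" "norm x < a + \<delta> / 2" "norm x \<le> R" for n x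
    unfolding un_def
  proof (rule conv_mollifier_le[OF r(1) uL])
    show "AE y in lborel. norm (x - y) < r n \<longrightarrow> uL y \<le> c"
      using near(2)
    proof (eventually_elim, intro impI)
      case (elim y)
      assume y: "norm (x - y) < r n"
      have "a < norm y" "norm y < a + \<delta>" "norm y \<le> L"
        using y that r[of n] norm_triangle_ineq2[of x y] norm_triangle_ineq2[of y x]
        by (auto simp: L_def norm_minus_commute)
      with elim show "uL y \<le> c" by (simp add: uL_def)
    qed
  qed
  \<comment> \<open>Between b and a + \<delta>/2 the mollified quotient is at most 1 as long as |x|
    is at most R, so Q vanishes; beyond R the factor zeta does. This annulus is the overlap for the
    gluing.\<close>
  define b where "b = a + \<delta> / 4"
  have b: "a < b" "b < a + \<delta> / 2" "0 < b" using near(1) a by (auto simp: b_def)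
  define tn where "tn n x = un n x / v (norm x)" for n x
  define Dn where "Dn n x = (1 / v (norm x)) *\<^sub>R (grad (un n) x - (tn n x * v' (norm x) / norm x) *\<^sub>R x)" for n x
  define wn where "wn n x = Q (tn n x) * \<zeta> (norm x)" for n x
  define Wn where "Wn n x = (\<zeta> (norm x) * Q' (tn n x)) *\<^sub>R Dn n x
    + (Q (tn n x) * \<zeta>' (norm x) / norm x) *\<^sub>R x" for n x
  define wb where "wb n x = (if norm x \<le> b then 0 else wn n x)" for n x
  define Wb where "Wb n x = (if norm x \<le> b then 0 else Wn n x)" for n x
  have tn_le: "tn n x \<le> 1" if "b < norm x" "norm x < a + \<delta> / 2" "norm x \<le> R" for n x
  proof -
    have "un n x \<le> c" using un_le that by (simp add: b_def)
    also have "c \<le> v (norm x)" using near that b by auto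
    finally have "un n x \<le> v (norm x)" .
    moreover have "0 < v (norm x)" by (rule v(1)) (use that b in linarith)
    ultimately show ?thesis by (simp add: tn_def divide_le_eq)
  qed
  have Cb: "C1_grad (wb n) (Wb n)" for n
    unfolding wb_def[abs_def] Wb_def[abs_def]
  proof (rule C1_grad_glue[OF b(2)])
    fix x :: 'a assume x: "b < norm x"
    with b have x0: "x \<noteq> 0" "a \<le> norm x" by auto
    have "((\<lambda>x. tn n x) has_derivative (\<lambda>h. Dn n x \<bullet> h)) (at x)"
      using grad_form_divide[OF C1_gradD(1)[OF unC] grad_form_radial[OF x0(1) v(2)[OF x0(2)]]] v(1)[OF x0(2)]
      by (simp add: tn_def Dn_def)
    from grad_form_mult[OF grad_form_compose[OF this Q(2)] grad_form_radial[OF x0(1) \<zeta>(2)[OF x0(2)]]]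
    show "(wn n has_derivative (\<lambda>h. Wn n x \<bullet> h)) (at x)"
      by (simp add: wn_def[abs_def] Wn_def add.commute)
  next
    have nc: "continuous_on {x::'a. b < norm x} norm" by (intro continuous_intros)
    have im: "norm ` {x::'a. b < norm x} \<subseteq> {a..}" using b by auto
    note rad = continuous_on_compose2[OF _ nc im]
    have ut: "continuous_on {x. b < norm x} (un n)" "continuous_on {x. b < norm x} (grad (un n))"
      using C1_gradD[OF unC] by auto
    have v0: "\<forall>x\<in>{x::'a. b < norm x}. v (norm x) \<noteq> 0"
      by (intro ballI less_imp_neq[symmetric] v(1)) (use b in auto)
    have n0: "\<forall>x\<in>{x::'a. b < norm x}. norm x \<noteq> 0" using b by auto
    have tc: "continuous_on {x. b < norm x} (tn n)"
      unfolding tn_def by (intro continuous_on_divide ut rad[OF vc] v0)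
    have "continuous_on {x. b < norm x} (Dn n)"
      unfolding Dn_def
      by (intro continuous_on_scaleR continuous_on_divide continuous_on_const continuous_on_diff
          continuous_on_mult continuous_on_id ut tc rad[OF vc] rad[OF v(3)] nc v0 n0)
    then show "continuous_on {x. b < norm x} (Wn n)"
      unfolding Wn_def
      by (intro continuous_on_scaleR continuous_on_divide continuous_on_const continuous_on_add
          continuous_on_mult continuous_on_id rad[OF \<zeta>c] rad[OF \<zeta>(3)] nc n0
          continuous_on_compose2[OF Qc tc] continuous_on_compose2[OF Q(3) tc]) auto
  next
    fix x :: 'a assume x: "b < norm x" "norm x < a + \<delta> / 2"
    show "wn n x = 0 \<and> Wn n x = 0"
    proof (cases "norm x \<le> R")
      case True
      then show ?thesis using Q(4,5)[OF tn_le[OF x True]] by (simp add: wn_def Wn_def)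
    qed (simp add: wn_def Wn_def \<zeta>)
  qed
  have le: "(\<integral>x. P x \<bullet> Wb n x + q x * wb n x \<partial>lborel) \<le> 0" for n
  proof (rule J[OF Cb _ b(1)])
    show "0 \<le> wb n x" for x
    proof (cases "norm x \<le> b")
      case False
      then have "a \<le> norm x" using b(1) by linarith
      from \<zeta>(1)[OF this] show ?thesis using Q(1) by (simp add: wb_def wn_def)
    qed (simp add: wb_def)
    show "norm x \<le> b \<Longrightarrow> wb n x = 0" for x by (simp add: wb_def)
    show "R \<le> norm x \<Longrightarrow> wb n x = 0" for x using \<zeta> by (simp add: wb_def wn_def)
  qed
  have bd: "\<exists>B. \<forall>r. a \<le> r \<and> r \<le> R \<longrightarrow> \<bar>h r\<bar> \<le> B" if "continuous_on {a..} h" for h :: "real \<Rightarrow> real"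
  proof -
    have "compact (h ` {a..R})"
      using that a by (intro compact_continuous_image) (auto intro: continuous_on_subset)
    then obtain B where "\<forall>z\<in>h ` {a..R}. norm z \<le> B"
      using compact_imp_bounded bounded_iff by blast
    then show ?thesis by (intro exI[of _ B]) auto
  qed
  have v0: "\<forall>r\<in>{a..}. v r \<noteq> 0" "\<forall>r\<in>{a..}. v r * v r \<noteq> 0"
    by (intro ballI less_imp_neq[symmetric] mult_pos_pos v(1); simp)+
  obtain B1 where B1: "\<And>r. a \<le> r \<Longrightarrow> r \<le> R \<Longrightarrow> \<bar>\<zeta> r / v r\<bar> \<le> B1"
    using bd[of "\<lambda>r. \<zeta> r / v r"] continuous_on_divide[OF \<zeta>c vc v0(1)] by blast
  obtain B2 where B2: "\<And>r. a \<le> r \<Longrightarrow> r \<le> R \<Longrightarrow> \<bar>\<zeta> r * v' r / (v r * v r)\<bar> \<le> B2"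
    using bd[of "\<lambda>r. \<zeta> r * v' r / (v r * v r)"]
      continuous_on_divide[OF continuous_on_mult[OF \<zeta>c v(3)] continuous_on_mult[OF vc vc] v0(2)] by blast
  obtain B3 where B3: "\<And>r. a \<le> r \<Longrightarrow> r \<le> R \<Longrightarrow> \<bar>\<zeta>' r\<bar> \<le> B3" using bd[OF \<zeta>(3)] by blast
  obtain B4 where B4: "\<And>r. a \<le> r \<Longrightarrow> r \<le> R \<Longrightarrow> \<bar>\<zeta> r\<bar> \<le> B4" using bd[OF \<zeta>c] by blast
  define B where "B = \<bar>B1\<bar> + \<bar>B2\<bar> + \<bar>B3\<bar> + \<bar>B4\<bar>"
  have B: "0 \<le> B" "B1 \<le> B" "B2 \<le> B" "B3 \<le> B" "B4 \<le> B" by (auto simp: B_def)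
  have bound: "\<bar>P x \<bullet> Wb n x + q x * wb n x\<bar> \<le> B * (\<bar>W0 x\<bar> + \<bar>K\<bar> * D x)"
    if AE: "\<bar>un n x\<bar> powr s \<le> D x" "norm (gn n x) powr p \<le> D x" for n x
  proof (cases "b < norm x \<and> norm x \<le> R")
    case False
    have "0 \<le> D x" using AE(1) powr_ge_zero order_trans by blast
    then have "0 \<le> B * (\<bar>W0 x\<bar> + \<bar>K\<bar> * D x)" using B by simp
    moreover have "Wb n x = 0" "wb n x = 0"
      using False by (auto simp: Wb_def wb_def Wn_def wn_def \<zeta>)
    ultimately show ?thesis by simp
  next
    case True
    let ?r = "norm x"
    have rr: "a \<le> ?r" "?r \<le> R" "0 < ?r" using True b by auto
    have vp: "0 < v ?r" using v(1) rr by simp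
    have unit: "norm (x /\<^sub>R ?r) = 1" using rr(3) by simp
    let ?q' = "\<bar>Q' (tn n x)\<bar>" and ?q = "\<bar>Q (tn n x)\<bar>"
    have "norm ((\<zeta> ?r * Q' (tn n x)) *\<^sub>R Dn n x) = ?q' * norm ((\<zeta> ?r / v ?r) *\<^sub>R gn n x
        - ((\<zeta> ?r * v' ?r / (v ?r * v ?r)) * un n x) *\<^sub>R (x /\<^sub>R ?r))"
    proof -
      have "(\<zeta> ?r * Q' (tn n x)) *\<^sub>R Dn n x = Q' (tn n x) *\<^sub>R ((\<zeta> ?r / v ?r) *\<^sub>R gn n x
        - ((\<zeta> ?r * v' ?r / (v ?r * v ?r)) * un n x) *\<^sub>R (x /\<^sub>R ?r))"
        using gradun[of x n] True vp rr
        by (simp add: Dn_def tn_def b_def scaleR_diff_right divide_simps mult_ac)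
      then show ?thesis by simp
    qed
    also have "\<dots> \<le> ?q' * (B * norm (gn n x) + B * \<bar>un n x\<bar>)"
    proof (intro mult_left_mono order_trans[OF norm_triangle_ineq4] add_mono)
      show "norm ((\<zeta> ?r / v ?r) *\<^sub>R gn n x) \<le> B * norm (gn n x)"
        unfolding norm_scaleR by (intro mult_right_mono order_trans[OF B1[OF rr(1,2)] B(2)]) auto
      show "norm (((\<zeta> ?r * v' ?r / (v ?r * v ?r)) * un n x) *\<^sub>R (x /\<^sub>R ?r)) \<le> B * \<bar>un n x\<bar>"
        unfolding norm_scaleR[of _ "x /\<^sub>R ?r"] unit abs_mult[of _ "un n x"] mult_1_right
        by (intro mult_right_mono order_trans[OF B2[OF rr(1,2)] B(3)]) auto
    qed auto
    finally have 1: "norm ((\<zeta> ?r * Q' (tn n x)) *\<^sub>R Dn n x) \<le> B * (?q' * (norm (gn n x) + \<bar>un n x\<bar>))"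
      by (simp add: algebra_simps)
    have "norm ((Q (tn n x) * \<zeta>' ?r / ?r) *\<^sub>R x) = ?q * \<bar>\<zeta>' ?r\<bar>"
      using rr(3) by (simp add: abs_mult)
    also have "\<dots> \<le> ?q * B"
      using order_trans[OF B3[OF rr(1,2)] B(4)] by (intro mult_left_mono) auto
    finally have 2: "norm (Wn n x) \<le> B * (?q' * (norm (gn n x) + \<bar>un n x\<bar>) + ?q)"
      unfolding Wn_def distrib_left using 1 by (intro order_trans[OF norm_triangle_ineq add_mono])
        (simp_all add: mult.commute distrib_left)
    have "\<bar>P x \<bullet> Wn n x\<bar> \<le> norm (P x) * norm (Wn n x)" by (rule Cauchy_Schwarz_ineq2)
    also have "\<dots> \<le> norm (P x) * (B * (?q' * (norm (gn n x) + \<bar>un n x\<bar>) + ?q))"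
      using 2 by (intro mult_left_mono) auto
    finally have 3: "\<bar>P x \<bullet> Wn n x\<bar> \<le> B * (norm (P x) * (?q' * (norm (gn n x) + \<bar>un n x\<bar>) + ?q))"
      by (simp add: mult_ac)
    have "\<bar>q x * wn n x\<bar> = \<bar>q x\<bar> * (?q * \<bar>\<zeta> ?r\<bar>)" by (simp add: wn_def abs_mult)
    also have "\<dots> \<le> \<bar>q x\<bar> * (?q * B)"
      using order_trans[OF B4[OF rr(1,2)] B(5)] by (intro mult_left_mono) auto
    finally have "\<bar>P x \<bullet> Wn n x + q x * wn n x\<bar>
      \<le> B * (norm (P x) * (?q' * (norm (gn n x) + \<bar>un n x\<bar>) + ?q) + \<bar>q x\<bar> * ?q)"
      using 3 abs_triangle_ineq[of "P x \<bullet> Wn n x" "q x * wn n x"] by (simp add: algebra_simps)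
    \<comment> \<open>The domination hypothesis is stated for arbitrary values \<alpha> and \<beta>
      precisely so that it applies at the mollified values, with their common majorant as d.\<close>
    also have "\<dots> \<le> B * (W0 x + K * D x)"
      using dom(2)[of x "un n x" "D x" "norm (gn n x)"] AE True b B(1)
      by (intro mult_left_mono) (auto simp: tn_def)
    also have "\<dots> \<le> B * (\<bar>W0 x\<bar> + \<bar>K\<bar> * D x)"
    proof -
      have "0 \<le> D x" using AE(1) powr_ge_zero order_trans by blast
      then have "K * D x \<le> \<bar>K\<bar> * D x" by (intro mult_right_mono) auto
      then show ?thesis using B(1) by (intro mult_left_mono) auto
    qed
    finally show ?thesis using True by (simp add: Wb_def wb_def)
  qed
  \<comment> \<open>For a < |x| <= b the approximations are 0 by construction, and so is the limit:
    there u <= c <= v almost everywhere, hence Q and Q' vanish.\<close>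
  have lim: "AE x in lborel. (\<lambda>n. P x \<bullet> Wb n x + q x * wb n x) \<longlonglongrightarrow> ?F x"
    using AE1 near(2)
  proof eventually_elim
    case (elim x)
    let ?r = "norm x" and ?t = "u x / v (norm x)"
    consider "?r \<le> a" | "a < ?r" "?r \<le> b" | "b < ?r" "?r \<le> R" | "b < ?r" "R < ?r" by linarith
    then show ?case
    proof cases
      case 1
      then show ?thesis using b by (simp add: Wb_def wb_def chain_integrand_def)
    next
      case 2
      then have "u x \<le> c" "c \<le> v ?r" using elim near b by auto
      moreover have "0 < v ?r" by (rule v(1)) (use 2 a in linarith)
      ultimately have "?t \<le> 1" by (simp add: divide_le_eq)
      then show ?thesis using 2 Q by (simp add: Wb_def wb_def chain_integrand_def)
    next
      case 4
      then show ?thesis using b \<zeta> by (simp add: Wb_def wb_def Wn_def wn_def chain_integrand_def)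
    next
      case 3
      have "0 < v ?r" by (rule v(1)) (use 3 b in linarith)
      then have vp: "v ?r \<noteq> 0" by simp
      have "(\<lambda>n. un n x) \<longlonglongrightarrow> u x" "(\<lambda>n. gn n x) \<longlonglongrightarrow> g x"
        using elim(1) 3 by (auto simp: uL_def gL_def L_def)
      note l = this
      have t: "(\<lambda>n. tn n x) \<longlonglongrightarrow> ?t"
        unfolding tn_def by (intro tendsto_intros l vp)
      have q: "(\<lambda>n. Q (tn n x)) \<longlonglongrightarrow> Q ?t" "(\<lambda>n. Q' (tn n x)) \<longlonglongrightarrow> Q' ?t"
        using continuous_on_tendsto_compose[OF Qc t] continuous_on_tendsto_compose[OF Q(3) t] by auto
      have gr: "grad (un n) x = gn n x" for n using gradun 3 by (simp add: b_def)
      have d: "(\<lambda>n. Dn n x) \<longlonglongrightarrow> quot_grad v v' x"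
        unfolding Dn_def quot_grad_def gr using 3 b by (intro tendsto_intros l t) auto
      have "(\<lambda>n. P x \<bullet> Wn n x + q x * wn n x) \<longlonglongrightarrow> ?F x"
        unfolding Wn_def wn_def chain_integrand_def using 3 b
        by (simp, intro tendsto_intros d q) auto
      then show ?thesis using 3 by (simp add: Wb_def wb_def)
    qed
  qed
  have meas: "(\<lambda>x. P x \<bullet> Wb n x + q x * wb n x) \<in> borel_measurable lborel" for n
  proof -
    have "Wb n \<in> borel_measurable borel" "wb n \<in> borel_measurable borel"
      using C1_gradD[OF Cb] borel_measurable_continuous_onI by blast+
    then show ?thesis by measurable
  qed
  have measF: "?F \<in> borel_measurable lborel"
    unfolding chain_integrand_def[abs_def] quot_grad_def by measurable
  have domi: "integrable lborel (\<lambda>x. B * (\<bar>W0 x\<bar> + \<bar>K\<bar> * D x))"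
    using dom(1) D by simp
  have AEb: "AE x in lborel. norm (P x \<bullet> Wb n x + q x * wb n x) \<le> B * (\<bar>W0 x\<bar> + \<bar>K\<bar> * D x)" for n
    using AE1 by eventually_elim (use bound in simp)
  show "integrable lborel ?F"
    by (rule integrable_dominated_convergence[OF measF meas domi lim AEb])
  have "(\<lambda>n. \<integral>x. P x \<bullet> Wb n x + q x * wb n x \<partial>lborel) \<longlonglongrightarrow> integral\<^sup>L lborel ?F"
    by (rule integral_dominated_convergence[OF measF meas domi lim AEb])
  then show "integral\<^sup>L lborel ?F \<le> 0"
    by (rule LIMSEQ_le_const2) (use le in auto)
qed

end

section \<open>The p-Laplacian flux and the Picone identity\<close>

definition flux :: "real \<Rightarrow> 'a::euclidean_space \<Rightarrow> 'a" where
  "flux p a = norm a powr (p - 2) *\<^sub>R a"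

lemma powr_minus_one_mult: "0 \<le> t \<Longrightarrow> t powr (q - 1) * t = t powr q" for t q :: real
  using powr_mult_base[of t "q - 1"] by (simp add: mult.commute)

lemma norm_flux: "norm (flux p a) = norm a powr (p - 1)"
  using powr_minus_one_mult[of "norm a" "p - 1"] by (simp add: flux_def diff_diff_eq)

lemma flux_inner_self: "flux p a \<bullet> a = norm a powr p"
proof -
  have "flux p a \<bullet> a = norm a powr (p - 1 - 1) * norm a * norm a"
    by (simp add: flux_def dot_square_norm power2_eq_square diff_diff_eq)
  also have "\<dots> = norm a powr p"
    unfolding powr_minus_one_mult[OF norm_ge_zero] ..
  finally show ?thesis .
qed

lemma flux_scaleR: "0 < t \<Longrightarrow> flux p (t *\<^sub>R a) = t powr (p - 1) *\<^sub>R flux p a"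
  using powr_minus_one_mult[of t "p - 1"]
  by (simp add: flux_def powr_mult diff_diff_eq mult_ac)

lemma flux_inner_le: "flux p a \<bullet> c \<le> norm a powr (p - 1) * norm c"
  using norm_cauchy_schwarz[of "flux p a" c] by (simp add: norm_flux)

text \<open>Expanding the product leaves a one-dimensional monotonicity term in the norms plus two
  Cauchy-Schwarz defects, each nonnegative; p < 2 and p >= 2 are treated alike. Equality forces
  equal norms and then equality in Cauchy-Schwarz.\<close>

lemma flux_monotone:
  assumes "1 < p"
  shows "0 \<le> (flux p a - flux p c) \<bullet> (a - c)"
    and "(flux p a - flux p c) \<bullet> (a - c) = 0 \<Longrightarrow> a = c"
proof -
  let ?A = "norm a" and ?C = "norm c"
  have e: "(flux p a - flux p c) \<bullet> (a - c) = ?A powr p + ?C powr p - flux p a \<bullet> c - flux p c \<bullet> a"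
    by (simp add: inner_diff_left inner_diff_right flux_inner_self)
  have s: "?A powr p + ?C powr p - ?A powr (p - 1) * ?C - ?C powr (p - 1) * ?A
      = (?A powr (p - 1) - ?C powr (p - 1)) * (?A - ?C)"
    using powr_minus_one_mult[of ?A p] powr_minus_one_mult[of ?C p] by (simp add: algebra_simps)
  have nn: "0 \<le> (?A powr (p - 1) - ?C powr (p - 1)) * (?A - ?C)"
  proof (cases "?A \<le> ?C")
    case True
    then have "?A powr (p - 1) \<le> ?C powr (p - 1)" using assms by (intro powr_mono2) auto
    with True show ?thesis by (intro mult_nonpos_nonpos) auto
  next
    case False
    then have "?C powr (p - 1) \<le> ?A powr (p - 1)" using assms by (intro powr_mono2) auto
    with False show ?thesis by (intro mult_nonneg_nonneg) auto
  qed
  show "0 \<le> (flux p a - flux p c) \<bullet> (a - c)"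
    using nn flux_inner_le[of p a c] flux_inner_le[of p c a] e s by linarith
  assume "(flux p a - flux p c) \<bullet> (a - c) = 0"
  then have 1: "(?A powr (p - 1) - ?C powr (p - 1)) * (?A - ?C) = 0"
    and 2: "flux p a \<bullet> c = ?A powr (p - 1) * ?C"
    using nn flux_inner_le[of p a c] flux_inner_le[of p c a] e s by linarith+
  have AC: "?A = ?C"
  proof (rule ccontr)
    assume "?A \<noteq> ?C"
    then have "?A powr (p - 1) = ?C powr (p - 1)" using 1 by simp
    moreover have "?A powr (p - 1) < ?C powr (p - 1)" if "?A < ?C"
      using that assms by (intro powr_less_mono2) auto
    moreover have "?C powr (p - 1) < ?A powr (p - 1)" if "?C < ?A"
      using that assms by (intro powr_less_mono2) auto
    ultimately show False using \<open>?A \<noteq> ?C\<close> by linarith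
  qed
  show "a = c"
  proof (cases "a = 0")
    case True
    with AC show ?thesis by simp
  next
    case False
    have "?A powr (p - 2) * (a \<bullet> c) = ?A powr (p - 2) * (?A * ?A)"
      using 2 AC powr_minus_one_mult[of ?A "p - 1"] by (simp add: flux_def diff_diff_eq flip: mult.assoc)
    then have "a \<bullet> c = ?A * ?A" using False by simp
    moreover have "a \<bullet> a = ?A * ?A" "c \<bullet> c = ?A * ?A"
      using AC by (simp_all add: dot_square_norm power2_eq_square)
    ultimately have "(a - c) \<bullet> (a - c) = 0"
      by (simp add: inner_diff_left inner_diff_right inner_commute)
    then show ?thesis by simp
  qed
qed

text \<open>Convexity of |.|^p at c: the tangent inequality for the norms, and Cauchy-Schwarz for
  the mixed term.\<close>

lemma picone_nonneg:
  assumes "1 < p"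
  shows "0 \<le> norm a powr p - p * (flux p c \<bullet> a) + (p - 1) * norm c powr p"
proof -
  have "norm c powr p + p * norm c powr (p - 1) * (norm a - norm c) \<le> norm a powr p"
    using powr_tangent[OF assms] by simp
  moreover have "p * norm c powr (p - 1) * (norm a - norm c)
      = p * (norm c powr (p - 1) * norm a) - p * norm c powr p"
    using powr_minus_one_mult[of "norm c" p] by (simp add: algebra_simps)
  moreover have "p * (flux p c \<bullet> a) \<le> p * (norm c powr (p - 1) * norm a)"
    using flux_inner_le[of p c a] assms by (intro mult_left_mono) auto
  ultimately show ?thesis unfolding left_diff_distrib[of p 1] by linarith
qed

text \<open>
  \<open>excess t = t H(t)\<close> and \<open>powr_excess p t = t\<^sup>p H(t)\<close> with \<open>H(t) = (1 - 1/t)\<^sup>2\<close> for \<open>t > 1\<close>; the double zero of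
  \<open>H\<close> at \<open>t = 1\<close> makes both functions continuously differentiable.
\<close>

definition excess :: "real \<Rightarrow> real" where "excess t = (max 0 (t - 1))\<^sup>2 / max 1 t"

definition excess' :: "real \<Rightarrow> real" where "excess' t = (if t \<le> 1 then 0 else 1 - 1 / t\<^sup>2)"

definition powr_excess :: "real \<Rightarrow> real \<Rightarrow> real" where "powr_excess p t = max 1 t powr (p - 1) * excess t"

definition powr_excess' :: "real \<Rightarrow> real \<Rightarrow> real" where
  "powr_excess' p t = (p - 1) * max 1 t powr (p - 2) * excess t + max 1 t powr (p - 1) * excess' t"

lemma DERIV_max0_square:
  "((\<lambda>z. (max 0 z)\<^sup>2) has_real_derivative 2 * max 0 z) (at z)" for z :: real
proof -
  consider "z > 0" | "z < 0" | "z = 0" by linarith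
  then show ?thesis
  proof cases
    case 1
    have "((\<lambda>z. z\<^sup>2) has_real_derivative 2 * max 0 z) (at z)"
      using 1 by (auto intro!: derivative_eq_intros)
    then show ?thesis
      by (rule has_field_derivative_transform_within_open[where S = "{0<..}"]) (use 1 in auto)
  next
    case 2
    have "((\<lambda>z. 0) has_real_derivative 2 * max 0 z) (at z)" using 2 by simp
    then show ?thesis
      by (rule has_field_derivative_transform_within_open[where S = "{..<0}"]) (use 2 in auto)
  next
    case 3
    have "((\<lambda>h. (max 0 h)\<^sup>2 / h) \<longlongrightarrow> (0::real)) (at 0)"
    proof (rule Lim_null_comparison)
      show "\<forall>\<^sub>F h in at 0. norm ((max 0 h)\<^sup>2 / h) \<le> \<bar>h\<bar>"
        by (rule always_eventually) (auto simp: max_def power2_eq_square)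
      show "((\<lambda>h. \<bar>h\<bar>) \<longlongrightarrow> (0::real)) (at 0)" by (auto intro!: tendsto_eq_intros)
    qed
    then show ?thesis using 3 by (simp add: DERIV_def)
  qed
qed

lemma excess_eq: "1 \<le> t \<Longrightarrow> excess t = (t - 1)\<^sup>2 / t"
  by (simp add: excess_def max_def)

lemma excess_eq_0: "t \<le> 1 \<Longrightarrow> excess t = 0"
  by (simp add: excess_def)

lemma excess_nonneg: "0 \<le> excess t"
  by (simp add: excess_def)

lemma excess_pos: "1 < t \<Longrightarrow> 0 < excess t"
  by (simp add: excess_eq)

lemma excess_le: "1 \<le> t \<Longrightarrow> excess t \<le> t"
proof -
  assume t: "1 \<le> t"
  then have "(t - 1)\<^sup>2 \<le> t\<^sup>2" by (intro power_mono) auto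
  then show ?thesis using t by (simp add: excess_eq divide_le_eq power2_eq_square)
qed

lemma excess'_eq_0: "t \<le> 1 \<Longrightarrow> excess' t = 0"
  by (simp add: excess'_def)

lemma excess'_bounds: "0 \<le> excess' t" "excess' t \<le> 1"
proof -
  have "1 \<le> t\<^sup>2" if "1 < t" using that by (simp add: one_le_power)
  then show "0 \<le> excess' t" "excess' t \<le> 1" by (auto simp: excess'_def divide_le_eq)
qed

lemma DERIV_glue_at_1:
  fixes F F' :: "real \<Rightarrow> real"
  assumes "\<And>t. 1 < t \<Longrightarrow> (F has_real_derivative F' t) (at t)"
    and "\<And>t. t \<le> 1 \<Longrightarrow> F t = 0" "\<And>t. t \<le> 1 \<Longrightarrow> F' t = 0"
    and "\<And>t. 1 < t \<Longrightarrow> t < 2 \<Longrightarrow> \<bar>F t\<bar> \<le> C * (t - 1)\<^sup>2" "0 \<le> C"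
  shows "(F has_real_derivative F' t) (at t)"
proof -
  consider "t > 1" | "t < 1" | "t = 1" by linarith
  then show ?thesis
  proof cases
    case 1
    then show ?thesis by (rule assms(1))
  next
    case 2
    have "((\<lambda>z. 0) has_real_derivative F' t) (at t)" using 2 assms by simp
    then show ?thesis
      by (rule has_field_derivative_transform_within_open[where S = "{..<1}"]) (use 2 assms in auto)
  next
    case 3
    have "((\<lambda>h. F (1 + h) / h) \<longlongrightarrow> (0::real)) (at 0)"
    proof (rule Lim_null_comparison)
      have "norm (F (1 + h) / h) \<le> C * \<bar>h\<bar>" if "h \<noteq> 0" "dist h 0 < 1" for h
      proof (cases "h > 0")
        case True
        then show ?thesis using assms(4)[of "1 + h"] that
          by (simp add: abs_divide divide_le_eq power2_eq_square mult.assoc)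
      next
        case False
        then have "F (1 + h) = 0" by (intro assms(2)) simp
        moreover have "0 \<le> C * \<bar>h\<bar>" using assms(5) by (rule mult_nonneg_nonneg) simp
        ultimately show ?thesis by simp
      qed
      then show "\<forall>\<^sub>F h in at 0. norm (F (1 + h) / h) \<le> C * \<bar>h\<bar>"
        unfolding eventually_at by (intro exI[of _ 1]) auto
      show "((\<lambda>h. C * \<bar>h\<bar>) \<longlongrightarrow> (0::real)) (at 0)" by (auto intro!: tendsto_eq_intros)
    qed
    then show ?thesis using 3 assms by (simp add: DERIV_def)
  qed
qed

lemma DERIV_excess: "(excess has_real_derivative excess' t) (at t)"
proof (rule DERIV_glue_at_1[where C = 1])
  fix t :: real assume t: "1 < t"
  have "((\<lambda>t. (t - 1)\<^sup>2 / t) has_real_derivative excess' t) (at t)"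
    using t by (auto intro!: derivative_eq_intros simp: excess'_def field_simps power2_eq_square)
  then show "(excess has_real_derivative excess' t) (at t)"
    by (rule has_field_derivative_transform_within_open[where S = "{1<..}"]) (use t in \<open>auto simp: excess_eq\<close>)
  have "(t - 1)\<^sup>2 / t \<le> (t - 1)\<^sup>2 / 1" using t by (intro divide_left_mono) auto
  then show "\<bar>excess t\<bar> \<le> 1 * (t - 1)\<^sup>2" using t by (simp add: excess_eq)
qed (auto simp: excess_eq_0 excess'_eq_0)

lemma continuous_on_excess': "continuous_on UNIV excess'"
proof -
  have eq: "excess' = (\<lambda>t. 1 - 1 / (max 1 t)\<^sup>2)" by (auto simp: excess'_def max_def)
  show ?thesis unfolding eq by (intro continuous_intros) auto
qed

lemma continuous_on_excess: "continuous_on UNIV excess"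
  by (rule DERIV_continuous_on[OF has_field_derivative_at_within[OF DERIV_excess]])

lemma powr_excess_eq_0: "t \<le> 1 \<Longrightarrow> powr_excess p t = 0" "t \<le> 1 \<Longrightarrow> powr_excess' p t = 0"
  by (simp_all add: powr_excess_def powr_excess'_def excess_eq_0 excess'_eq_0)

lemma powr_excess_nonneg: "0 \<le> powr_excess p t"
  by (simp add: powr_excess_def excess_nonneg)

lemma powr_excess_le: "1 \<le> t \<Longrightarrow> powr_excess p t \<le> t powr p"
  using mult_left_mono[OF excess_le, of t "t powr (p - 1)"] powr_minus_one_mult[of t p]
  by (simp add: powr_excess_def max_def)

lemma abs_powr_excess'_le:
  assumes "1 < p" "1 \<le> t"
  shows "\<bar>powr_excess' p t\<bar> \<le> p * t powr (p - 1)"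
proof -
  have "0 \<le> (p - 1) * t powr (p - 2) * excess t" "0 \<le> t powr (p - 1) * excess' t"
    using assms excess_nonneg excess'_bounds by auto
  moreover have "(p - 1) * t powr (p - 2) * excess t \<le> (p - 1) * t powr (p - 2) * t"
    using assms excess_le by (intro mult_left_mono) auto
  moreover have "(p - 1) * t powr (p - 2) * t = (p - 1) * t powr (p - 1)"
    using powr_minus_one_mult[of t "p - 1"] assms by (simp add: diff_diff_eq)
  moreover have "t powr (p - 1) * excess' t \<le> t powr (p - 1) * 1"
    using excess'_bounds by (intro mult_left_mono) auto
  moreover have "powr_excess' p t = (p - 1) * t powr (p - 2) * excess t + t powr (p - 1) * excess' t"
    using assms by (simp add: powr_excess'_def max_def)
  ultimately show ?thesis unfolding left_diff_distrib[of p 1 "t powr (p - 1)"] by linarith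
qed

lemma continuous_on_powr_excess': "continuous_on UNIV (powr_excess' p)"
  unfolding powr_excess'_def[abs_def]
  by (intro continuous_intros continuous_on_compose2[OF continuous_on_excess]
      continuous_on_compose2[OF continuous_on_excess']) auto

lemma DERIV_powr_excess:
  assumes "1 < p" shows "(powr_excess p has_real_derivative powr_excess' p t) (at t)"
proof (rule DERIV_glue_at_1[where C = "2 powr (p - 1)"])
  fix t :: real assume t: "1 < t"
  have "((\<lambda>t. t powr (p - 1) * excess t) has_real_derivative powr_excess' p t) (at t)"
    using t by (auto intro!: derivative_eq_intros DERIV_excess simp: powr_excess'_def max_def diff_diff_eq)
  then show "(powr_excess p has_real_derivative powr_excess' p t) (at t)"
    by (rule has_field_derivative_transform_within_open[where S = "{1<..}"])
      (use t in \<open>auto simp: powr_excess_def max_def\<close>)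
  assume t2: "t < 2"
  have "(t - 1)\<^sup>2 / t \<le> (t - 1)\<^sup>2 / 1" using t by (intro divide_left_mono) auto
  then have "excess t \<le> (t - 1)\<^sup>2" using t by (simp add: excess_eq)
  moreover have "t powr (p - 1) \<le> 2 powr (p - 1)" using t t2 assms by (intro powr_mono2) auto
  ultimately have "t powr (p - 1) * excess t \<le> 2 powr (p - 1) * (t - 1)\<^sup>2"
    using excess_nonneg by (intro mult_mono) auto
  then show "\<bar>powr_excess p t\<bar> \<le> 2 powr (p - 1) * (t - 1)\<^sup>2"
    using t excess_nonneg[of t] by (simp add: powr_excess_def max_def abs_mult)
qed (auto simp: powr_excess_eq_0)

text \<open>Here a and b stand for the gradients of u and v, each divided by v. With c = t b, t Z
  equals (t excess' - excess) M + excess S, where M is the monotonicity expression and S the Picone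
  expression of a and c. The coefficient of M is 2 (t - 1) / t, strictly positive for t > 1, so Z =
  0 forces M = 0 and a = c.\<close>

lemma picone_bracket:
  fixes a b :: "'a::euclidean_space"
  assumes p: "1 < p" and t: "1 < t"
  defines "Z \<equiv> excess' t * (flux p a \<bullet> (a - t *\<^sub>R b)) + excess t * (flux p a \<bullet> b)
    - powr_excess' p t * (flux p b \<bullet> (a - t *\<^sub>R b)) - powr_excess p t * (flux p b \<bullet> b)"
  shows "0 \<le> Z" and "Z = 0 \<Longrightarrow> a = t *\<^sub>R b"
proof -
  define c where "c = t *\<^sub>R b"
  define M where "M = (flux p a - flux p c) \<bullet> (a - c)"
  define S where "S = norm a powr p - p * (flux p c \<bullet> a) + (p - 1) * norm c powr p"
  have c: "flux p c = t powr (p - 1) *\<^sub>R flux p b" using t by (simp add: c_def flux_scaleR)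
  have tp: "t powr (p - 1) = t powr (p - 2) * t"
    using powr_minus_one_mult[of t "p - 1"] t by (simp add: diff_diff_eq)
  have np: "norm c powr p = t powr (p - 1) * t * norm b powr p"
  proof -
    have "norm c = t * norm b" using t by (simp add: c_def)
    then have "norm c powr p = t powr p * norm b powr p" using t by (simp only: powr_mult)
    then show ?thesis using powr_minus_one_mult[of t p] t by (simp only: zero_le_one less_imp_le)
  qed
  have M': "M = norm a powr p + norm c powr p - t * (flux p a \<bullet> b) - t powr (p - 1) * (flux p b \<bullet> a)"
  proof -
    have "flux p a \<bullet> c = t * (flux p a \<bullet> b)" by (simp add: c_def)
    moreover have "flux p c \<bullet> a = t powr (p - 1) * (flux p b \<bullet> a)" by (simp add: c)
    ultimately show ?thesis
      by (simp add: M_def inner_diff_left inner_diff_right flux_inner_self)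
  qed
  have S': "S = norm a powr p - p * t powr (p - 1) * (flux p b \<bullet> a) + (p - 1) * norm c powr p"
    unfolding S_def c by simp
  define X Y A B where "X = flux p a \<bullet> b" "Y = flux p b \<bullet> a" "A = norm a powr p" "B = norm b powr p"
  define T where "T = t powr (p - 2)"
  have ZZ: "Z = excess' t * (A - t * X) + excess t * X - ((p - 1) * T * excess t + T * t * excess' t) * (Y - t * B) - T * t * excess t * B"
    using t unfolding Z_def powr_excess_def powr_excess'_def
    by (simp add: inner_diff_right flux_inner_self X_Y_A_B_def T_def tp max_def)
  have MM: "M = A + T * t * t * B - t * X - T * t * Y"
    and SS: "S = A - p * T * t * Y + (p - 1) * (T * t * t * B)"
    unfolding M' S' np by (simp_all add: X_Y_A_B_def T_def tp mult_ac)
  have "t * Z = (t * excess' t - excess t) * M + excess t * S"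
    unfolding ZZ MM SS by (simp add: algebra_simps)
  moreover have tG: "t * excess' t - excess t = 2 * (t - 1) / t"
    using t by (simp add: excess'_def excess_eq field_simps power2_eq_square)
  ultimately have Z: "t * Z = 2 * (t - 1) / t * M + excess t * S" by simp
  have M0: "0 \<le> M" unfolding M_def by (rule flux_monotone(1)[OF p])
  have S0: "0 \<le> S" unfolding S_def by (rule picone_nonneg[OF p])
  have s1: "0 \<le> 2 * (t - 1) / t * M" and s2: "0 \<le> excess t * S"
    using M0 S0 t excess_nonneg by auto
  have "0 \<le> t * Z" unfolding Z using s1 s2 by linarith
  then show "0 \<le> Z" using t by (simp add: zero_le_mult_iff)
  assume "Z = 0"
  then have "t * Z = 0" by simp
  then have "2 * (t - 1) / t * M = 0" using Z s1 s2 by linarith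
  then have "M = 0" using t by simp
  then show "a = t *\<^sub>R b" unfolding M_def using flux_monotone(2)[OF p] c_def by blast
qed

text \<open>For R > 0 it equals 1 up to R and 0 from 2 R on. The inner square smooths the junction
  at R, the outer one the junction at 2 R, which gives a continuous derivative.\<close>

definition cutoff :: "real \<Rightarrow> real \<Rightarrow> real" where
  "cutoff R r = (max 0 (1 - (max 0 (r / R - 1))\<^sup>2))\<^sup>2"

definition cutoff' :: "real \<Rightarrow> real \<Rightarrow> real" where
  "cutoff' R r = 2 * max 0 (1 - (max 0 (r / R - 1))\<^sup>2) * (- (2 * max 0 (r / R - 1) * (1 / R)))"

lemma DERIV_cutoff: "(cutoff R has_real_derivative cutoff' R r) (at r)"
proof -
  have 1: "((\<lambda>r. (max 0 (r / R - 1))\<^sup>2) has_real_derivative 2 * max 0 (r / R - 1) * (1 / R)) (at r)"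
    using DERIV_chain2[OF DERIV_max0_square DERIV_diff[OF DERIV_cdivide[OF DERIV_ident, of R] DERIV_const[of 1]]]
    by simp
  have 2: "((\<lambda>r. 1 - (max 0 (r / R - 1))\<^sup>2) has_real_derivative - (2 * max 0 (r / R - 1) * (1 / R))) (at r)"
    using DERIV_diff[OF DERIV_const[of 1] 1] by simp
  show ?thesis
    unfolding cutoff_def[abs_def] cutoff'_def by (rule DERIV_chain2[OF DERIV_max0_square 2])
qed

lemma continuous_on_cutoff': "continuous_on S (cutoff' R)"
proof (cases "R = 0")
  case False
  show ?thesis unfolding cutoff'_def[abs_def] by (intro continuous_intros ballI False)
qed (simp add: cutoff'_def[abs_def])

lemma cutoff_bounds: "0 \<le> cutoff R r" "cutoff R r \<le> 1"
  by (auto simp: cutoff_def max_def intro: power_le_one)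

lemma cutoff_eq_1: "0 < R \<Longrightarrow> r \<le> R \<Longrightarrow> cutoff R r = 1"
  by (simp add: cutoff_def max_def)

lemma cutoff_eq_0:
  assumes "0 < R" "2 * R \<le> r" shows "cutoff R r = 0" "cutoff' R r = 0"
proof -
  have "1 \<le> r / R - 1" using assms by (simp add: le_divide_eq)
  then have "1 \<le> (max 0 (r / R - 1))\<^sup>2" by (simp add: one_le_power)
  then show "cutoff R r = 0" "cutoff' R r = 0" by (simp_all add: cutoff_def cutoff'_def)
qed

lemma cutoff'_eq_0: "0 < R \<Longrightarrow> r \<le> R \<Longrightarrow> cutoff' R r = 0"
  by (simp add: cutoff'_def max_def)

lemma abs_cutoff'_le:
  assumes "0 < R" shows "\<bar>cutoff' R r\<bar> \<le> 4 / R"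
proof (cases "2 * R \<le> r")
  case False
  then have "max 0 (r / R - 1) \<le> 1" using assms by (simp add: divide_le_eq)
  moreover have "max 0 (1 - (max 0 (r / R - 1))\<^sup>2) \<le> 1" by simp
  ultimately have "max 0 (1 - (max 0 (r / R - 1))\<^sup>2) * max 0 (r / R - 1) \<le> 1 * 1"
    by (intro mult_mono) auto
  then have "4 / R * (max 0 (1 - (max 0 (r / R - 1))\<^sup>2) * max 0 (r / R - 1)) \<le> 4 / R * 1"
    using assms by (intro mult_left_mono) auto
  moreover have "\<bar>cutoff' R r\<bar> = 4 / R * (max 0 (1 - (max 0 (r / R - 1))\<^sup>2) * max 0 (r / R - 1))"
    using assms by (simp add: cutoff'_def abs_mult)
  ultimately show ?thesis by simp
qed (use assms cutoff_eq_0 in simp)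

section \<open>A radial supersolution\<close>

text \<open>Integrating -r v'/v = \<gamma> - k r^(-\<beta>) yields this formula. For positive k and
  \<beta> the exponential factor lies between 0 and 1 and tends to 1 at infinity, so the decay rate
  is that of r^(-\<gamma>).\<close>

definition barrier :: "real \<Rightarrow> real \<Rightarrow> real \<Rightarrow> real \<Rightarrow> real" where
  "barrier \<gamma> k \<beta> r = r powr (- \<gamma>) * exp (- (k / \<beta>) * r powr (- \<beta>))"

text \<open>The logarithmic slope \<open>- r v'(r) / v(r)\<close> of the barrier \<open>v\<close>.\<close>

definition slope :: "real \<Rightarrow> real \<Rightarrow> real \<Rightarrow> real \<Rightarrow> real" where
  "slope \<gamma> k \<beta> r = \<gamma> - k * r powr (- \<beta>)"

definition barrier' :: "real \<Rightarrow> real \<Rightarrow> real \<Rightarrow> real \<Rightarrow> real" where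
  "barrier' \<gamma> k \<beta> r = - (slope \<gamma> k \<beta> r * barrier \<gamma> k \<beta> r / r)"

text \<open>\<open>- |\<nabla>v|\<^sup>p\<^sup>-\<^sup>2\<nabla>v = barrier_flux (|x|) x\<close> for the radial function \<open>v\<close>.\<close>

definition barrier_flux :: "real \<Rightarrow> real \<Rightarrow> real \<Rightarrow> real \<Rightarrow> real \<Rightarrow> real" where
  "barrier_flux p \<gamma> k \<beta> r = (slope \<gamma> k \<beta> r * barrier \<gamma> k \<beta> r) powr (p - 1) * r powr (- p)"

text \<open>The logarithmic derivative of \<open>barrier_flux\<close> is (p - 1) (y'/y + v'/v) -
  p/r, where the slope y satisfies r y' = k \<beta> r^(-\<beta>) and r v'/v = -y.\<close>

definition barrier_flux' :: "real \<Rightarrow> real \<Rightarrow> real \<Rightarrow> real \<Rightarrow> real \<Rightarrow> real" where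
  "barrier_flux' p \<gamma> k \<beta> r = barrier_flux p \<gamma> k \<beta> r *
    ((p - 1) * (k * \<beta> * r powr (- \<beta>) / slope \<gamma> k \<beta> r - slope \<gamma> k \<beta> r) - p) / r"

lemma barrier_pos: "0 < r \<Longrightarrow> 0 < barrier \<gamma> k \<beta> r"
  by (simp add: barrier_def)

lemma powr_minus_Suc: "0 < r \<Longrightarrow> r powr (- \<beta> - 1) = r powr (- \<beta>) / r" for r :: real
  by (simp add: powr_diff)

lemma DERIV_slope:
  assumes "0 < r"
  shows "(slope \<gamma> k \<beta> has_real_derivative k * \<beta> * r powr (- \<beta>) / r) (at r)"
proof -
  have "(slope \<gamma> k \<beta> has_real_derivative - (k * (- \<beta> * r powr (- \<beta> - 1)))) (at r)"
    unfolding slope_def[abs_def] using assms by (auto intro!: derivative_eq_intros)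
  then show ?thesis using assms by (simp add: powr_minus_Suc mult.assoc)
qed

lemma DERIV_barrier:
  assumes "0 < r" "\<beta> \<noteq> 0"
  shows "(barrier \<gamma> k \<beta> has_real_derivative barrier' \<gamma> k \<beta> r) (at r)"
proof -
  let ?e = "\<lambda>r. exp (- (k / \<beta>) * r powr (- \<beta>))"
  have "(?e has_real_derivative ?e r * (- (k / \<beta>) * (- \<beta> * r powr (- \<beta> - 1)))) (at r)"
    using assms by (auto intro!: derivative_eq_intros)
  moreover have "((\<lambda>r. r powr (- \<gamma>)) has_real_derivative - \<gamma> * r powr (- \<gamma> - 1)) (at r)"
    using assms by (auto intro!: derivative_eq_intros)
  ultimately have "((\<lambda>r. r powr (- \<gamma>) * ?e r) has_real_derivative
      - \<gamma> * r powr (- \<gamma> - 1) * ?e r + ?e r * (- (k / \<beta>) * (- \<beta> * r powr (- \<beta> - 1))) * r powr (- \<gamma>)) (at r)"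
    by (rule DERIV_mult[rotated])
  then show ?thesis
    unfolding barrier_def[abs_def] barrier'_def slope_def
    by (rule DERIV_cong) (use assms in \<open>simp add: powr_minus_Suc field_simps\<close>)
qed

lemma DERIV_barrier_flux:
  assumes "0 < r" "\<beta> \<noteq> 0" "0 < slope \<gamma> k \<beta> r"
  shows "(barrier_flux p \<gamma> k \<beta> has_real_derivative barrier_flux' p \<gamma> k \<beta> r) (at r)"
proof -
  let ?y = "slope \<gamma> k \<beta> r" and ?v = "barrier \<gamma> k \<beta> r"
  have yv: "0 < ?y * ?v" using assms barrier_pos by simp
  have d1: "((\<lambda>r. slope \<gamma> k \<beta> r * barrier \<gamma> k \<beta> r) has_real_derivative
      k * \<beta> * r powr (- \<beta>) / r * ?v + barrier' \<gamma> k \<beta> r * ?y) (at r)"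
    by (rule DERIV_mult[OF DERIV_slope[OF assms(1)] DERIV_barrier[OF assms(1,2)]])
  have d2: "((\<lambda>r. (slope \<gamma> k \<beta> r * barrier \<gamma> k \<beta> r) powr (p - 1)) has_real_derivative
      (p - 1) * (?y * ?v) powr (p - 1 - 1) * (k * \<beta> * r powr (- \<beta>) / r * ?v + barrier' \<gamma> k \<beta> r * ?y)) (at r)"
    using DERIV_fun_powr[OF d1 yv, of "p - 1"] by simp
  have d3: "((\<lambda>r. r powr (- p)) has_real_derivative - p * r powr (- p - 1)) (at r)"
    using assms by (auto intro!: derivative_eq_intros)
  have e: "(?y * ?v) powr (p - 1 - 1) = (?y * ?v) powr (p - 1) / (?y * ?v)"
    using powr_diff[of "?y * ?v" "p - 1" 1] yv by simp
  show ?thesis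
    unfolding barrier_flux_def[abs_def]
  proof (rule DERIV_cong[OF DERIV_mult[OF d2 d3]])
    \<comment> \<open>Stated for free variables, so that the powers are opaque and a purely rational
      identity remains.\<close>
    have field: "(p - 1) * (S / (y * v)) * (K / r * v + - (y * v / r) * y) * T + - p * (T / r) * S
        = S * T * ((p - 1) * (K / y - y) - p) / r" if "y \<noteq> 0" "v \<noteq> 0" for y v S T K :: real
      using that assms(1) by (simp add: field_simps)
    show "(p - 1) * (?y * ?v) powr (p - 1 - 1) * (k * \<beta> * r powr (- \<beta>) / r * ?v + barrier' \<gamma> k \<beta> r * ?y)
        * r powr (- p) + - p * r powr (- p - 1) * (?y * ?v) powr (p - 1) = barrier_flux' p \<gamma> k \<beta> r"
      unfolding e powr_minus_Suc[OF assms(1)] barrier_flux'_def barrier_flux_def barrier'_def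
      by (rule field) (use yv in auto)
  qed
qed

lemma continuous_on_slope: "a > 0 \<Longrightarrow> continuous_on {a..} (slope \<gamma> k \<beta>)"
  unfolding slope_def[abs_def] by (intro continuous_intros) auto

lemma continuous_on_barrier: "a > 0 \<Longrightarrow> continuous_on {a..} (barrier \<gamma> k \<beta>)"
  unfolding barrier_def[abs_def] by (intro continuous_intros) auto

lemma continuous_on_barrier': "a > 0 \<Longrightarrow> continuous_on {a..} (barrier' \<gamma> k \<beta>)"
  unfolding barrier'_def[abs_def]
  by (intro continuous_intros continuous_on_slope continuous_on_barrier) auto

lemma continuous_on_barrier_flux:
  assumes "a > 0" "\<And>r. a \<le> r \<Longrightarrow> 0 < slope \<gamma> k \<beta> r"
  shows "continuous_on {a..} (barrier_flux p \<gamma> k \<beta>)"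
proof -
  have "0 < slope \<gamma> k \<beta> r * barrier \<gamma> k \<beta> r" if "a \<le> r" for r
    using assms that by (intro mult_pos_pos barrier_pos) auto
  then have "\<forall>r\<in>{a..}. slope \<gamma> k \<beta> r * barrier \<gamma> k \<beta> r \<noteq> 0" by fastforce
  moreover have "\<forall>r\<in>{a..}. r \<noteq> 0" using assms by auto
  ultimately show ?thesis
    unfolding barrier_flux_def[abs_def] using assms
    by (intro continuous_on_mult continuous_on_powr continuous_on_const continuous_on_id
        continuous_on_slope continuous_on_barrier) auto
qed

lemma continuous_on_barrier_flux':
  assumes "a > 0" "\<And>r. a \<le> r \<Longrightarrow> 0 < slope \<gamma> k \<beta> r"
  shows "continuous_on {a..} (barrier_flux' p \<gamma> k \<beta>)"
proof -
  have "\<forall>r\<in>{a..}. slope \<gamma> k \<beta> r \<noteq> 0" using assms(2) by (metis atLeast_iff less_irrefl)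
  moreover have "\<forall>r\<in>{a..}. r \<noteq> 0" using assms by auto
  ultimately show ?thesis
    unfolding barrier_flux'_def[abs_def] using assms
    by (intro continuous_on_divide continuous_on_mult continuous_on_diff continuous_on_const continuous_on_id
        continuous_on_slope continuous_on_barrier_flux continuous_on_powr) auto
qed

lemma borel_measurable_barrier [measurable]:
  "barrier \<gamma> k \<beta> \<in> borel_measurable borel" "barrier' \<gamma> k \<beta> \<in> borel_measurable borel"
  "slope \<gamma> k \<beta> \<in> borel_measurable borel" "barrier_flux p \<gamma> k \<beta> \<in> borel_measurable borel"
  "barrier_flux' p \<gamma> k \<beta> \<in> borel_measurable borel"
  unfolding barrier_def[abs_def] barrier'_def[abs_def] slope_def[abs_def] barrier_flux_def[abs_def]
    barrier_flux'_def[abs_def] by measurable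

text \<open>The left side is the divergence of h(|x|) x for the flux coefficient h. Apart from the
  last summand, which stems from the derivative of the slope, the factor on the right is minus the
  characteristic function at the slope, without its constant \<mu>.\<close>

lemma div_barrier_flux:
  assumes "0 < r" "0 < slope \<gamma> k \<beta> r"
  shows "r * barrier_flux' p \<gamma> k \<beta> r + N * barrier_flux p \<gamma> k \<beta> r
    = barrier \<gamma> k \<beta> r powr (p - 1) * r powr (- p) * (slope \<gamma> k \<beta> r powr (p - 2)
        * ((N - p) * slope \<gamma> k \<beta> r - (p - 1) * (slope \<gamma> k \<beta> r)\<^sup>2 + (p - 1) * k * \<beta> * r powr (- \<beta>)))"
proof -
  let ?y = "slope \<gamma> k \<beta> r" and ?v = "barrier \<gamma> k \<beta> r"
  have "?y powr (p - 1) = ?y powr (p - 2) * ?y"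
    using powr_minus_one_mult[of ?y "p - 1"] assms by (simp add: diff_diff_eq)
  then have h: "barrier_flux p \<gamma> k \<beta> r = ?v powr (p - 1) * r powr (- p) * (?y powr (p - 2) * ?y)"
    using assms barrier_pos[OF assms(1), of \<gamma> k \<beta>] by (simp add: barrier_flux_def powr_mult)
  have main: "r * barrier_flux' p \<gamma> k \<beta> r + N * barrier_flux p \<gamma> k \<beta> r
    = barrier_flux p \<gamma> k \<beta> r * (N - p + (p - 1) * (k * \<beta> * r powr (- \<beta>) / ?y - ?y))"
  proof -
    have "r * barrier_flux' p \<gamma> k \<beta> r = barrier_flux p \<gamma> k \<beta> r
        * ((p - 1) * (k * \<beta> * r powr (- \<beta>) / ?y - ?y) - p)"
      using assms(1) by (simp add: barrier_flux'_def)
    then show ?thesis by (simp add: algebra_simps)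
  qed
  show ?thesis
    unfolding main unfolding h using assms by (simp add: field_simps power2_eq_square)
qed

text \<open>For positive \<gamma> the derivative of K has the sign of p \<gamma> - c: K falls, then
  rises, and is at most 0 between two zeros. Written with the exponent p - 1, the function is
  visibly continuous at 0 also for p < 2, which admits the root 0.\<close>

lemma characteristic_nonneg_between:
  fixes p c \<mu> y y1 y2 :: real
  defines "K \<equiv> \<lambda>\<gamma>. \<gamma> powr (p - 2) * ((p - 1) * \<gamma>\<^sup>2 - c * \<gamma>) + \<mu>"
  assumes p: "1 < p" and y: "0 \<le> y1" "y1 \<le> y" "y \<le> y2" "0 < y" and K: "K y1 = 0" "K y2 = 0"
  shows "K y \<le> 0"
proof -
  define k where "k \<gamma> = \<gamma> powr (p - 1) * ((p - 1) * \<gamma> - c) + \<mu>" for \<gamma>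
  have kK: "K \<gamma> = k \<gamma>" if "0 \<le> \<gamma>" for \<gamma>
  proof -
    have "\<gamma> powr (p - 1) = \<gamma> powr (p - 2) * \<gamma>"
      using powr_minus_one_mult[of \<gamma> "p - 1"] that by (simp add: diff_diff_eq)
    then show ?thesis by (simp add: K_def k_def power2_eq_square algebra_simps)
  qed
  have kc: "continuous_on {0..} k"
    unfolding k_def[abs_def] using p by (intro continuous_intros continuous_on_powr') auto
  have kd: "(k has_real_derivative (p - 1) * \<gamma> powr (p - 2) * (p * \<gamma> - c)) (at \<gamma>)" if "0 < \<gamma>" for \<gamma>
  proof -
    have "((\<lambda>\<gamma>. \<gamma> powr (p - 1)) has_real_derivative (p - 1) * \<gamma> powr (p - 2)) (at \<gamma>)"
      using that by (auto intro!: derivative_eq_intros simp: diff_diff_eq)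
    moreover have "((\<lambda>\<gamma>. (p - 1) * \<gamma> - c) has_real_derivative (p - 1)) (at \<gamma>)"
      by (auto intro!: derivative_eq_intros)
    ultimately have "((\<lambda>\<gamma>. \<gamma> powr (p - 1) * ((p - 1) * \<gamma> - c)) has_real_derivative
        (p - 1) * \<gamma> powr (p - 2) * ((p - 1) * \<gamma> - c) + (p - 1) * \<gamma> powr (p - 1)) (at \<gamma>)"
      by (rule DERIV_mult)
    from DERIV_add[OF this DERIV_const[of \<mu>]] show ?thesis
      unfolding k_def[abs_def]
      by (rule DERIV_cong)
        (use that powr_minus_one_mult[of \<gamma> "p - 1"] in \<open>simp add: diff_diff_eq algebra_simps\<close>)
  qed
  show ?thesis
  proof (cases "p * y \<le> c")
    case True
    have "k y \<le> k y1"
    proof (rule DERIV_nonpos_imp_decreasing_open[OF y(2)])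
      fix x assume x: "y1 < x" "x < y"
      have "p * x - c \<le> 0" using mult_left_mono[of x y p] x p True by linarith
      then have "(p - 1) * x powr (p - 2) * (p * x - c) \<le> 0"
        using p by (intro mult_nonneg_nonpos) auto
      with kd[of x] x y show "\<exists>z. (k has_real_derivative z) (at x) \<and> z \<le> 0" by auto
    qed (use kc y in \<open>auto intro: continuous_on_subset\<close>)
    then show ?thesis using K kK y by simp
  next
    case False
    have "k y \<le> k y2"
    proof (rule DERIV_nonneg_imp_increasing_open[OF y(3)])
      fix x assume x: "y < x" "x < y2"
      have "0 \<le> p * x - c" using mult_left_mono[of y x p] x p False by linarith
      then have "(p - 1) * x powr (p - 2) * (p * x - c) \<ge> 0"
        using p by (intro mult_nonneg_nonneg) auto
      with kd[of x] x y show "\<exists>z. (k has_real_derivative z) (at x) \<and> z \<ge> 0" by auto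
    qed (use kc y in \<open>auto intro: continuous_on_subset\<close>)
    then show ?thesis using K kK y by simp
  qed
qed

text \<open>
  As \<open>r\<close> grows, the slope increases to the larger root through values at which the characteristic
  function is nonpositive; the term with its derivative absorbs \<open>A |x|\<^sup>-\<^sup>\<alpha>\<close>.
\<close>

lemma barrier_supersolution:
  fixes p \<mu> A \<alpha> \<gamma>\<^sub>1 \<gamma>\<^sub>2 N :: real
  assumes p: "1 < p" and A: "0 < A" and \<alpha>: "p < \<alpha>" and \<gamma>: "0 \<le> \<gamma>\<^sub>1" "\<gamma>\<^sub>1 < \<gamma>\<^sub>2"
    and r1: "\<gamma>\<^sub>1 powr (p - 2) * ((p - 1) * \<gamma>\<^sub>1\<^sup>2 - (N - p) * \<gamma>\<^sub>1) + \<mu> = 0"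
    and r2: "\<gamma>\<^sub>2 powr (p - 2) * ((p - 1) * \<gamma>\<^sub>2\<^sup>2 - (N - p) * \<gamma>\<^sub>2) + \<mu> = 0"
  obtains k R\<^sub>0 where "0 < k" "1 < R\<^sub>0"
    "\<And>r. R\<^sub>0 \<le> r \<Longrightarrow> 0 < slope \<gamma>\<^sub>2 k (\<alpha> - p) r"
    "\<And>r. R\<^sub>0 \<le> r \<Longrightarrow> slope \<gamma>\<^sub>2 k (\<alpha> - p) r \<le> \<gamma>\<^sub>2"
    "\<And>r. R\<^sub>0 \<le> r \<Longrightarrow> barrier \<gamma>\<^sub>2 k (\<alpha> - p) r powr (p - 1) * (\<mu> * r powr (- p) + A * r powr (- \<alpha>))
      \<le> r * barrier_flux' p \<gamma>\<^sub>2 k (\<alpha> - p) r + N * barrier_flux p \<gamma>\<^sub>2 k (\<alpha> - p) r"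
proof -
  define \<beta> where "\<beta> = \<alpha> - p"
  have \<beta>: "0 < \<beta>" using \<alpha> by (simp add: \<beta>_def)
  \<comment> \<open>A floor for the slope: at least \<open>\<gamma>\<^sub>1\<close>, so that the
    slope stays between the roots, and away from 0 even when \<open>\<gamma>\<^sub>1\<close> is
    0.\<close>
  define y1 where "y1 = max \<gamma>\<^sub>1 (\<gamma>\<^sub>2 / 2)"
  have y1: "0 < y1" "\<gamma>\<^sub>1 \<le> y1" "y1 < \<gamma>\<^sub>2" using \<gamma> by (auto simp: y1_def)
  \<comment> \<open>A lower bound for y^(p-2) between \<open>y1\<close> and
    \<open>\<gamma>\<^sub>2\<close>: the power is monotone, so its minimum sits at one endpoint,
    which one depending on the sign of p - 2.\<close>
  define c where "c = min (\<gamma>\<^sub>2 powr (p - 2)) (y1 powr (p - 2))"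
  have c: "0 < c" using y1 by (simp add: c_def)
  \<comment> \<open>Solves c (p - 1) k \<beta> = A, so that the derivative of the slope pays for the
    bound on f.\<close>
  define k where "k = A / ((p - 1) * \<beta> * c)"
  have k: "0 < k" using A p \<beta> c by (simp add: k_def)
  \<comment> \<open>Beyond R the correction k r^(-\<beta>) is at most
    \<open>\<gamma>\<^sub>2 - y1\<close>.\<close>
  define R where "R = max 2 ((k / (\<gamma>\<^sub>2 - y1)) powr (1 / \<beta>))"
  have R: "1 < R" by (simp add: R_def)
  have y: "y1 \<le> slope \<gamma>\<^sub>2 k \<beta> r" "slope \<gamma>\<^sub>2 k \<beta> r \<le> \<gamma>\<^sub>2" if "R \<le> r" for r
  proof -
    have "((k / (\<gamma>\<^sub>2 - y1)) powr (1 / \<beta>)) powr \<beta> \<le> r powr \<beta>"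
      using that \<beta> by (intro powr_mono2) (auto simp: R_def)
    then have "k / (\<gamma>\<^sub>2 - y1) \<le> r powr \<beta>"
      using \<beta> k y1 by (simp add: powr_powr)
    then have "k * r powr (- \<beta>) \<le> \<gamma>\<^sub>2 - y1"
      using y1 that R by (simp add: powr_minus field_simps)
    then show "y1 \<le> slope \<gamma>\<^sub>2 k \<beta> r" by (simp add: slope_def)
    show "slope \<gamma>\<^sub>2 k \<beta> r \<le> \<gamma>\<^sub>2" using k by (simp add: slope_def)
  qed
  show thesis
  proof (rule that[OF k R], unfold \<beta>_def[symmetric])
    fix r assume r: "R \<le> r"
    let ?y = "slope \<gamma>\<^sub>2 k \<beta> r" and ?v = "barrier \<gamma>\<^sub>2 k \<beta> r"
    show y0: "0 < ?y" and "?y \<le> \<gamma>\<^sub>2" using y[OF r] y1 by auto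
    have r0: "0 < r" using r R by simp
    have "?y powr (p - 2) * ((p - 1) * ?y\<^sup>2 - (N - p) * ?y) + \<mu> \<le> 0"
      using characteristic_nonneg_between[OF p \<gamma>(1) _ y(2)[OF r] y0 r1 r2] y[OF r] y1 by simp
    moreover have "A * r powr (- \<beta>) \<le> ?y powr (p - 2) * ((p - 1) * k * \<beta> * r powr (- \<beta>))"
    proof -
      have "c \<le> ?y powr (p - 2)"
      proof (cases "2 \<le> p")
        case True
        then have "y1 powr (p - 2) \<le> ?y powr (p - 2)" using y[OF r] y1 by (intro powr_mono2) auto
        then show ?thesis by (simp add: c_def)
      next
        case False
        then have "\<gamma>\<^sub>2 powr (p - 2) \<le> ?y powr (p - 2)" using y[OF r] y0 by (intro powr_mono2') auto
        then show ?thesis by (simp add: c_def)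
      qed
      then have "c * ((p - 1) * k * \<beta> * r powr (- \<beta>)) \<le> ?y powr (p - 2) * ((p - 1) * k * \<beta> * r powr (- \<beta>))"
        using p k \<beta> by (intro mult_right_mono) auto
      moreover have "c * ((p - 1) * k * \<beta> * r powr (- \<beta>)) = A * r powr (- \<beta>)"
        using p \<beta> c by (simp add: k_def field_simps)
      ultimately show ?thesis by simp
    qed
    ultimately have br: "\<mu> + A * r powr (- \<beta>) \<le> ?y powr (p - 2)
        * ((N - p) * ?y - (p - 1) * ?y\<^sup>2 + (p - 1) * k * \<beta> * r powr (- \<beta>))"
      by (simp add: algebra_simps)
    have "?v powr (p - 1) * (\<mu> * r powr (- p) + A * r powr (- \<alpha>))
        = ?v powr (p - 1) * r powr (- p) * (\<mu> + A * r powr (- \<beta>))"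
      using r0 by (simp add: \<beta>_def algebra_simps flip: powr_add)
    also have "\<dots> \<le> r * barrier_flux' p \<gamma>\<^sub>2 k \<beta> r + N * barrier_flux p \<gamma>\<^sub>2 k \<beta> r"
      unfolding div_barrier_flux[OF r0 y0] using br by (intro mult_left_mono) auto
    finally show "?v powr (p - 1) * (\<mu> * r powr (- p) + A * r powr (- \<alpha>))
      \<le> r * barrier_flux' p \<gamma>\<^sub>2 k \<beta> r + N * barrier_flux p \<gamma>\<^sub>2 k \<beta> r" .
  qed
qed

section \<open>The comparison principle\<close>

text \<open>Young's inequality with constant 1, by replacing both factors with their
  maximum.\<close>

lemma powr_mult_le_sum:
  fixes X Y p :: real
  assumes "1 < p" "0 \<le> X" "0 \<le> Y"
  shows "X powr (p - 1) * Y \<le> X powr p + Y powr p"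
proof -
  have "X powr (p - 1) * Y \<le> max X Y powr (p - 1) * max X Y"
    using assms by (intro mult_mono powr_mono2) auto
  also have "\<dots> = max X Y powr p" using assms by (intro powr_minus_one_mult) auto
  also have "\<dots> \<le> X powr p + Y powr p" by (simp add: max_def)
  finally show ?thesis .
qed

lemma powr_le_one_add:
  fixes X p s :: real
  assumes "0 \<le> X" "0 \<le> p" "p \<le> s"
  shows "X powr p \<le> 1 + X powr s"
proof (cases "X \<le> 1")
  case True
  then have "X powr p \<le> 1" using assms by (simp add: powr_le1)
  then show ?thesis using powr_ge_zero[of X s] by linarith
next
  case False
  then have "X powr p \<le> X powr s" using assms by (intro powr_mono) auto
  then show ?thesis by simp
qed

text \<open>Young's inequality for the conjugate exponents N / p and N / (N - p), by comparing the
  two factors. It pairs f with expressions of order p in u, which are critically integrable: s = p N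
  / (N - p).\<close>

lemma young_critical:
  fixes F Z p N :: real
  assumes "0 < p" "p < N" "0 \<le> F" "0 \<le> Z"
  shows "F * Z \<le> F powr (N / p) + Z powr (N / (N - p))"
proof (cases "F \<le> Z powr (p / (N - p))")
  case True
  have "F * Z \<le> Z powr (p / (N - p)) * Z" using True assms by (intro mult_right_mono)
  also have "\<dots> = Z powr (p / (N - p) + 1)"
    using powr_minus_one_mult[of Z "p / (N - p) + 1"] assms by simp
  also have "p / (N - p) + 1 = N / (N - p)" using assms by (simp add: field_simps)
  finally show ?thesis using powr_ge_zero[of F "N / p"] by linarith
next
  case False
  have "(Z powr (p / (N - p))) powr ((N - p) / p) \<le> F powr ((N - p) / p)"
    using False assms by (intro powr_mono2) auto
  then have "Z \<le> F powr ((N - p) / p)" using assms by (simp add: powr_powr)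
  then have "F * Z \<le> F powr ((N - p) / p) * F" using assms by (simp add: mult.commute mult_left_mono)
  also have "\<dots> = F powr ((N - p) / p + 1)"
    using powr_minus_one_mult[of F "(N - p) / p + 1"] assms by simp
  also have "(N - p) / p + 1 = N / p" using assms by (simp add: field_simps)
  finally show ?thesis using powr_ge_zero[of Z "N / (N - p)"] by linarith
qed

lemma borel_measurable_flux [measurable]: "flux p \<in> borel_measurable borel"
  unfolding flux_def[abs_def] by measurable

lemma borel_measurable_test_profiles [measurable]:
  "excess \<in> borel_measurable borel" "excess' \<in> borel_measurable borel"
  "powr_excess p \<in> borel_measurable borel" "powr_excess' p \<in> borel_measurable borel"
  "cutoff R \<in> borel_measurable borel" "cutoff' R \<in> borel_measurable borel"
proof -
  show [measurable]: "excess \<in> borel_measurable borel"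
    by (rule borel_measurable_continuous_onI[OF continuous_on_excess])
  show "powr_excess p \<in> borel_measurable borel" unfolding powr_excess_def[abs_def] by measurable
  show "cutoff R \<in> borel_measurable borel" unfolding cutoff_def[abs_def] by measurable
qed (rule borel_measurable_continuous_onI, rule continuous_on_excess' continuous_on_powr_excess' continuous_on_cutoff')+

text \<open>The barrier enters through its profile v, slope y and flux coefficient h, tied by
  \<open>v'_eq\<close>, \<open>h_eq\<close> and the radial inequality \<open>supersol\<close>; in
  this form positive multiples of a barrier fit as well. The constant c separates u from v on a
  shell outside the sphere.\<close>

locale comparison = exterior_sobolev a s p u g
  for a s p :: real and u :: "'a::euclidean_space \<Rightarrow> real" and g :: "'a \<Rightarrow> 'a" +
  fixes f :: "'a \<Rightarrow> real" and N \<mu> A \<alpha> \<gamma> \<delta> c :: real and v v' y h h' :: "real \<Rightarrow> real"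
  assumes N: "N = DIM('a)" and p_less: "p < N" and s_eq: "s = N * p / (N - p)"
    and a1: "1 < a" and \<mu>: "0 \<le> \<mu>"
    and f_borel [measurable]: "f \<in> borel_measurable borel"
    and f_int: "integrable lborel (\<lambda>x. \<bar>f x\<bar> powr (N / p))"
    and f_le: "AE x in lborel. a < norm x \<longrightarrow> f x \<le> A * norm x powr (- \<alpha>)"
    and subsol: "\<And>\<phi>. \<phi> \<in> test_functions {x. a < norm x} \<Longrightarrow> (\<And>x. 0 \<le> \<phi> x) \<Longrightarrow>
      (\<integral>x. flux p (g x) \<bullet> grad \<phi> x + - ((\<mu> * norm x powr (- p) + f x) * (\<bar>u x\<bar> powr (p - 2) * u x)) * \<phi> x
        \<partial>lborel) \<le> 0"
    and v_borel [measurable]: "v \<in> borel_measurable borel" "v' \<in> borel_measurable borel"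
      "h \<in> borel_measurable borel" "h' \<in> borel_measurable borel" "y \<in> borel_measurable borel"
    and v: "\<And>r. a \<le> r \<Longrightarrow> 0 < v r" "\<And>r. a \<le> r \<Longrightarrow> (v has_real_derivative v' r) (at r)"
      "continuous_on {a..} v'"
    and h: "\<And>r. a \<le> r \<Longrightarrow> (h has_real_derivative h' r) (at r)" "continuous_on {a..} h'"
    and y: "\<And>r. a \<le> r \<Longrightarrow> 0 < y r" "\<And>r. a \<le> r \<Longrightarrow> y r \<le> \<gamma>"
    and v'_eq: "\<And>r. a \<le> r \<Longrightarrow> v' r = - (y r * v r / r)"
    and h_eq: "\<And>r. a \<le> r \<Longrightarrow> h r = (y r * v r) powr (p - 1) * r powr (- p)"
    and supersol: "\<And>r. a \<le> r \<Longrightarrow>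
      v r powr (p - 1) * (\<mu> * r powr (- p) + A * r powr (- \<alpha>)) \<le> r * h' r + N * h r"
    and near: "0 < \<delta>" "AE x in lborel. a < norm x \<and> norm x < a + \<delta> \<longrightarrow> u x \<le> c"
      "\<And>r. a < r \<Longrightarrow> r < a + \<delta> \<Longrightarrow> c \<le> v r"
begin

section \<open>Zeroth order terms and dominating functions\<close>

definition q :: "'a \<Rightarrow> real" where
  "q x = - ((\<mu> * norm x powr (- p) + f x) * (\<bar>u x\<bar> powr (p - 2) * u x))"

lemma q_borel [measurable]: "q \<in> borel_measurable borel"
  unfolding q_def[abs_def] by measurable

lemma N_pos: "0 < N" "0 \<le> N / (N - p)"
  using p_less p by auto

lemma p_le_s: "p \<le> s"
  using p p_less unfolding s_eq by (simp add: le_divide_eq mult.commute[of _ p] mult_left_mono)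

lemma powr_p_le: "0 \<le> X \<Longrightarrow> X powr p \<le> 1 + X powr s"
  using powr_le_one_add p_le_s p by simp

text \<open>X is the size of a test function at x. The weight |x|^(-p) is at most 1 since a > 1, and
  f is paired with |u|^(p-1) X by the critical Young inequality; besides a constant, only |f|^(N/p)
  and s-th powers remain.\<close>

lemma abs_q_mult_le:
  assumes x: "a < norm x" and X: "0 \<le> X"
  shows "\<bar>q x\<bar> * X \<le> \<mu> * (2 + \<bar>u x\<bar> powr s + X powr s) + (\<bar>f x\<bar> powr (N / p) + \<bar>u x\<bar> powr s + X powr s)"
proof -
  define Z where "Z = \<bar>u x\<bar> powr (p - 1) * X"
  have Z0: "0 \<le> Z" using X by (simp add: Z_def)
  have Z1: "Z \<le> 2 + \<bar>u x\<bar> powr s + X powr s"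
    using powr_mult_le_sum[OF p, of "\<bar>u x\<bar>" X] powr_p_le[of "\<bar>u x\<bar>"] powr_p_le[OF X] X
    by (simp add: Z_def)
  have Z2: "Z powr (N / (N - p)) \<le> \<bar>u x\<bar> powr s + X powr s"
  proof -
    have "Z \<le> max \<bar>u x\<bar> X powr (p - 1) * max \<bar>u x\<bar> X"
      unfolding Z_def using X p by (intro mult_mono powr_mono2) auto
    then have "Z \<le> max \<bar>u x\<bar> X powr p" using powr_minus_one_mult[of "max \<bar>u x\<bar> X" p] X by simp
    then have "Z powr (N / (N - p)) \<le> (max \<bar>u x\<bar> X powr p) powr (N / (N - p))"
      using Z0 N_pos by (intro powr_mono2) auto
    also have "\<dots> = max \<bar>u x\<bar> X powr s" by (simp add: powr_powr s_eq mult.commute)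
    also have "\<dots> \<le> \<bar>u x\<bar> powr s + X powr s" by (simp add: max_def)
    finally show ?thesis .
  qed
  have "norm x powr (- p) \<le> 1"
    using x a1 p powr_mono2'[of "- p" 1 "norm x"] by simp
  then have m: "\<mu> * norm x powr (- p) \<le> \<mu>" "0 \<le> \<mu> * norm x powr (- p)"
    using \<mu> by (auto simp: mult_left_le)
  have "\<bar>\<bar>u x\<bar> powr (p - 2) * u x\<bar> = \<bar>u x\<bar> powr (p - 1)"
    using powr_minus_one_mult[of "\<bar>u x\<bar>" "p - 1"] by (simp add: abs_mult diff_diff_eq)
  then have "\<bar>q x\<bar> * X = \<bar>\<mu> * norm x powr (- p) + f x\<bar> * Z"
    by (simp add: q_def abs_mult Z_def)
  also have "\<dots> \<le> (\<mu> + \<bar>f x\<bar>) * Z" using m Z0 by (intro mult_right_mono) auto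
  also have "\<dots> = \<mu> * Z + \<bar>f x\<bar> * Z" by (simp add: distrib_right)
  also have "\<dots> \<le> \<mu> * (2 + \<bar>u x\<bar> powr s + X powr s) + (\<bar>f x\<bar> powr (N / p) + Z powr (N / (N - p)))"
    using Z1 \<mu> Z0 young_critical[of p N "\<bar>f x\<bar>" Z] p p_less by (intro add_mono mult_left_mono) auto
  finally show ?thesis using Z2 by linarith
qed

lemma subsol_C1:
  assumes "C1_grad w W" "\<And>x. 0 \<le> w x" "a < b" "\<And>x. norm x \<le> b \<Longrightarrow> w x = 0" "\<And>x. R \<le> norm x \<Longrightarrow> w x = 0"
  shows "(\<integral>x. flux p (g x) \<bullet> W x + q x * w x \<partial>lborel) \<le> 0"
proof (rule C1_test_extension[where a = a and b = b and R = R])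
  fix L :: real
  let ?i = "\<lambda>x. indicator {x. a < norm x \<and> norm x \<le> L} x * (norm (flux p (g x)) + \<bar>q x\<bar>)"
  let ?B = "\<lambda>x. (2 + 3 * \<mu>) * indicator (cball 0 L) x + norm (g x) powr p + (\<mu> + 1) * \<bar>u x\<bar> powr s
    + \<bar>f x\<bar> powr (N / p)"
  show "integrable lborel ?i"
  proof (rule Bochner_Integration.integrable_bound[where f = ?B])
    show "integrable lborel ?B"
      by (intro Bochner_Integration.integrable_add integrable_const_cball g_int f_int
          integrable_mult_right u_int)
    show "AE x in lborel. norm (?i x) \<le> norm (?B x)"
    proof (rule AE_I2)
      fix x :: 'a
      show "norm (?i x) \<le> norm (?B x)"
      proof (cases "a < norm x \<and> norm x \<le> L")
        case True
        have "norm (flux p (g x)) \<le> 1 + norm (g x) powr p"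
          unfolding norm_flux using powr_le_one_add[of "norm (g x)" "p - 1" p] p by simp
        moreover have "\<bar>q x\<bar> \<le> \<mu> * (2 + \<bar>u x\<bar> powr s + 1) + (\<bar>f x\<bar> powr (N / p) + \<bar>u x\<bar> powr s + 1)"
          using abs_q_mult_le[of x 1] True by simp
        ultimately have "?i x \<le> ?B x" using True by (simp add: algebra_simps)
        moreover have "0 \<le> ?i x" by simp
        ultimately show ?thesis by simp
      qed simp
    qed
    show "?i \<in> borel_measurable lborel" by measurable
  qed
qed (use assms subsol in \<open>auto simp: q_def\<close>)

lemma bounded_on_annulus:
  assumes "continuous_on {a..} \<kappa>"
  obtains B :: real where "1 \<le> B" "\<And>r. a \<le> r \<Longrightarrow> r \<le> R \<Longrightarrow> \<bar>\<kappa> r\<bar> \<le> B"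
proof -
  have "compact (\<kappa> ` {a..R})"
    using assms by (intro compact_continuous_image) (auto intro: continuous_on_subset)
  then obtain B where B: "\<forall>z\<in>\<kappa> ` {a..R}. norm z \<le> B"
    using compact_imp_bounded bounded_iff by blast
  have "\<bar>\<kappa> r\<bar> \<le> max 1 B" if "a \<le> r" "r \<le> R" for r
  proof -
    have "\<bar>\<kappa> r\<bar> \<le> B" using B that by auto
    then show ?thesis by simp
  qed
  then show thesis using that[of "max 1 B"] by simp
qed

lemma continuous_on_v: "continuous_on {a..} v"
  by (rule DERIV_continuous_on[OF has_field_derivative_at_within[OF v(2)]]) simp

lemma inverse_v_bound:
  obtains B where "1 \<le> B" "\<And>r. a \<le> r \<Longrightarrow> r \<le> R \<Longrightarrow> 1 / v r \<le> B"
proof -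
  have "continuous_on {a..} (\<lambda>r. 1 / v r)"
    using v(1) by (intro continuous_on_divide continuous_on_const continuous_on_v) force
  then obtain B where "1 \<le> B" "\<And>r. a \<le> r \<Longrightarrow> r \<le> R \<Longrightarrow> \<bar>1 / v r\<bar> \<le> B"
    using bounded_on_annulus[of "\<lambda>r. 1 / v r" R] by metis
  note B = this
  show thesis
  proof (rule that[OF B(1)])
    show "1 / v r \<le> B" if "a \<le> r" "r \<le> R" for r
      using B(2)[OF that] by (rule abs_le_D1)
  qed
qed

lemma abs_excess_le: "\<bar>excess t\<bar> \<le> \<bar>t\<bar>"
  using excess_le[of t] excess_eq_0[of t] excess_nonneg[of t] by (cases "1 \<le> t") auto

lemma abs_powr_excess_le: "\<bar>powr_excess p t\<bar> \<le> \<bar>t\<bar> powr p"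
  using powr_excess_le[of t p] powr_excess_eq_0(1)[of t p] powr_excess_nonneg[of p t] by (cases "1 \<le> t") auto

lemma abs_powr_excess'_le': "\<bar>powr_excess' p t\<bar> \<le> p * \<bar>t\<bar> powr (p - 1)"
  using abs_powr_excess'_le[OF p, of t] powr_excess_eq_0(2)[of t p] p by (cases "1 \<le> t") auto

text \<open>The domination hypothesis of \<open>chain_test\<close> for the inequality of u. The
  profile grows at most linearly, so its products with |g|^(p-1) and with q stay within |g|^p,
  |u|^s, |f|^(N/p), constants on a ball and the majorant d.\<close>

lemma dom_subsol:
  obtains W0 K where "integrable lborel W0"
    "\<And>x \<tau> \<beta> d. a < norm x \<Longrightarrow> norm x \<le> R \<Longrightarrow> \<bar>\<tau>\<bar> powr s \<le> d \<Longrightarrow> 0 \<le> \<beta> \<Longrightarrow> \<beta> powr p \<le> d \<Longrightarrow>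
        norm (flux p (g x)) * (\<bar>excess' (\<tau> / v (norm x))\<bar> * (\<beta> + \<bar>\<tau>\<bar>) + \<bar>excess (\<tau> / v (norm x))\<bar>)
          + \<bar>q x\<bar> * \<bar>excess (\<tau> / v (norm x))\<bar> \<le> W0 x + K * d"
proof -
  obtain B where B: "1 \<le> B" "\<And>r. a \<le> r \<Longrightarrow> r \<le> R \<Longrightarrow> 1 / v r \<le> B"
    using inverse_v_bound by blast
  define W where "W x = (norm (g x) powr p + (1 + B) * (norm (g x) powr p + 1 * indicator (cball 0 R) x))
    + B * (2 * \<mu> * indicator (cball 0 R) x + (\<mu> + 1) * \<bar>u x\<bar> powr s + \<bar>f x\<bar> powr (N / p))" for x
  show thesis
  proof (rule that[of W "1 + (1 + B) + B * (\<mu> + 1)"])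
    show "integrable lborel W"
      unfolding W_def[abs_def]
      by (intro Bochner_Integration.integrable_add integrable_mult_right g_int u_int f_int integrable_const_cball)
    fix x :: 'a and \<tau> \<beta> d :: real
    assume x: "a < norm x" "norm x \<le> R" and d: "\<bar>\<tau>\<bar> powr s \<le> d" "0 \<le> \<beta>" "\<beta> powr p \<le> d"
    let ?t = "\<tau> / v (norm x)" and ?g = "norm (g x)"
    have vp: "0 < v (norm x)" using v(1) x by simp
    have excess: "\<bar>excess ?t\<bar> \<le> B * \<bar>\<tau>\<bar>"
    proof -
      have "\<bar>excess ?t\<bar> \<le> (1 / v (norm x)) * \<bar>\<tau>\<bar>" using abs_excess_le[of ?t] vp by simp
      also have "\<dots> \<le> B * \<bar>\<tau>\<bar>" using B(2)[of "norm x"] x by (intro mult_right_mono) auto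
      finally show ?thesis .
    qed
    have "\<bar>excess' ?t\<bar> * (\<beta> + \<bar>\<tau>\<bar>) \<le> 1 * (\<beta> + \<bar>\<tau>\<bar>)"
      using excess'_bounds[of ?t] d by (intro mult_right_mono) auto
    then have "?g powr (p - 1) * (\<bar>excess' ?t\<bar> * (\<beta> + \<bar>\<tau>\<bar>) + \<bar>excess ?t\<bar>) \<le> ?g powr (p - 1) * ((\<beta> + \<bar>\<tau>\<bar>) + B * \<bar>\<tau>\<bar>)"
      using excess by (intro mult_left_mono) auto
    also have "\<dots> = ?g powr (p - 1) * \<beta> + (1 + B) * (?g powr (p - 1) * \<bar>\<tau>\<bar>)"
      by (simp add: algebra_simps)
    also have "\<dots> \<le> (?g powr p + d) + (1 + B) * (?g powr p + (1 + d))"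
    proof (intro add_mono mult_left_mono)
      show "?g powr (p - 1) * \<beta> \<le> ?g powr p + d"
        using powr_mult_le_sum[OF p, of ?g \<beta>] d by simp
      show "?g powr (p - 1) * \<bar>\<tau>\<bar> \<le> ?g powr p + (1 + d)"
        using powr_mult_le_sum[OF p, of ?g "\<bar>\<tau>\<bar>"] powr_p_le[of "\<bar>\<tau>\<bar>"] d by simp
    qed (use B in simp)
    finally have 1: "norm (flux p (g x)) * (\<bar>excess' ?t\<bar> * (\<beta> + \<bar>\<tau>\<bar>) + \<bar>excess ?t\<bar>)
        \<le> (?g powr p + d) + (1 + B) * (?g powr p + (1 + d))"
      by (simp add: norm_flux)
    have "\<bar>q x\<bar> * \<bar>excess ?t\<bar> \<le> \<bar>q x\<bar> * (B * \<bar>\<tau>\<bar>)" using excess by (intro mult_left_mono) auto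
    also have "\<dots> = B * (\<bar>q x\<bar> * \<bar>\<tau>\<bar>)" by simp
    also have "\<dots> \<le> B * (\<mu> * (2 + \<bar>u x\<bar> powr s + \<bar>\<tau>\<bar> powr s)
        + (\<bar>f x\<bar> powr (N / p) + \<bar>u x\<bar> powr s + \<bar>\<tau>\<bar> powr s))"
      using abs_q_mult_le[OF x(1), of "\<bar>\<tau>\<bar>"] B(1) by (intro mult_left_mono) auto
    also have "\<dots> \<le> B * (\<mu> * (2 + \<bar>u x\<bar> powr s + d) + (\<bar>f x\<bar> powr (N / p) + \<bar>u x\<bar> powr s + d))"
      using d \<mu> B(1) by (intro mult_left_mono add_mono) auto
    finally show "norm (flux p (g x)) * (\<bar>excess' ?t\<bar> * (\<beta> + \<bar>\<tau>\<bar>) + \<bar>excess ?t\<bar>) + \<bar>q x\<bar> * \<bar>excess ?t\<bar>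
      \<le> W x + (1 + (1 + B) + B * (\<mu> + 1)) * d"
      using 1 x by (simp add: W_def algebra_simps)
  qed
qed

text \<open>The same for the barrier. The profile grows like t^p, which is affordable because the
  field x is bounded on the ball and p is at most s.\<close>

lemma dom_supersol:
  obtains W0 :: "'a \<Rightarrow> real" and K where "integrable lborel W0"
    "\<And>x \<tau> \<beta> d. a < norm x \<Longrightarrow> norm x \<le> R \<Longrightarrow> \<bar>\<tau>\<bar> powr s \<le> d \<Longrightarrow> 0 \<le> \<beta> \<Longrightarrow> \<beta> powr p \<le> d \<Longrightarrow>
        norm x * (\<bar>powr_excess' p (\<tau> / v (norm x))\<bar> * (\<beta> + \<bar>\<tau>\<bar>) + \<bar>powr_excess p (\<tau> / v (norm x))\<bar>)
          + \<bar>N\<bar> * \<bar>powr_excess p (\<tau> / v (norm x))\<bar> \<le> W0 x + K * d"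
proof -
  obtain B where B: "1 \<le> B" "\<And>r. a \<le> r \<Longrightarrow> r \<le> R \<Longrightarrow> 1 / v r \<le> B"
    using inverse_v_bound by blast
  define C where "C = \<bar>R\<bar> * (p * B powr (p - 1) * 3 + B powr p) + N * B powr p"
  have C: "0 \<le> C" using p N_pos(1) by (simp add: C_def)
  define W where "W x = C * indicator (cball 0 R) x" for x :: 'a
  show thesis
  proof (rule that[of W C])
    show "integrable lborel W" unfolding W_def[abs_def] by (rule integrable_const_cball)
    fix x :: 'a and \<tau> \<beta> d :: real
    assume x: "a < norm x" "norm x \<le> R" and d: "\<bar>\<tau>\<bar> powr s \<le> d" "0 \<le> \<beta>" "\<beta> powr p \<le> d"
    let ?t = "\<tau> / v (norm x)"
    have vp: "0 < v (norm x)" using v(1) x by simp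
    have t: "\<bar>?t\<bar> \<le> B * \<bar>\<tau>\<bar>"
    proof -
      have "\<bar>?t\<bar> = (1 / v (norm x)) * \<bar>\<tau>\<bar>" using vp by simp
      also have "\<dots> \<le> B * \<bar>\<tau>\<bar>" using B(2)[of "norm x"] x by (intro mult_right_mono) auto
      finally show ?thesis .
    qed
    have d0: "0 \<le> d" using d(1) powr_ge_zero order_trans by blast
    have tp: "\<bar>\<tau>\<bar> powr p \<le> 1 + d" using powr_p_le[of "\<bar>\<tau>\<bar>"] d by simp
    have powr_excess: "\<bar>powr_excess p ?t\<bar> \<le> B powr p * (1 + d)"
    proof -
      have "\<bar>powr_excess p ?t\<bar> \<le> (B * \<bar>\<tau>\<bar>) powr p"
        by (rule order_trans[OF abs_powr_excess_le]) (use t p in \<open>intro powr_mono2; simp\<close>)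
      also have "\<dots> = B powr p * \<bar>\<tau>\<bar> powr p" using B(1) by (simp add: powr_mult)
      also have "\<dots> \<le> B powr p * (1 + d)" using tp by (intro mult_left_mono) auto
      finally show ?thesis .
    qed
    have "\<bar>powr_excess' p ?t\<bar> * (\<beta> + \<bar>\<tau>\<bar>) \<le> (p * (B powr (p - 1) * \<bar>\<tau>\<bar> powr (p - 1))) * (\<beta> + \<bar>\<tau>\<bar>)"
    proof (intro mult_right_mono)
      have "\<bar>powr_excess' p ?t\<bar> \<le> p * (B * \<bar>\<tau>\<bar>) powr (p - 1)"
        by (rule order_trans[OF abs_powr_excess'_le']) (use t p in \<open>intro mult_left_mono powr_mono2; simp\<close>)
      then show "\<bar>powr_excess' p ?t\<bar> \<le> p * (B powr (p - 1) * \<bar>\<tau>\<bar> powr (p - 1))"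
        using B(1) by (simp add: powr_mult)
    qed (use d in simp)
    also have "\<dots> = p * B powr (p - 1) * (\<bar>\<tau>\<bar> powr (p - 1) * \<beta> + \<bar>\<tau>\<bar> powr p)"
      using powr_minus_one_mult[of "\<bar>\<tau>\<bar>" p] by (simp add: algebra_simps)
    also have "\<dots> \<le> p * B powr (p - 1) * (3 * (1 + d))"
      using powr_mult_le_sum[OF p, of "\<bar>\<tau>\<bar>" \<beta>] d tp d0 p by (intro mult_left_mono) auto
    finally have "\<bar>powr_excess' p ?t\<bar> * (\<beta> + \<bar>\<tau>\<bar>) + \<bar>powr_excess p ?t\<bar> \<le> (p * B powr (p - 1) * 3 + B powr p) * (1 + d)"
      using powr_excess by (simp add: algebra_simps)
    then have "norm x * (\<bar>powr_excess' p ?t\<bar> * (\<beta> + \<bar>\<tau>\<bar>) + \<bar>powr_excess p ?t\<bar>)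
        \<le> \<bar>R\<bar> * ((p * B powr (p - 1) * 3 + B powr p) * (1 + d))"
      using x d by (intro mult_mono) auto
    moreover have "\<bar>N\<bar> * \<bar>powr_excess p ?t\<bar> \<le> N * (B powr p * (1 + d))"
      using powr_excess N_pos(1) by (simp add: mult_left_mono)
    ultimately show "norm x * (\<bar>powr_excess' p ?t\<bar> * (\<beta> + \<bar>\<tau>\<bar>) + \<bar>powr_excess p ?t\<bar>) + \<bar>N\<bar> * \<bar>powr_excess p ?t\<bar> \<le> W x + C * d"
      using x by (simp add: W_def C_def algebra_simps)
  qed
qed

text \<open>The linear profile \<open>excess\<close> against the radial field, for turning a
  vanishing gradient of the quotient into u <= v.\<close>

lemma dom_radial:
  obtains W0 :: "'a \<Rightarrow> real" and K where "integrable lborel W0"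
    "\<And>x \<tau> \<beta> d. a < norm x \<Longrightarrow> norm x \<le> R \<Longrightarrow> \<bar>\<tau>\<bar> powr s \<le> d \<Longrightarrow> 0 \<le> \<beta> \<Longrightarrow> \<beta> powr p \<le> d \<Longrightarrow>
        norm x * (\<bar>excess' (\<tau> / v (norm x))\<bar> * (\<beta> + \<bar>\<tau>\<bar>) + \<bar>excess (\<tau> / v (norm x))\<bar>)
          + \<bar>N\<bar> * \<bar>excess (\<tau> / v (norm x))\<bar> \<le> W0 x + K * d"
proof -
  obtain B where B: "1 \<le> B" "\<And>r. a \<le> r \<Longrightarrow> r \<le> R \<Longrightarrow> 1 / v r \<le> B"
    using inverse_v_bound by blast
  define C where "C = \<bar>R\<bar> * (2 + B) + N * B"
  define W where "W x = C * indicator (cball 0 R) x" for x :: 'a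
  show thesis
  proof (rule that[of W C])
    show "integrable lborel W" unfolding W_def[abs_def] by (rule integrable_const_cball)
    fix x :: 'a and \<tau> \<beta> d :: real
    assume x: "a < norm x" "norm x \<le> R" and d: "\<bar>\<tau>\<bar> powr s \<le> d" "0 \<le> \<beta>" "\<beta> powr p \<le> d"
    let ?t = "\<tau> / v (norm x)"
    have vp: "0 < v (norm x)" using v(1) x by simp
    have \<tau>: "\<bar>\<tau>\<bar> \<le> 1 + d" and \<beta>: "\<beta> \<le> 1 + d"
      using powr_ge_self[OF s, of "\<bar>\<tau>\<bar>"] powr_ge_self[OF p d(2)] d by auto
    have "\<bar>excess ?t\<bar> \<le> (1 / v (norm x)) * \<bar>\<tau>\<bar>" using abs_excess_le[of ?t] vp by simp
    also have "\<dots> \<le> B * (1 + d)" using B(1) B(2)[of "norm x"] x \<tau> by (intro mult_mono) auto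
    finally have excess: "\<bar>excess ?t\<bar> \<le> B * (1 + d)" .
    have "\<bar>excess' ?t\<bar> * (\<beta> + \<bar>\<tau>\<bar>) \<le> 1 * (2 * (1 + d))"
      using excess'_bounds[of ?t] d \<tau> \<beta> by (intro mult_mono) auto
    with excess have "\<bar>excess' ?t\<bar> * (\<beta> + \<bar>\<tau>\<bar>) + \<bar>excess ?t\<bar> \<le> (2 + B) * (1 + d)" by (simp add: algebra_simps)
    then have "norm x * (\<bar>excess' ?t\<bar> * (\<beta> + \<bar>\<tau>\<bar>) + \<bar>excess ?t\<bar>) \<le> \<bar>R\<bar> * ((2 + B) * (1 + d))"
      using x d by (intro mult_mono) auto
    moreover have "\<bar>N\<bar> * \<bar>excess ?t\<bar> \<le> N * (B * (1 + d))" using excess N_pos(1) by (simp add: mult_left_mono)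
    ultimately show "norm x * (\<bar>excess' ?t\<bar> * (\<beta> + \<bar>\<tau>\<bar>) + \<bar>excess ?t\<bar>) + \<bar>N\<bar> * \<bar>excess ?t\<bar> \<le> W x + C * d"
      using x by (simp add: W_def C_def algebra_simps)
  qed
qed

end

section \<open>The two tested inequalities and their sum\<close>

context comparison
begin

text \<open>The test function u H(t) eta equals v eta times \<open>excess t\<close>, so the radial
  factor is v eta with eta the cutoff.\<close>

definition \<zeta> :: "real \<Rightarrow> real \<Rightarrow> real" where "\<zeta> R r = v r * cutoff R r"

definition \<zeta>' :: "real \<Rightarrow> real \<Rightarrow> real" where "\<zeta>' R r = v' r * cutoff R r + v r * cutoff' R r"

lemma borel_measurable_\<zeta> [measurable]: "\<zeta> R \<in> borel_measurable borel" "\<zeta>' R \<in> borel_measurable borel"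
  unfolding \<zeta>_def[abs_def] \<zeta>'_def[abs_def] by measurable

lemma DERIV_\<zeta>: "a \<le> r \<Longrightarrow> (\<zeta> R has_real_derivative \<zeta>' R r) (at r)"
  unfolding \<zeta>_def[abs_def] \<zeta>'_def
  by (rule DERIV_cong[OF DERIV_mult[OF v(2) DERIV_cutoff]]) (auto simp: mult.commute)

lemma continuous_on_cutoff: "continuous_on S (cutoff R)"
  by (rule DERIV_continuous_on[OF has_field_derivative_at_within[OF DERIV_cutoff]])

lemma continuous_on_\<zeta>: "continuous_on {a..} (\<zeta> R)" "continuous_on {a..} (\<zeta>' R)"
  unfolding \<zeta>_def[abs_def] \<zeta>'_def[abs_def]
  by (intro continuous_on_add continuous_on_mult continuous_on_v v(3) continuous_on_cutoff continuous_on_cutoff')+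

lemma \<zeta>_nonneg: "a \<le> r \<Longrightarrow> 0 \<le> \<zeta> R r"
  using v(1)[of r] cutoff_bounds(1)[of R r] by (simp add: \<zeta>_def)

lemma \<zeta>_eq_0: "0 < R \<Longrightarrow> 2 * R \<le> r \<Longrightarrow> \<zeta> R r = 0" "0 < R \<Longrightarrow> 2 * R \<le> r \<Longrightarrow> \<zeta>' R r = 0"
  using cutoff_eq_0 by (auto simp: \<zeta>_def \<zeta>'_def)

definition subsol_integrand :: "real \<Rightarrow> 'a \<Rightarrow> real" where
  "subsol_integrand R = chain_integrand (\<lambda>x. flux p (g x)) q v v' (\<zeta> R) (\<zeta>' R) excess excess'"

text \<open>The Euler identity for w = h v eta t^p H(t). With h moved into w, the weak form for the
  barrier becomes x . W + N w, and the product rule makes the divergence r h' + N h appear.\<close>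

definition supersol_integrand :: "real \<Rightarrow> 'a \<Rightarrow> real" where
  "supersol_integrand R = chain_integrand (\<lambda>x. x) (\<lambda>_. N) v v' (\<lambda>r. h r * \<zeta> R r) (\<lambda>r. h' r * \<zeta> R r + h r * \<zeta>' R r) (powr_excess p) (powr_excess' p)"

lemma subsol_integrand:
  assumes R: "0 < R"
  shows "integrable lborel (subsol_integrand R)" "integral\<^sup>L lborel (subsol_integrand R) \<le> 0"
proof -
  obtain W0 K where W: "integrable lborel W0"
    "\<And>x \<tau> \<beta> d. a < norm x \<Longrightarrow> norm x \<le> 2 * R \<Longrightarrow> \<bar>\<tau>\<bar> powr s \<le> d \<Longrightarrow> 0 \<le> \<beta> \<Longrightarrow> \<beta> powr p \<le> d \<Longrightarrow>
        norm (flux p (g x)) * (\<bar>excess' (\<tau> / v (norm x))\<bar> * (\<beta> + \<bar>\<tau>\<bar>) + \<bar>excess (\<tau> / v (norm x))\<bar>)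
          + \<bar>q x\<bar> * \<bar>excess (\<tau> / v (norm x))\<bar> \<le> W0 x + K * d"
    by (rule dom_subsol[of "2 * R"], rule that)
  have m: "(\<lambda>x. flux p (g x)) \<in> borel_measurable borel" by measurable
  note test = chain_test[where P = "\<lambda>x. flux p (g x)" and q = q and v = v and v' = v' and \<zeta> = "\<zeta> R"
      and \<zeta>' = "\<zeta>' R" and Q = excess and Q' = excess' and R = "2 * R" and \<delta> = \<delta> and c = c and K = K,
      OF m q_borel subsol_C1 v_borel(1,2) borel_measurable_\<zeta> v \<zeta>_nonneg DERIV_\<zeta> continuous_on_\<zeta>(2)
      \<zeta>_eq_0[OF R] excess_nonneg DERIV_excess continuous_on_excess' excess_eq_0 excess'_eq_0 near W(1) W(2)]
  show "integrable lborel (subsol_integrand R)" unfolding subsol_integrand_def by (rule test(1); assumption)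
  show "integral\<^sup>L lborel (subsol_integrand R) \<le> 0" unfolding subsol_integrand_def by (rule test(2); assumption)
qed

lemma h_nonneg: "a \<le> r \<Longrightarrow> 0 \<le> h r"
  by (simp add: h_eq)

lemma continuous_on_h: "continuous_on {a..} h"
  by (rule DERIV_continuous_on[OF has_field_derivative_at_within[OF h(1)]]) simp

lemma supersol_integrand:
  assumes R: "0 < R"
  shows "integrable lborel (supersol_integrand R)" "integral\<^sup>L lborel (supersol_integrand R) \<le> 0"
proof -
  obtain W0 :: "'a \<Rightarrow> real" and K where W: "integrable lborel W0"
    "\<And>x \<tau> \<beta> d. a < norm x \<Longrightarrow> norm x \<le> 2 * R \<Longrightarrow> \<bar>\<tau>\<bar> powr s \<le> d \<Longrightarrow> 0 \<le> \<beta> \<Longrightarrow> \<beta> powr p \<le> d \<Longrightarrow>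
        norm x * (\<bar>powr_excess' p (\<tau> / v (norm x))\<bar> * (\<beta> + \<bar>\<tau>\<bar>) + \<bar>powr_excess p (\<tau> / v (norm x))\<bar>)
          + \<bar>N\<bar> * \<bar>powr_excess p (\<tau> / v (norm x))\<bar> \<le> W0 x + K * d"
    by (rule dom_supersol[of "2 * R"], rule that)
  let ?z = "\<lambda>r. h r * \<zeta> R r" and ?z' = "\<lambda>r. h' r * \<zeta> R r + h r * \<zeta>' R r"
  have m: "?z \<in> borel_measurable borel" "?z' \<in> borel_measurable borel" by measurable
  have m0: "(\<lambda>x::'a. x) \<in> borel_measurable borel" "(\<lambda>_::'a. N) \<in> borel_measurable borel" by auto
  have z: "0 \<le> ?z r" "(?z has_real_derivative ?z' r) (at r)" if "a \<le> r" for r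
    using \<zeta>_nonneg[OF that, of R] h_nonneg[OF that] DERIV_mult[OF h(1)[OF that] DERIV_\<zeta>[OF that, of R]]
    by (auto simp: mult.commute)
  have zc: "continuous_on {a..} ?z'"
    by (intro continuous_on_add continuous_on_mult h(2) continuous_on_h continuous_on_\<zeta>)
  have z0: "?z r = 0" "?z' r = 0" if "2 * R \<le> r" for r
    using \<zeta>_eq_0[OF R that] by auto
  have J: "(\<integral>x. x \<bullet> D x + N * w x \<partial>lborel) \<le> 0"
    if "C1_grad w D" "\<And>x. R \<le> norm x \<Longrightarrow> w x = 0" for w :: "'a \<Rightarrow> real" and D R
    using integral_euler_eq_0[OF that] by (simp add: N inner_commute add.commute)
  note test = chain_test[where P = "\<lambda>x. x" and q = "\<lambda>_. N" and v = v and v' = v' and \<zeta> = ?z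
      and \<zeta>' = ?z' and Q = "powr_excess p" and Q' = "powr_excess' p" and R = "2 * R" and \<delta> = \<delta> and c = c and K = K,
      OF m0 J v_borel(1,2) m v z zc z0 powr_excess_nonneg DERIV_powr_excess[OF p] continuous_on_powr_excess' powr_excess_eq_0 near W(1) W(2)]
  show "integrable lborel (supersol_integrand R)" unfolding supersol_integrand_def by (rule test(1); assumption)
  show "integral\<^sup>L lborel (supersol_integrand R) \<le> 0" unfolding supersol_integrand_def by (rule test(2); assumption)
qed

text \<open>The expression Z of \<open>picone_bracket\<close>, with the gradients of u and v divided
  by v as a and b.\<close>

definition gap :: "'a \<Rightarrow> real" where
  "gap x = (let t = u x / v (norm x); a = (1 / v (norm x)) *\<^sub>R g x; b = (v' (norm x) / (v (norm x) * norm x)) *\<^sub>R x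
    in excess' t * (flux p a \<bullet> (a - t *\<^sub>R b)) + excess t * (flux p a \<bullet> b)
      - powr_excess' p t * (flux p b \<bullet> (a - t *\<^sub>R b)) - powr_excess p t * (flux p b \<bullet> b))"

definition weighted_gap :: "'a \<Rightarrow> real" where
  "weighted_gap x = (if a < norm x \<and> v (norm x) < u x then v (norm x) powr p * gap x else 0)"

definition cutoff_error :: "real \<Rightarrow> 'a \<Rightarrow> real" where
  "cutoff_error R x = (if R \<le> norm x \<and> norm x \<le> 2 * R
    then (4 + 4 * \<gamma> powr (p - 1)) * (norm (g x) powr p + \<bar>u x\<bar> powr p * R powr (- p)) else 0)"

lemma weighted_gap_borel [measurable]: "weighted_gap \<in> borel_measurable borel"
  unfolding weighted_gap_def[abs_def] gap_def[abs_def] Let_def by measurable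

lemma cutoff_error_borel [measurable]: "cutoff_error R \<in> borel_measurable borel"
  unfolding cutoff_error_def[abs_def] by measurable

lemma cutoff_error_nonneg: "0 \<le> cutoff_error R x"
  by (simp add: cutoff_error_def)

lemma quot_grad_eq:
  "quot_grad v v' x = (1 / v (norm x)) *\<^sub>R g x
    - (u x / v (norm x)) *\<^sub>R ((v' (norm x) / (v (norm x) * norm x)) *\<^sub>R x)"
  by (simp add: quot_grad_def scaleR_diff_right)

lemma gap_bracket:
  assumes "a < norm x" "v (norm x) < u x"
  shows "0 \<le> gap x" and "gap x = 0 \<Longrightarrow> quot_grad v v' x = 0"
proof -
  have t: "1 < u x / v (norm x)"
    using assms v(1)[of "norm x"] by simp
  show "0 \<le> gap x" "gap x = 0 \<Longrightarrow> quot_grad v v' x = 0"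
    using picone_bracket[OF p t, of "(1 / v (norm x)) *\<^sub>R g x" "(v' (norm x) / (v (norm x) * norm x)) *\<^sub>R x"]
    by (auto simp: gap_def Let_def quot_grad_eq)
qed

lemma weighted_gap_nonneg: "0 \<le> weighted_gap x"
  using gap_bracket(1)[of x] by (simp add: weighted_gap_def)

text \<open>After |eta'| <= 4 / R, Young's inequality is applied to |g|^(p-1) and u / R. In the
  barrier's contribution |x| > R turns (\<gamma> / |x|)^(p-1) into the missing powers of R.\<close>

lemma error_bound:
  assumes R: "a \<le> R" and x: "a < norm x" and u: "0 < u x"
  shows "\<bar>cutoff' R (norm x)\<bar> * (u x * norm (g x) powr (p - 1) + u x powr p * (\<gamma> / norm x) powr (p - 1)) \<le> cutoff_error R x"
proof (cases "R < norm x \<and> norm x < 2 * R")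
  case False
  have "0 < R" using R a by simp
  then have "cutoff' R (norm x) = 0"
    using False cutoff_eq_0(2)[of R "norm x"] cutoff'_eq_0[of R "norm x"] by (auto simp: not_less)
  then show ?thesis using cutoff_error_nonneg by simp
next
  case True
  let ?r = "norm x" and ?g = "norm (g x)"
  have R0: "0 < R" using R a by simp
  have \<gamma>: "0 < \<gamma>" using y[of ?r] x by (auto intro: less_le_trans)
  have 1: "(4 / R) * (u x * ?g powr (p - 1)) \<le> 4 * (?g powr p + u x powr p * R powr (- p))"
  proof -
    have "?g powr (p - 1) * (u x / R) \<le> ?g powr p + (u x / R) powr p"
      using powr_mult_le_sum[OF p, of ?g "u x / R"] u R0 by simp
    also have "(u x / R) powr p = u x powr p * R powr (- p)"
      using u R0 by (simp add: powr_divide powr_minus_divide)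
    finally have "4 * (?g powr (p - 1) * (u x / R)) \<le> 4 * (?g powr p + u x powr p * R powr (- p))"
      by (rule mult_left_mono) simp
    then show ?thesis by (simp add: mult.commute mult.left_commute)
  qed
  have 2: "(4 / R) * (u x powr p * (\<gamma> / ?r) powr (p - 1)) \<le> 4 * \<gamma> powr (p - 1) * (u x powr p * R powr (- p))"
  proof -
    have "(\<gamma> / ?r) powr (p - 1) \<le> (\<gamma> / R) powr (p - 1)"
    proof (intro powr_mono2 divide_left_mono)
      show "0 < ?r * R" using True R0 by (intro mult_pos_pos) linarith+
    qed (use True R0 \<gamma> p in auto)
    also have "\<dots> = \<gamma> powr (p - 1) * (R * R powr (- p))"
      using \<gamma> R0 powr_mult_base[of R "- p"] powr_minus_divide[of R "p - 1"] by (simp add: powr_divide)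
    finally have "(4 / R) * (u x powr p * (\<gamma> / ?r) powr (p - 1))
        \<le> (4 / R) * (u x powr p * (\<gamma> powr (p - 1) * (R * R powr (- p))))"
      using R0 by (intro mult_left_mono) auto
    also have "\<dots> = 4 * \<gamma> powr (p - 1) * (u x powr p * R powr (- p))" using R0 by simp
    finally show ?thesis .
  qed
  have "\<bar>cutoff' R ?r\<bar> * (u x * ?g powr (p - 1) + u x powr p * (\<gamma> / ?r) powr (p - 1))
      \<le> (4 / R) * (u x * ?g powr (p - 1) + u x powr p * (\<gamma> / ?r) powr (p - 1))"
    using abs_cutoff'_le[OF R0] u by (intro mult_right_mono) auto
  also have "\<dots> \<le> 4 * (?g powr p + u x powr p * R powr (- p)) + 4 * \<gamma> powr (p - 1) * (u x powr p * R powr (- p))"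
    using 1 2 by (simp add: distrib_left)
  also have "\<dots> \<le> cutoff_error R x"
    using True u by (simp add: cutoff_error_def algebra_simps)
  finally show ?thesis .
qed

text \<open>Where u exceeds v the two integrands add up to three groups: eta v^p times the Picone
  bracket, the terms with eta', which \<open>cutoff_error\<close> bounds, and zeroth order terms,
  which are nonnegative. Elsewhere the test profiles vanish.\<close>

lemma pointwise_lower:
  assumes R: "a \<le> R" and fx: "a < norm x \<Longrightarrow> f x \<le> A * norm x powr (- \<alpha>)"
  shows "cutoff R (norm x) * weighted_gap x - cutoff_error R x \<le> subsol_integrand R x + supersol_integrand R x"
proof (cases "a < norm x \<and> v (norm x) < u x")
  case False
  have "subsol_integrand R x = 0 \<and> supersol_integrand R x = 0"
  proof (cases "a < norm x")
    case True
    then have "u x / v (norm x) \<le> 1" using False v(1)[of "norm x"] by simp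
    then show ?thesis
      by (simp add: subsol_integrand_def supersol_integrand_def chain_integrand_def excess_eq_0 excess'_eq_0 powr_excess_eq_0)
  qed (simp add: subsol_integrand_def supersol_integrand_def chain_integrand_def)
  moreover have "weighted_gap x = 0" unfolding weighted_gap_def by (rule if_not_P[OF False])
  ultimately show ?thesis using cutoff_error_nonneg[of R x] by simp
next
  case True
  define r t \<eta> \<eta>' V where "r = norm x" and "t = u x / v r" and "\<eta> = cutoff R r"
    and "\<eta>' = cutoff' R r" and "V = v r powr (p - 1)"
  have r: "a < r" "0 < r" using True a by (auto simp: r_def)
  have vp: "0 < v r" using v(1) r by simp
  have yr: "0 < y r" "y r \<le> \<gamma>" using y r by auto
  have ut: "u x = t * v r" and t1: "1 < t" and u0: "0 < u x"
    using True vp by (auto simp: t_def r_def)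
  \<comment> \<open>Dividing both gradients by v lets the homogeneity of the flux pull out the
    common factor V = v^(p-1).\<close>
  define va vb where "va = (1 / v r) *\<^sub>R g x" and "vb = (v' r / (v r * r)) *\<^sub>R x"
  have ga: "g x = v r *\<^sub>R va" using vp by (simp add: va_def)
  have fg: "flux p (g x) = V *\<^sub>R flux p va" unfolding ga V_def by (rule flux_scaleR[OF vp])
  have nb: "norm vb = y r / r"
    using r vp yr by (simp add: vb_def v'_eq abs_mult flip: r_def)
  have vbx: "vb = - ((y r / r\<^sup>2) *\<^sub>R x)"
    using r vp by (simp add: vb_def v'_eq power2_eq_square)
  \<comment> \<open>The gradient of v points towards the origin, hence the minus sign between the
    field h(|x|) x and the flux of v.\<close>
  have hx: "h r *\<^sub>R x = - (V *\<^sub>R flux p vb)"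
  proof -
    have "(y r / r) powr (p - 2) * (y r / r\<^sup>2) = (y r / r) powr (p - 1) / r"
      using powr_minus_one_mult[of "y r / r" "p - 1"] yr r by (simp add: diff_diff_eq power2_eq_square flip: divide_divide_eq_left)
    also have "\<dots> = y r powr (p - 1) * r powr (- p)"
      using yr r powr_minus_one_mult[of r p] by (simp add: powr_divide powr_minus_divide)
    finally have "V * ((y r / r) powr (p - 2) * (y r / r\<^sup>2)) = h r"
      using yr vp r by (simp add: V_def h_eq powr_mult)
    moreover have "V *\<^sub>R flux p vb = - ((V * ((y r / r) powr (p - 2) * (y r / r\<^sup>2))) *\<^sub>R x)"
      unfolding flux_def nb unfolding vbx by simp
    ultimately show ?thesis by simp
  qed
  define D where "D = va - t *\<^sub>R vb"
  have qg: "quot_grad v v' x = D"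
    unfolding quot_grad_eq D_def va_def vb_def t_def r_def ..
  have Zx: "gap x = excess' t * (flux p va \<bullet> D) + excess t * (flux p va \<bullet> vb) - powr_excess' p t * (flux p vb \<bullet> D) - powr_excess p t * (flux p vb \<bullet> vb)"
    unfolding gap_def Let_def D_def va_def vb_def t_def r_def ..
  have z: "(\<zeta>' R r / r) *\<^sub>R x = (v r * \<eta>) *\<^sub>R vb + (v r * \<eta>' / r) *\<^sub>R x"
    using vp r by (simp add: \<zeta>'_def vb_def \<eta>_def \<eta>'_def add_divide_distrib scaleR_add_left)
  have ze: "\<zeta> R r = v r * \<eta>" by (simp add: \<zeta>_def \<eta>_def)
  have subsol_integrand: "subsol_integrand R x = V * v r * \<eta> * (excess' t * (flux p va \<bullet> D) + excess t * (flux p va \<bullet> vb))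
      + V * v r * \<eta>' / r * (excess t * (flux p va \<bullet> x)) + v r * \<eta> * (q x * excess t)"
  proof -
    have "subsol_integrand R x = flux p (g x) \<bullet> ((\<zeta> R r * excess' t) *\<^sub>R D + excess t *\<^sub>R ((\<zeta>' R r / r) *\<^sub>R x)) + q x * (excess t * \<zeta> R r)"
      using True by (simp add: subsol_integrand_def chain_integrand_def qg flip: r_def t_def)
    then show ?thesis unfolding fg z ze by (simp add: inner_add_right algebra_simps)
  qed
  have supersol_integrand: "supersol_integrand R x = - (V * v r * \<eta> * (powr_excess' p t * (flux p vb \<bullet> D) + powr_excess p t * (flux p vb \<bullet> vb)))
      - V * v r * \<eta>' / r * (powr_excess p t * (flux p vb \<bullet> x)) + v r * \<eta> * (powr_excess p t * (r * h' r + N * h r))"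
  proof -
    have "x \<bullet> ((powr_excess p t * (h' r * \<zeta> R r + h r * \<zeta>' R r) / r) *\<^sub>R x)
        = powr_excess p t * (h' r * \<zeta> R r) * r + powr_excess p t * ((h r *\<^sub>R x) \<bullet> ((\<zeta>' R r / r) *\<^sub>R x))"
      using r by (simp add: dot_square_norm power2_eq_square field_simps flip: r_def)
    then have "supersol_integrand R x = \<zeta> R r * powr_excess' p t * ((h r *\<^sub>R x) \<bullet> D) + powr_excess p t * (h' r * \<zeta> R r) * r
        + powr_excess p t * ((h r *\<^sub>R x) \<bullet> ((\<zeta>' R r / r) *\<^sub>R x)) + N * (powr_excess p t * (h r * \<zeta> R r))"
      using True by (simp add: supersol_integrand_def chain_integrand_def qg inner_add_right flip: r_def t_def)
    then show ?thesis unfolding hx z ze by (simp add: inner_add_right algebra_simps)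
  qed
  have Vv: "V * v r = v r powr p" unfolding V_def using vp by (intro powr_minus_one_mult) simp
  have sum: "subsol_integrand R x + supersol_integrand R x = \<eta> * (v r powr p * gap x)
      + v r powr p * \<eta>' / r * (excess t * (flux p va \<bullet> x) - powr_excess p t * (flux p vb \<bullet> x))
      + v r * \<eta> * (powr_excess p t * (r * h' r + N * h r) + q x * excess t)"
    unfolding subsol_integrand supersol_integrand Zx Vv[symmetric] using r by (simp add: field_simps)
  have pt: "powr_excess p t = t powr (p - 1) * excess t" using t1 by (simp add: powr_excess_def max_def)
  \<comment> \<open>The test functions are matched so that u^(p-1) t H(t) = v^(p-1) t^p H(t): both
    zeroth order terms share the nonnegative factor \<open>powr_excess p t\<close>, and the upper
    bound on f meets the supersolution inequality.\<close>
  have 3: "0 \<le> v r * \<eta> * (powr_excess p t * (r * h' r + N * h r) + q x * excess t)"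
  proof -
    have "\<bar>u x\<bar> powr (p - 2) * u x = u x powr (p - 1)"
      using powr_minus_one_mult[of "u x" "p - 1"] u0 by (simp add: diff_diff_eq)
    also have "\<dots> = t powr (p - 1) * V" unfolding ut V_def using t1 vp by (simp add: powr_mult)
    finally have "q x * excess t = - ((\<mu> * r powr (- p) + f x) * V * powr_excess p t)"
      by (simp add: q_def pt mult_ac flip: r_def)
    then have "powr_excess p t * (r * h' r + N * h r) + q x * excess t
        = powr_excess p t * (r * h' r + N * h r - V * (\<mu> * r powr (- p) + f x))"
      by (simp add: algebra_simps)
    also have "\<dots> \<ge> 0"
    proof (intro mult_nonneg_nonneg powr_excess_nonneg)
      have "V * (\<mu> * r powr (- p) + f x) \<le> V * (\<mu> * r powr (- p) + A * r powr (- \<alpha>))"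
        using fx r \<mu> by (intro mult_left_mono add_mono) (auto simp: r_def V_def)
      then show "0 \<le> r * h' r + N * h r - V * (\<mu> * r powr (- p) + f x)"
        using supersol[of r] r by (simp add: V_def)
    qed
    finally show ?thesis using vp cutoff_bounds(1)[of R r] by (simp add: \<eta>_def)
  qed
  have "\<bar>v r powr p * \<eta>' / r * (excess t * (flux p va \<bullet> x) - powr_excess p t * (flux p vb \<bullet> x))\<bar>
      \<le> \<bar>\<eta>'\<bar> * (u x * norm (g x) powr (p - 1) + u x powr p * (\<gamma> / r) powr (p - 1))"
  proof -
    have b1: "\<bar>excess t * (flux p va \<bullet> x)\<bar> \<le> t * (norm va powr (p - 1) * r)"
    proof -
      have "\<bar>flux p va \<bullet> x\<bar> \<le> norm va powr (p - 1) * r"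
        using Cauchy_Schwarz_ineq2[of "flux p va" x] by (simp add: norm_flux r_def)
      then show ?thesis
        using excess_le[of t] excess_nonneg[of t] t1 unfolding abs_mult by (intro mult_mono) auto
    qed
    have b2: "\<bar>powr_excess p t * (flux p vb \<bullet> x)\<bar> \<le> t powr p * ((\<gamma> / r) powr (p - 1) * r)"
    proof -
      have "\<bar>flux p vb \<bullet> x\<bar> \<le> (y r / r) powr (p - 1) * r"
        using Cauchy_Schwarz_ineq2[of "flux p vb" x] by (simp add: norm_flux nb r_def)
      also have "\<dots> \<le> (\<gamma> / r) powr (p - 1) * r"
        using yr r p by (intro mult_right_mono powr_mono2 divide_right_mono) auto
      finally show ?thesis
        using powr_excess_le[of t p] powr_excess_nonneg[of p t] t1 unfolding abs_mult by (intro mult_mono) auto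
    qed
    have "\<bar>v r powr p * \<eta>' / r * (excess t * (flux p va \<bullet> x) - powr_excess p t * (flux p vb \<bullet> x))\<bar>
        = v r powr p * \<bar>\<eta>'\<bar> / r * \<bar>excess t * (flux p va \<bullet> x) - powr_excess p t * (flux p vb \<bullet> x)\<bar>"
      using r by (simp add: abs_mult)
    also have "\<dots> \<le> v r powr p * \<bar>\<eta>'\<bar> / r * (t * (norm va powr (p - 1) * r) + t powr p * ((\<gamma> / r) powr (p - 1) * r))"
      using b1 b2 r by (intro mult_left_mono) auto
    also have "\<dots> = \<bar>\<eta>'\<bar> * (v r powr p * t * norm va powr (p - 1) + (v r powr p * t powr p) * (\<gamma> / r) powr (p - 1))"
      using r by (simp add: field_simps)
    also have "v r powr p * t * norm va powr (p - 1) = u x * norm (g x) powr (p - 1)"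
      unfolding Vv[symmetric] using vp by (simp add: ga ut powr_mult V_def mult_ac)
    also have "v r powr p * t powr p = u x powr p"
      unfolding ut using vp t1 by (simp add: powr_mult mult.commute)
    finally show ?thesis .
  qed
  also have "\<dots> \<le> cutoff_error R x"
    using error_bound[OF R, of x] True u0 by (simp add: \<eta>'_def r_def)
  finally have 4: "\<bar>v r powr p * \<eta>' / r * (excess t * (flux p va \<bullet> x) - powr_excess p t * (flux p vb \<bullet> x))\<bar> \<le> cutoff_error R x" .
  have Wx: "weighted_gap x = v r powr p * gap x" using True by (simp add: weighted_gap_def r_def)
  show ?thesis
    unfolding Wx r_def[symmetric] \<eta>_def[symmetric] using 3 abs_le_D2[OF 4] sum by linarith
qed

text \<open>The term |u|^p R^(-p) is split by the critical Young inequality with a weight l. The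
  part with R^(-N) integrates over the ball of radius 2 R to a multiple of l^(N/p) that is the same
  for every R, and l makes it small. The rest is a tail of an integrable function and is small for
  large R.\<close>

lemma cutoff_error_small:
  assumes "0 < \<epsilon>"
  shows "\<exists>n0. \<forall>n\<ge>n0. integrable lborel (cutoff_error (real n)) \<and> integral\<^sup>L lborel (cutoff_error (real n)) \<le> \<epsilon>"
proof -
  define C where "C = 4 + 4 * \<gamma> powr (p - 1)"
  have C: "0 < C" by (simp add: C_def add_pos_nonneg)
  \<comment> \<open>R^(-N) times the volume of the ball of radius 2 R.\<close>
  define \<kappa> where "\<kappa> = unit_ball_vol N * 2 ^ DIM('a)"
  have \<kappa>: "0 < \<kappa>" using N by (simp add: \<kappa>_def)
  \<comment> \<open>Chosen so that the part independent of R contributes \<epsilon>/2.\<close>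
  define l where "l = (\<epsilon> / (2 * C * \<kappa>)) powr (p / N)"
  have l: "0 < l" "l powr (N / p) = \<epsilon> / (2 * C * \<kappa>)"
    using assms C \<kappa> p N_pos by (auto simp: l_def powr_powr)
  define H where "H x = norm (g x) powr p + l powr (- (N / (N - p))) * \<bar>u x\<bar> powr s" for x
  have H: "integrable lborel H" "0 \<le> H x" for x
    using g_int u_int by (auto simp: H_def[abs_def])
  have [measurable]: "H \<in> borel_measurable borel" using H(1) by auto
  have cutoff_error_le: "cutoff_error R x \<le> C * (indicator {x. R \<le> norm x} x * H x
      + l powr (N / p) * R powr (- N) * indicator (cball 0 (2 * R)) x)" if R: "0 < R" for R x
  proof (cases "R \<le> norm x \<and> norm x \<le> 2 * R")
    case True
    have "(l * R powr (- p)) * (\<bar>u x\<bar> powr p / l)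
        \<le> (l * R powr (- p)) powr (N / p) + (\<bar>u x\<bar> powr p / l) powr (N / (N - p))"
      using l p p_less by (intro young_critical) auto
    also have "(l * R powr (- p)) powr (N / p) = l powr (N / p) * R powr (- N)"
      using l p by (simp add: powr_mult powr_powr)
    also have "(\<bar>u x\<bar> powr p / l) powr (N / (N - p)) = l powr (- (N / (N - p))) * \<bar>u x\<bar> powr s"
      using l by (simp add: powr_divide powr_powr s_eq powr_minus_divide mult.commute)
    finally have "\<bar>u x\<bar> powr p * R powr (- p)
        \<le> l powr (N / p) * R powr (- N) + l powr (- (N / (N - p))) * \<bar>u x\<bar> powr s"
      using l by (simp add: mult.commute)
    then have "C * (norm (g x) powr p + \<bar>u x\<bar> powr p * R powr (- p))
        \<le> C * (H x + l powr (N / p) * R powr (- N))"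
      using C by (intro mult_left_mono) (auto simp: H_def)
    then show ?thesis using True by (simp add: cutoff_error_def C_def)
  next
    case False
    have "0 \<le> C * (indicator {x. R \<le> norm x} x * H x + l powr (N / p) * R powr (- N) * indicator (cball 0 (2 * R)) x)"
      using C H(2) by simp
    moreover have "cutoff_error R x = 0" unfolding cutoff_error_def by (rule if_not_P[OF False])
    ultimately show ?thesis by simp
  qed
  have Hi: "integrable lborel (\<lambda>x. indicator {x. R \<le> norm x} x * H x)" for R
    by (rule Bochner_Integration.integrable_bound[OF H(1)]) (auto simp: indicator_def)
  have Ei: "integrable lborel (cutoff_error R)"
    and Eb: "integral\<^sup>L lborel (cutoff_error R) \<le> C * (\<integral>x. indicator {x. R \<le> norm x} x * H x \<partial>lborel) + \<epsilon> / 2"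
    if R: "0 < R" for R
  proof -
    let ?b = "\<lambda>x. C * (indicator {x. R \<le> norm x} x * H x
      + l powr (N / p) * R powr (- N) * indicator (cball (0::'a) (2 * R)) x)"
    have ci: "integrable lborel (\<lambda>x::'a. l powr (N / p) * R powr (- N) * indicator (cball 0 (2 * R)) x)"
      by (rule integrable_const_cball)
    have bi: "integrable lborel ?b"
      by (intro integrable_mult_right Bochner_Integration.integrable_add Hi ci)
    show Ei: "integrable lborel (cutoff_error R)"
    proof (rule Bochner_Integration.integrable_bound[OF bi])
      show "AE x in lborel. norm (cutoff_error R x) \<le> norm (?b x)"
        using cutoff_error_le[OF R] cutoff_error_nonneg[of R] by (intro AE_I2) (smt (verit) real_norm_def)
    qed simp
    have "integral\<^sup>L lborel (cutoff_error R) \<le> integral\<^sup>L lborel ?b"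
      by (rule integral_mono[OF Ei bi]) (rule cutoff_error_le[OF R])
    also have "\<dots> = C * ((\<integral>x. indicator {x. R \<le> norm x} x * H x \<partial>lborel)
        + l powr (N / p) * R powr (- N) * measure lborel (cball (0::'a) (2 * R)))"
      using Hi[of R] ci by simp
    also have "R powr (- N) * measure lborel (cball (0::'a) (2 * R)) = \<kappa>"
      using content_cball[of "2 * R" "0::'a"] R
      by (simp add: \<kappa>_def N power_mult_distrib powr_minus_divide powr_realpow)
    then have "l powr (N / p) * R powr (- N) * measure lborel (cball (0::'a) (2 * R)) = \<epsilon> / (2 * C)"
      using l(2) \<kappa> by (simp add: mult.assoc)
    finally show "integral\<^sup>L lborel (cutoff_error R) \<le> C * (\<integral>x. indicator {x. R \<le> norm x} x * H x \<partial>lborel) + \<epsilon> / 2"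
      using C by (simp add: distrib_left)
  qed
  have "(\<lambda>n. \<integral>x. indicator {x. real n \<le> norm x} x * H x \<partial>lborel) \<longlonglongrightarrow> integral\<^sup>L lborel (\<lambda>x::'a. 0)"
  proof (rule integral_dominated_convergence[where w = H])
    show "AE x in lborel. (\<lambda>n. indicator {x. real n \<le> norm x} x * H x) \<longlonglongrightarrow> 0"
    proof (rule AE_I2)
      fix x :: 'a
      obtain m :: nat where "norm x < real m" using reals_Archimedean2 by blast
      then have "\<forall>\<^sub>F n in sequentially. indicator {x. real n \<le> norm x} x * H x = 0"
        by (intro eventually_mono[OF eventually_ge_at_top[of m]])
          (use \<open>norm x < real m\<close> in \<open>auto simp: indicator_def\<close>)
      then show "(\<lambda>n. indicator {x. real n \<le> norm x} x * H x) \<longlonglongrightarrow> 0" by (rule tendsto_eventually)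
    qed
    show "AE x in lborel. norm (indicator {x. real n \<le> norm x} x * H x) \<le> H x" for n
      using H(2) by (intro AE_I2) (auto simp: indicator_def)
  qed (use H(1) in auto)
  then have "\<forall>\<^sub>F n in sequentially. (\<integral>x. indicator {x. real n \<le> norm x} x * H x \<partial>lborel) < \<epsilon> / (2 * C)"
    using assms C by (intro order_tendstoD(2)) auto
  then obtain n1 where n1: "\<And>n. n1 \<le> n \<Longrightarrow> (\<integral>x. indicator {x. real n \<le> norm x} x * H x \<partial>lborel) < \<epsilon> / (2 * C)"
    by (auto simp: eventually_sequentially)
  show ?thesis
  proof (intro exI[of _ "max 1 n1"] allI impI conjI)
    fix n assume n: "max 1 n1 \<le> n"
    then have "0 < real n" by simp
    then show "integrable lborel (cutoff_error (real n))" by (rule Ei)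
    have "C * (\<integral>x. indicator {x. real n \<le> norm x} x * H x \<partial>lborel) \<le> C * (\<epsilon> / (2 * C))"
      using n1[of n] n C by (intro mult_left_mono) auto
    also have "\<dots> = \<epsilon> / 2" using C by simp
    finally show "integral\<^sup>L lborel (cutoff_error (real n)) \<le> \<epsilon>" using Eb[OF \<open>0 < real n\<close>] by linarith
  qed
qed

text \<open>Both tested integrals are at most 0, so integrating the pointwise bound leaves the
  cutoff error, which can be made arbitrarily small. Restricting to the ball of radius m, where the
  cutoff is 1 once R is at least m, gives a quantity that does not change with R.\<close>

lemma weighted_gap_eq_0: "AE x in lborel. weighted_gap x = 0"
proof -
  have *: "AE x in lborel. norm x \<le> real m \<longrightarrow> weighted_gap x = 0" for m
  proof -
    let ?w = "\<lambda>x. indicator (cball 0 (real m)) x * weighted_gap x"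
    have w_le: "AE x in lborel. ?w x \<le> subsol_integrand R x + supersol_integrand R x + cutoff_error R x" if R: "a \<le> R" "real m \<le> R" for R
      using f_le
    proof eventually_elim
      case (elim x)
      have "?w x \<le> cutoff R (norm x) * weighted_gap x"
        using cutoff_eq_1[of R "norm x"] cutoff_bounds(1)[of R "norm x"] R a weighted_gap_nonneg[of x]
        by (cases "norm x \<le> real m") (auto simp: indicator_def)
      with pointwise_lower[OF R(1), of x] elim show ?case by simp
    qed
    have wnn: "0 \<le> ?w x" for x using weighted_gap_nonneg by simp
    have wm: "?w \<in> borel_measurable lborel"
    proof -
      have [measurable]: "cball (0::'a) (real m) \<in> sets borel" by simp
      show ?thesis by measurable
    qed
    \<comment> \<open>Integrability of \<open>?w\<close> is itself a consequence of the pointwise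
      bound: it is nonnegative and lies below an integrable function.\<close>
    have w_int: "integrable lborel ?w \<and> integral\<^sup>L lborel ?w \<le> \<epsilon>" if "0 < \<epsilon>" for \<epsilon>
    proof -
      obtain n0 where n0: "\<And>n. n0 \<le> n \<Longrightarrow> integrable lborel (cutoff_error (real n)) \<and> integral\<^sup>L lborel (cutoff_error (real n)) \<le> \<epsilon>"
        using cutoff_error_small[OF \<open>0 < \<epsilon>\<close>] by blast
      define n where "n = max (max n0 m) (nat \<lceil>a\<rceil>)"
      have n: "a \<le> real n" "real m \<le> real n" "n0 \<le> n"
        using real_nat_ceiling_ge[of a] by (auto simp: n_def)
      have n': "0 < real n" using n a by simp
      have i: "integrable lborel (\<lambda>x. subsol_integrand (real n) x + supersol_integrand (real n) x + cutoff_error (real n) x)"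
        using subsol_integrand(1)[OF n'] supersol_integrand(1)[OF n'] n0[OF n(3)] by simp
      have wi: "integrable lborel ?w"
      proof (rule Bochner_Integration.integrable_bound[OF i wm])
        show "AE x in lborel. norm (?w x) \<le> norm (subsol_integrand (real n) x + supersol_integrand (real n) x + cutoff_error (real n) x)"
          using w_le[OF n(1,2)] by eventually_elim (use wnn in auto)
      qed
      have "integral\<^sup>L lborel ?w \<le> (\<integral>x. subsol_integrand (real n) x + supersol_integrand (real n) x + cutoff_error (real n) x \<partial>lborel)"
        by (rule integral_mono_AE[OF wi i w_le[OF n(1,2)]])
      also have "\<dots> \<le> \<epsilon>"
        using subsol_integrand[OF n'] supersol_integrand[OF n'] n0[OF n(3)] by simp
      finally show ?thesis using wi by simp
    qed
    have "integral\<^sup>L lborel ?w \<le> 0" by (rule dense_ge) (use w_int in blast)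
    moreover have "0 \<le> integral\<^sup>L lborel ?w"
      by (rule Bochner_Integration.integral_nonneg) (rule wnn)
    ultimately have "integral\<^sup>L lborel ?w = 0" by (rule order.antisym)
    then have "AE x in lborel. ?w x = 0"
      using integral_nonneg_eq_0_iff_AE[of lborel ?w] w_int[of 1] wnn by simp
    then show ?thesis by eventually_elim (auto simp: indicator_def)
  qed
  have "AE x in lborel. \<forall>m::nat. norm x \<le> real m \<longrightarrow> weighted_gap x = 0"
    unfolding AE_all_countable using * by blast
  then show ?thesis
    by eventually_elim (use real_arch_simple in blast)
qed

text \<open>The gradient of t is 0 where t > 1, by the equality case of the Picone bracket. Testing
  the Euler identity with z(|x|) \<open>excess t\<close> therefore leaves \<open>excess t\<close>
  times a weight that is positive inside radius m, with integral at most 0; hence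
  \<open>excess t\<close> is 0 there.\<close>

lemma u_le_v: "AE x in lborel. a < norm x \<longrightarrow> u x \<le> v (norm x)"
proof -
  have *: "AE x in lborel. a < norm x \<and> norm x < real m \<longrightarrow> u x \<le> v (norm x)" for m
  proof -
    let ?L = "real m"
    \<comment> \<open>The factor r^(-N) cancels the term N z: r z' + N z = -4 r^2 r^(-N) max 0 (L^2
      - r^2) with L = m. The square makes z continuously differentiable at L.\<close>
    define z where "z r = r powr (- N) * (max 0 (?L\<^sup>2 - r\<^sup>2))\<^sup>2" for r
    define z' where "z' r = - N * r powr (- N - 1) * (max 0 (?L\<^sup>2 - r\<^sup>2))\<^sup>2
      + 2 * max 0 (?L\<^sup>2 - r\<^sup>2) * (- (2 * r)) * r powr (- N)" for r
    have zm: "z \<in> borel_measurable borel" "z' \<in> borel_measurable borel"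
      unfolding z_def[abs_def] z'_def[abs_def] by measurable
    have z0: "z r = 0" "z' r = 0" if "?L \<le> r" for r
    proof -
      have "?L\<^sup>2 \<le> r\<^sup>2" using that by (intro power_mono) auto
      then show "z r = 0" "z' r = 0" by (auto simp: z_def z'_def)
    qed
    have zd: "(z has_real_derivative z' r) (at r)" if "a \<le> r" for r
    proof -
      have r: "0 < r" using that a by simp
      have "((\<lambda>r. ?L\<^sup>2 - r\<^sup>2) has_real_derivative - (2 * r)) (at r)"
        by (auto intro!: derivative_eq_intros)
      from DERIV_chain2[OF DERIV_max0_square this]
      have d1: "((\<lambda>r. (max 0 (?L\<^sup>2 - r\<^sup>2))\<^sup>2) has_real_derivative 2 * max 0 (?L\<^sup>2 - r\<^sup>2) * (- (2 * r))) (at r)" .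
      have d2: "((\<lambda>r. r powr (- N)) has_real_derivative - N * r powr (- N - 1)) (at r)"
        using r by (auto intro!: derivative_eq_intros)
      show ?thesis
        unfolding z_def[abs_def] z'_def by (rule DERIV_mult[OF d2 d1])
    qed
    have zc: "continuous_on {a..} z'"
      unfolding z'_def[abs_def] using a by (intro continuous_intros) auto
    have znn: "0 \<le> z r" for r by (simp add: z_def)
    \<comment> \<open>The Euler identity is used with reversed sign, so that the remaining integrand
      is nonnegative.\<close>
    have J: "(\<integral>x. (- x) \<bullet> D x + (- N) * w x \<partial>lborel) \<le> 0"
      if "C1_grad w D" "\<And>x. R \<le> norm x \<Longrightarrow> w x = 0" for w :: "'a \<Rightarrow> real" and D R
    proof -
      have eq: "(- x) \<bullet> D x + (- N) * w x = - (N * w x + D x \<bullet> x)" for x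
        by (simp add: inner_commute)
      have "(\<integral>x. (- x) \<bullet> D x + (- N) * w x \<partial>lborel) = - (\<integral>x. N * w x + D x \<bullet> x \<partial>lborel)"
        unfolding eq by (rule Bochner_Integration.integral_minus)
      then show ?thesis using integral_euler_eq_0[OF that] by (simp add: N)
    qed
    obtain W0 :: "'a \<Rightarrow> real" and K where W0: "integrable lborel W0"
      "\<And>x \<tau> \<beta> d. a < norm x \<Longrightarrow> norm x \<le> ?L \<Longrightarrow> \<bar>\<tau>\<bar> powr s \<le> d \<Longrightarrow> 0 \<le> \<beta> \<Longrightarrow> \<beta> powr p \<le> d \<Longrightarrow>
        norm x * (\<bar>excess' (\<tau> / v (norm x))\<bar> * (\<beta> + \<bar>\<tau>\<bar>) + \<bar>excess (\<tau> / v (norm x))\<bar>)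
          + \<bar>N\<bar> * \<bar>excess (\<tau> / v (norm x))\<bar> \<le> W0 x + K * d"
      by (rule dom_radial[of ?L], rule that)
    have dom: "norm (- x) * (\<bar>excess' (\<tau> / v (norm x))\<bar> * (\<beta> + \<bar>\<tau>\<bar>) + \<bar>excess (\<tau> / v (norm x))\<bar>)
          + \<bar>- N\<bar> * \<bar>excess (\<tau> / v (norm x))\<bar> \<le> W0 x + K * d"
      if "a < norm x" "norm x \<le> ?L" "\<bar>\<tau>\<bar> powr s \<le> d" "0 \<le> \<beta>" "\<beta> powr p \<le> d" for x :: 'a and \<tau> \<beta> d
      using W0(2)[OF that] by simp
    let ?F = "chain_integrand uminus (\<lambda>_. - N) v v' z z' excess excess'"
    have m: "uminus \<in> borel_measurable (borel :: 'a measure)" "(\<lambda>_::'a. - N) \<in> borel_measurable borel"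
      by auto
    note test = chain_test[where P = uminus and q = "\<lambda>_. - N" and v = v and v' = v' and \<zeta> = z
        and \<zeta>' = z' and Q = excess and Q' = excess' and R = ?L and \<delta> = \<delta> and c = c and K = K,
        OF m J v_borel(1,2) zm v znn zd zc z0 excess_nonneg DERIV_excess continuous_on_excess' excess_eq_0 excess'_eq_0 near W0(1) dom]
    have Fi: "integrable lborel ?F" by (rule test(1); assumption)
    have Fle: "integral\<^sup>L lborel ?F \<le> 0" by (rule test(2); assumption)
    have F_eq: "AE x in lborel. a < norm x \<longrightarrow>
        ?F x = 4 * (norm x)\<^sup>2 * norm x powr (- N) * max 0 (?L\<^sup>2 - (norm x)\<^sup>2) * excess (u x / v (norm x))"
      using weighted_gap_eq_0
    proof (eventually_elim, intro impI)
      fix x assume w0: "weighted_gap x = 0" and x: "a < norm x"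
      let ?t = "u x / v (norm x)" and ?r = "norm x"
      have vp: "0 < v ?r" using v(1) x by simp
      have r: "0 < ?r" using x a by linarith
      have D: "excess' ?t *\<^sub>R quot_grad v v' x = 0"
      proof (cases "v ?r < u x")
        case True
        then have "gap x = 0" using w0 x vp by (simp add: weighted_gap_def)
        then show ?thesis using gap_bracket(2)[OF x True] by simp
      next
        case False
        then have "?t \<le> 1" using vp by simp
        then show ?thesis by (simp add: excess'_eq_0)
      qed
      have "(z ?r * excess' ?t) *\<^sub>R quot_grad v v' x = z ?r *\<^sub>R (excess' ?t *\<^sub>R quot_grad v v' x)" by simp
      also have "\<dots> = 0" unfolding D by simp
      finally have D0: "(z ?r * excess' ?t) *\<^sub>R quot_grad v v' x = 0" .
      have "?F x = (- x) \<bullet> ((z ?r * excess' ?t) *\<^sub>R quot_grad v v' x + (excess ?t * z' ?r / ?r) *\<^sub>R x)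
          + - N * (excess ?t * z ?r)"
        using x by (simp only: chain_integrand_def if_True)
      also have "\<dots> = - (excess ?t * (?r * z' ?r + N * z ?r))"
        unfolding D0 using r by (simp add: dot_square_norm power2_eq_square field_simps)
      also have "?r * z' ?r + N * z ?r = - (4 * ?r\<^sup>2 * ?r powr (- N) * max 0 (?L\<^sup>2 - ?r\<^sup>2))"
        using powr_mult_base[of ?r "- N - 1"] r
        by (simp add: z_def z'_def algebra_simps power2_eq_square)
      finally show "?F x = 4 * ?r\<^sup>2 * ?r powr (- N) * max 0 (?L\<^sup>2 - ?r\<^sup>2) * excess ?t"
        by (simp add: mult_ac)
    qed
    have Fnn: "AE x in lborel. 0 \<le> ?F x"
      using F_eq by eventually_elim (auto simp: chain_integrand_def[of _ _ _ _ _ _ _ _ "_"] excess_nonneg)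
    have "integral\<^sup>L lborel ?F = 0"
      using integral_nonneg_AE[OF Fnn] Fle by simp
    then have "AE x in lborel. ?F x = 0"
      using integral_nonneg_eq_0_iff_AE[OF Fi Fnn] by simp
    then show ?thesis
      using F_eq
    proof (eventually_elim, intro impI)
      fix x assume F: "?F x = 0" "a < norm x \<longrightarrow>
        ?F x = 4 * (norm x)\<^sup>2 * norm x powr (- N) * max 0 (?L\<^sup>2 - (norm x)\<^sup>2) * excess (u x / v (norm x))"
        and x: "a < norm x \<and> norm x < ?L"
      have r: "0 < norm x" using x a by linarith
      have "(norm x)\<^sup>2 < ?L\<^sup>2" using x by (intro power_strict_mono) auto
      then have "excess (u x / v (norm x)) = 0" using F x r by simp
      then have "\<not> 1 < u x / v (norm x)" using excess_pos[of "u x / v (norm x)"] by linarith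
      then show "u x \<le> v (norm x)" using v(1)[of "norm x"] x by simp
    qed
  qed
  have "AE x in lborel. \<forall>m::nat. a < norm x \<and> norm x < real m \<longrightarrow> u x \<le> v (norm x)"
    unfolding AE_all_countable using * by blast
  then show ?thesis
    by eventually_elim (use reals_Archimedean2 in blast)
qed

end

section \<open>Subsolutions in an exterior domain\<close>

lemma borel_representative:
  fixes w :: "'a::euclidean_space \<Rightarrow> 'b::euclidean_space"
  assumes \<Omega>: "\<Omega> \<in> sets lebesgue" and w: "w \<in> borel_measurable (lebesgue_on \<Omega>)"
  obtains w0 where "w0 \<in> borel_measurable borel" "AE x in lborel. x \<in> \<Omega> \<longrightarrow> w0 x = w x"
proof -
  let ?w = "\<lambda>x. if x \<in> \<Omega> then w x else 0"
  have w': "?w \<in> borel_measurable lebesgue"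
    using w \<Omega> by (simp add: borel_measurable_if)
  have "\<forall>i. \<exists>k\<in>borel_measurable lborel. AE x in lborel. ?w x \<bullet> i = k x"
  proof
    fix i :: 'b
    have "(\<lambda>x. ?w x \<bullet> i) \<in> borel_measurable lebesgue" using w' by (rule borel_measurable_inner) simp
    then show "\<exists>k\<in>borel_measurable lborel. AE x in lborel. ?w x \<bullet> i = k x"
      by (rule completion_ex_borel_measurable_real)
  qed
  then obtain k where k: "\<And>i. k i \<in> borel_measurable lborel" "\<And>i. AE x in lborel. ?w x \<bullet> i = k i x"
    by metis
  have [measurable]: "k i \<in> borel_measurable borel" for i using k(1) by simp
  show thesis
  proof (rule that[of "\<lambda>x. \<Sum>i\<in>Basis. k i x *\<^sub>R i"])
    show "(\<lambda>x. \<Sum>i\<in>Basis. k i x *\<^sub>R i) \<in> borel_measurable borel" by measurable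
    have "AE x in lborel. \<forall>i\<in>Basis. ?w x \<bullet> i = k i x"
      using k(2) by (intro AE_finite_allI) auto
    then show "AE x in lborel. x \<in> \<Omega> \<longrightarrow> (\<Sum>i\<in>Basis. k i x *\<^sub>R i) = w x"
    proof (eventually_elim, intro impI)
      fix x assume k: "\<forall>i\<in>Basis. ?w x \<bullet> i = k i x" and x: "x \<in> \<Omega>"
      have "(\<Sum>i\<in>Basis. k i x *\<^sub>R i) = (\<Sum>i\<in>Basis. (w x \<bullet> i) *\<^sub>R i)"
        using k x by (intro sum.cong) auto
      then show "(\<Sum>i\<in>Basis. k i x *\<^sub>R i) = w x" by (simp add: euclidean_representation)
    qed
  qed
qed

text \<open>Bridges the integrals over \<open>lebesgue_on \<Omega>\<close> in the hypotheses and
  those over \<open>lborel\<close> in the comparison, where compositions are handled by Borel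
  measurability.\<close>

lemma lebesgue_on_lborel_transfer:
  fixes F F1 :: "'a::euclidean_space \<Rightarrow> real"
  assumes \<Omega>: "\<Omega> \<in> sets lebesgue" and F: "F \<in> borel_measurable (lebesgue_on \<Omega>)"
    and F1: "F1 \<in> borel_measurable borel"
    and eq: "AE x in lborel. F1 x = (if x \<in> \<Omega> then F x else 0)"
  shows "integrable (lebesgue_on \<Omega>) F \<longleftrightarrow> integrable lborel F1"
    and "integral\<^sup>L (lebesgue_on \<Omega>) F = integral\<^sup>L lborel F1"
proof -
  let ?F = "\<lambda>x. indicator \<Omega> x *\<^sub>R F x"
  have e: "?F = (\<lambda>x. if x \<in> \<Omega> then F x else 0)" by (auto simp: indicator_def)
  have F': "?F \<in> borel_measurable lebesgue"
    unfolding e using F \<Omega> by (simp add: borel_measurable_if)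
  have F1': "F1 \<in> borel_measurable lebesgue" "F1 \<in> borel_measurable lborel"
    using F1 by (auto intro: measurable_completion)
  have AE: "AE x in lebesgue. ?F x = F1 x"
    using eq unfolding AE_completion_iff by eventually_elim (auto simp: indicator_def)
  have "integrable (lebesgue_on \<Omega>) F \<longleftrightarrow> integrable lebesgue ?F"
    using \<Omega> by (intro integrable_restrict_space) auto
  also have "\<dots> \<longleftrightarrow> integrable lebesgue F1"
    by (rule integrable_cong_AE[OF F' F1'(1) AE])
  also have "\<dots> \<longleftrightarrow> integrable lborel F1" by (rule integrable_completion[OF F1'(2)])
  finally show "integrable (lebesgue_on \<Omega>) F \<longleftrightarrow> integrable lborel F1" .
  have "integral\<^sup>L (lebesgue_on \<Omega>) F = integral\<^sup>L lebesgue ?F"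
    using \<Omega> by (intro integral_restrict_space) auto
  also have "\<dots> = integral\<^sup>L lebesgue F1"
    by (rule integral_cong_AE[OF F' F1'(1) AE])
  also have "\<dots> = integral\<^sup>L lborel F1" by (rule integral_completion[OF F1'(2)])
  finally show "integral\<^sup>L (lebesgue_on \<Omega>) F = integral\<^sup>L lborel F1" .
qed

text \<open>A point outside S lies in the open complement of the support, where the function is
  locally 0 and so are its derivatives; boundary points are included because the closed support is a
  subset of S.\<close>

lemma test_functionsD:
  assumes "\<phi> \<in> test_functions S"
  shows "C_diff k \<phi>" "C1_grad \<phi> (grad \<phi>)" "x \<notin> S \<Longrightarrow> \<phi> x = 0"
    "x \<notin> S \<Longrightarrow> grad \<phi> x = 0" "x \<notin> S \<Longrightarrow> frechet_derivative \<phi> (at x) i = 0"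
    "\<exists>R. \<forall>x. R \<le> norm x \<longrightarrow> \<phi> x = 0"
proof -
  show C: "C_diff k \<phi>" for k using assms by (simp add: test_functions_def)
  show C1: "C1_grad \<phi> (grad \<phi>)" by (rule C1_grad_grad[OF C])
  have sub: "closure {x. \<phi> x \<noteq> 0} \<subseteq> S" "compact (closure {x. \<phi> x \<noteq> 0})"
    using assms by (auto simp: test_functions_def)
  have out: "\<phi> x = 0" if "x \<notin> closure {x. \<phi> x \<noteq> 0}" for x
    using that closure_subset[of "{x. \<phi> x \<noteq> 0}"] by auto
  show "x \<notin> S \<Longrightarrow> \<phi> x = 0" using out sub(1) by blast
  have fd: "(\<phi> has_derivative (\<lambda>_. 0)) (at x)" if "x \<notin> S" for x
  proof (rule has_derivative_transform_within_open[of "\<lambda>_. 0"])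
    show "open (- closure {x. \<phi> x \<noteq> 0})" by (simp add: open_Compl)
    show "x \<in> - closure {x. \<phi> x \<noteq> 0}" using that sub(1) by blast
    show "0 = \<phi> y" if "y \<in> - closure {x. \<phi> x \<noteq> 0}" for y
      by (rule out[symmetric]) (use that in blast)
  qed (rule has_derivative_const)
  show "x \<notin> S \<Longrightarrow> frechet_derivative \<phi> (at x) i = 0"
    using frechet_derivative_eqI[OF fd] by simp
  then show "x \<notin> S \<Longrightarrow> grad \<phi> x = 0"
    using frechet_derivative_eqI[OF fd] by (simp add: grad_def)
  obtain B where B: "\<forall>x\<in>closure {x. \<phi> x \<noteq> 0}. norm x \<le> B"
    using compact_imp_bounded[OF sub(2)] by (auto simp: bounded_iff)
  have "\<phi> x = 0" if "B + 1 \<le> norm x" for x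
    by (rule out) (use B that in force)
  then show "\<exists>R. \<forall>x. R \<le> norm x \<longrightarrow> \<phi> x = 0" by blast
qed

lemma test_functions_mono: "S \<subseteq> T \<Longrightarrow> test_functions S \<subseteq> test_functions T"
  by (auto simp: test_functions_def)

lemma borel_measurable_cont_on:
  assumes "\<Omega> \<in> sets lebesgue" "continuous_on UNIV k"
  shows "k \<in> borel_measurable (lebesgue_on \<Omega>)"
  using assms continuous_imp_measurable_on_sets_lebesgue continuous_on_subset by blast

text \<open>The data are replaced by Borel versions set to 0 on the closed ball of radius a. The
  jump at the sphere is invisible, because test functions for the exterior of the ball vanish near
  it.\<close>

lemma subsolution_on_exterior:
  fixes f u :: "'a::euclidean_space \<Rightarrow> real" and N p \<mu> a A \<alpha> :: real
  assumes N: "N = DIM('a)" and p: "1 < p" "p < N" and \<mu>: "0 \<le> \<mu>" and a: "1 < a"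
    and \<Omega>: "open \<Omega>" "- \<Omega> \<subseteq> ball 0 a"
    and f: "f \<in> Lp_on (N / p) \<Omega>" and f_le: "AE x in lebesgue_on \<Omega>. f x \<le> A * norm x powr (- \<alpha>)"
    and u: "u \<in> D1p p \<Omega>" and sub: "weak_subsolution p \<mu> f \<Omega> u"
  obtains u1 g1 f1 where
    "AE x in lborel. a < norm x \<longrightarrow> u1 x = u x"
    "integrable lborel (\<lambda>x. norm (g1 x) powr p)"
    "AE x in lborel. a < norm x \<longrightarrow> f1 x \<le> A * norm x powr (- \<alpha>)"
    "u1 \<in> borel_measurable borel" "g1 \<in> borel_measurable borel" "f1 \<in> borel_measurable borel"
    "integrable lborel (\<lambda>x. \<bar>u1 x\<bar> powr (N * p / (N - p)))"
    "integrable lborel (\<lambda>x. \<bar>f1 x\<bar> powr (N / p))"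
    "\<And>\<phi> i. \<phi> \<in> test_functions {x. a < norm x} \<Longrightarrow> i \<in> Basis \<Longrightarrow>
      (\<integral>x. u1 x * frechet_derivative \<phi> (at x) i \<partial>lborel) = - (\<integral>x. (g1 x \<bullet> i) * \<phi> x \<partial>lborel)"
    "\<And>\<phi>. \<phi> \<in> test_functions {x. a < norm x} \<Longrightarrow> (\<forall>x. 0 \<le> \<phi> x) \<Longrightarrow>
      (\<integral>x. flux p (g1 x) \<bullet> grad \<phi> x + - ((\<mu> * norm x powr (- p) + f1 x) * (\<bar>u1 x\<bar> powr (p - 2) * u1 x)) * \<phi> x
        \<partial>lborel) \<le> 0"
proof -
  define s where "s = N * p / (N - p)"
  define g where "g = weak_grad \<Omega> u"
  define S where "S = {x::'a. a < norm x}"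
  have s: "p \<le> s" "0 < s"
    using p by (auto simp: s_def le_divide_eq mult.commute[of _ p] mult_left_mono)
  have S\<Omega>: "S \<subseteq> \<Omega>" using \<Omega>(2) by (force simp: S_def subset_eq)
  have [measurable]: "S \<in> sets borel" unfolding S_def by measurable
  have \<Omega>m: "\<Omega> \<in> sets lebesgue" using \<Omega>(1) by (simp add: lborelD)
  have "weakly_differentiable_on \<Omega> u" using u by (simp add: D1p_def)
  then have wg: "is_weak_gradient \<Omega> u g"
    unfolding g_def weak_grad_def weakly_differentiable_on_def by (rule someI_ex)
  have um: "u \<in> borel_measurable (lebesgue_on \<Omega>)"
    and ui: "integrable (lebesgue_on \<Omega>) (\<lambda>x. norm (u x) powr s)"
    and gm: "g \<in> borel_measurable (lebesgue_on \<Omega>)"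
    and gi: "integrable (lebesgue_on \<Omega>) (\<lambda>x. norm (g x) powr p)"
    using u by (auto simp: D1p_def Lp_on_def sobolev_conj_def g_def s_def N)
  have fm: "f \<in> borel_measurable (lebesgue_on \<Omega>)"
    and fi: "integrable (lebesgue_on \<Omega>) (\<lambda>x. norm (f x) powr (N / p))"
    using f by (auto simp: Lp_on_def)
  obtain u0 where u0[measurable]: "u0 \<in> borel_measurable borel" and u0e: "AE x in lborel. x \<in> \<Omega> \<longrightarrow> u0 x = u x"
    by (rule borel_representative[OF \<Omega>m um], rule that)
  obtain g0 where g0[measurable]: "g0 \<in> borel_measurable borel" and g0e: "AE x in lborel. x \<in> \<Omega> \<longrightarrow> g0 x = g x"
    by (rule borel_representative[OF \<Omega>m gm], rule that)
  obtain f0 where f0[measurable]: "f0 \<in> borel_measurable borel" and f0e: "AE x in lborel. x \<in> \<Omega> \<longrightarrow> f0 x = f x"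
    by (rule borel_representative[OF \<Omega>m fm], rule that)
  define u1 where "u1 x = (if x \<in> S then u0 x else 0)" for x
  define g1 where "g1 x = (if x \<in> S then g0 x else 0)" for x
  define f1 where "f1 x = (if x \<in> S then f0 x else 0)" for x
  have m [measurable]: "u1 \<in> borel_measurable borel" "g1 \<in> borel_measurable borel" "f1 \<in> borel_measurable borel"
    unfolding u1_def[abs_def] g1_def[abs_def] f1_def[abs_def] by measurable
  have AE1: "AE x in lborel. x \<in> S \<longrightarrow> u1 x = u x \<and> g1 x = g x \<and> f1 x = f x"
    using u0e g0e f0e by eventually_elim (use S\<Omega> in \<open>auto simp: u1_def g1_def f1_def\<close>)
  have intS: "integrable lborel F1"
    if F: "integrable (lebesgue_on \<Omega>) F" and F1: "F1 \<in> borel_measurable borel"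
      and eq: "AE x in lborel. F1 x = (if x \<in> S then F x else 0)" for F F1 :: "'a \<Rightarrow> real"
  proof -
    have "integrable (lebesgue_on \<Omega>) (\<lambda>x. indicator S x *\<^sub>R F x)"
      using F by (intro integrable_mult_indicator) (auto simp: sets_restrict_space_iff \<Omega>m S\<Omega>)
    moreover have "AE x in lborel. F1 x = (if x \<in> \<Omega> then indicator S x *\<^sub>R F x else 0)"
      using eq by eventually_elim (use S\<Omega> in \<open>auto simp: indicator_def\<close>)
    ultimately show ?thesis
      using lebesgue_on_lborel_transfer(1)[OF \<Omega>m borel_measurable_integrable F1] by blast
  qed
  have u1i: "integrable lborel (\<lambda>x. \<bar>u1 x\<bar> powr s)"
  proof (rule intS[OF ui])
    show "AE x in lborel. \<bar>u1 x\<bar> powr s = (if x \<in> S then norm (u x) powr s else 0)"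
      using AE1 by eventually_elim (use s in \<open>auto simp: u1_def\<close>)
  qed measurable
  have g1i: "integrable lborel (\<lambda>x. norm (g1 x) powr p)"
  proof (rule intS[OF gi])
    show "AE x in lborel. norm (g1 x) powr p = (if x \<in> S then norm (g x) powr p else 0)"
      using AE1 by eventually_elim (use p in \<open>auto simp: g1_def\<close>)
  qed measurable
  have f1i: "integrable lborel (\<lambda>x. \<bar>f1 x\<bar> powr (N / p))"
  proof (rule intS[OF fi])
    show "AE x in lborel. \<bar>f1 x\<bar> powr (N / p) = (if x \<in> S then norm (f x) powr (N / p) else 0)"
      using AE1 by eventually_elim (use p in \<open>auto simp: f1_def\<close>)
  qed measurable
  have f1le: "AE x in lborel. a < norm x \<longrightarrow> f1 x \<le> A * norm x powr (- \<alpha>)"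
  proof -
    have "AE x in lebesgue. x \<in> \<Omega> \<longrightarrow> f x \<le> A * norm x powr (- \<alpha>)"
      using f_le \<Omega>m by (simp add: AE_restrict_space_iff)
    then have "AE x in lborel. x \<in> \<Omega> \<longrightarrow> f x \<le> A * norm x powr (- \<alpha>)"
      by (simp add: AE_completion_iff)
    then show ?thesis
      using AE1 by eventually_elim (use S\<Omega> in \<open>auto simp: S_def\<close>)
  qed
  have wk: "(\<integral>x. u1 x * frechet_derivative \<phi> (at x) i \<partial>lborel) = - (\<integral>x. (g1 x \<bullet> i) * \<phi> x \<partial>lborel)"
    if \<phi>: "\<phi> \<in> test_functions {x. a < norm x}" and i: "i \<in> Basis" for \<phi> i
  proof -
    note t = test_functionsD[OF \<phi>]
    have \<phi>c: "continuous_on UNIV \<phi>" "continuous_on UNIV (\<lambda>x. frechet_derivative \<phi> (at x) i)"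
      using t(1)[of 0] t(1)[of "Suc 0"] i by auto
    have [measurable]: "\<phi> \<in> borel_measurable borel" "(\<lambda>x. frechet_derivative \<phi> (at x) i) \<in> borel_measurable borel"
      using \<phi>c borel_measurable_continuous_onI by blast+
    have 1: "integral\<^sup>L (lebesgue_on \<Omega>) (\<lambda>x. u x * frechet_derivative \<phi> (at x) i)
        = (\<integral>x. u1 x * frechet_derivative \<phi> (at x) i \<partial>lborel)"
    proof (rule lebesgue_on_lborel_transfer(2)[OF \<Omega>m])
      show "(\<lambda>x. u x * frechet_derivative \<phi> (at x) i) \<in> borel_measurable (lebesgue_on \<Omega>)"
        by (intro borel_measurable_times um borel_measurable_cont_on[OF \<Omega>m \<phi>c(2)])
      show "AE x in lborel. u1 x * frechet_derivative \<phi> (at x) i = (if x \<in> \<Omega> then u x * frechet_derivative \<phi> (at x) i else 0)"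
        using AE1 by eventually_elim (use t(5) S\<Omega> in \<open>auto simp: S_def\<close>)
    qed measurable
    have 2: "integral\<^sup>L (lebesgue_on \<Omega>) (\<lambda>x. (g x \<bullet> i) * \<phi> x) = (\<integral>x. (g1 x \<bullet> i) * \<phi> x \<partial>lborel)"
    proof (rule lebesgue_on_lborel_transfer(2)[OF \<Omega>m])
      show "(\<lambda>x. (g x \<bullet> i) * \<phi> x) \<in> borel_measurable (lebesgue_on \<Omega>)"
        by (intro borel_measurable_times borel_measurable_inner gm borel_measurable_const
            borel_measurable_cont_on[OF \<Omega>m \<phi>c(1)])
      show "AE x in lborel. (g1 x \<bullet> i) * \<phi> x = (if x \<in> \<Omega> then (g x \<bullet> i) * \<phi> x else 0)"
        using AE1 by eventually_elim (use t(3) S\<Omega> in \<open>auto simp: S_def\<close>)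
    qed measurable
    have "\<phi> \<in> test_functions \<Omega>" using \<phi> test_functions_mono[OF S\<Omega>] by (auto simp: S_def)
    then show ?thesis using wg i 1 2 by (simp add: is_weak_gradient_def)
  qed
  have sb: "(\<integral>x. flux p (g1 x) \<bullet> grad \<phi> x + - ((\<mu> * norm x powr (- p) + f1 x) * (\<bar>u1 x\<bar> powr (p - 2) * u1 x)) * \<phi> x
        \<partial>lborel) \<le> 0"
    if \<phi>: "\<phi> \<in> test_functions {x. a < norm x}" and nn: "\<forall>x. 0 \<le> \<phi> x" for \<phi>
  proof -
    note t = test_functionsD[OF \<phi>]
    have c: "continuous_on UNIV \<phi>" "continuous_on UNIV (grad \<phi>)" using C1_gradD[OF t(2)] by auto
    have [measurable]: "\<phi> \<in> borel_measurable borel" "grad \<phi> \<in> borel_measurable borel"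
      using c borel_measurable_continuous_onI by blast+
    obtain R where R: "\<And>x. R \<le> norm x \<Longrightarrow> \<phi> x = 0" using t(6) by blast
    have gR: "grad \<phi> x = 0" if "R + 1 \<le> norm x" for x
      using C1_grad_support[OF t(2) R] that by auto
    obtain B1 where B1: "B1 > 0" "\<And>x. norm (\<phi> x) \<le> B1" using compact_support_bounded[OF c(1) R] by blast
    obtain B2 where B2: "B2 > 0" "\<And>x. norm (grad \<phi> x) \<le> B2" using compact_support_bounded[OF c(2) gR] by blast
    let ?L1 = "\<lambda>x. flux p (g1 x) \<bullet> grad \<phi> x - \<mu> * norm x powr (- p) * (\<bar>u1 x\<bar> powr (p - 2) * u1 x) * \<phi> x"
    let ?L2 = "\<lambda>x. f1 x * (\<bar>u1 x\<bar> powr (p - 2) * u1 x) * \<phi> x"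
    let ?F1 = "\<lambda>x. norm (g x) powr (p - 2) * (g x \<bullet> grad \<phi> x)
      - \<mu> / norm x powr p * \<bar>u x\<bar> powr (p - 2) * u x * \<phi> x"
    let ?F2 = "\<lambda>x. f x * \<bar>u x\<bar> powr (p - 2) * u x * \<phi> x"
    have \<phi>m: "\<phi> \<in> borel_measurable (lebesgue_on \<Omega>)" "grad \<phi> \<in> borel_measurable (lebesgue_on \<Omega>)"
      using borel_measurable_cont_on[OF \<Omega>m c(1)] borel_measurable_cont_on[OF \<Omega>m c(2)] .
    have nm: "norm \<in> borel_measurable (lebesgue_on \<Omega>)"
      by (rule borel_measurable_cont_on[OF \<Omega>m]) (intro continuous_intros)
    have 1: "integral\<^sup>L (lebesgue_on \<Omega>) ?F1 = integral\<^sup>L lborel ?L1"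
    proof (rule lebesgue_on_lborel_transfer(2)[OF \<Omega>m])
      show "?F1 \<in> borel_measurable (lebesgue_on \<Omega>)"
        using um gm \<phi>m nm by measurable
      show "AE x in lborel. ?L1 x = (if x \<in> \<Omega> then ?F1 x else 0)"
        using AE1
      proof eventually_elim
        case (elim x)
        show ?case
        proof (cases "x \<in> S")
          case True
          then show ?thesis using elim S\<Omega> by (auto simp: flux_def powr_minus_divide mult_ac)
        next
          case False
          then show ?thesis using t(3,4) by (simp add: S_def)
        qed
      qed
    qed measurable
    have 2: "integral\<^sup>L (lebesgue_on \<Omega>) ?F2 = integral\<^sup>L lborel ?L2"
    proof (rule lebesgue_on_lborel_transfer(2)[OF \<Omega>m])
      show "?F2 \<in> borel_measurable (lebesgue_on \<Omega>)"
        using um fm \<phi>m by measurable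
      show "AE x in lborel. ?L2 x = (if x \<in> \<Omega> then ?F2 x else 0)"
        using AE1
      proof eventually_elim
        case (elim x)
        show ?case
        proof (cases "x \<in> S")
          case True
          then show ?thesis using elim S\<Omega> by (auto simp: mult_ac)
        next
          case False
          then show ?thesis using t(3) by (simp add: S_def)
        qed
      qed
    qed measurable
    have abs_u: "\<bar>\<bar>u1 x\<bar> powr (p - 2) * u1 x\<bar> = \<bar>u1 x\<bar> powr (p - 1)" for x
      using powr_minus_one_mult[of "\<bar>u1 x\<bar>" "p - 1"] by (simp add: abs_mult diff_diff_eq)
    have b1: "\<bar>u1 x\<bar> powr (p - 1) \<le> 1 + \<bar>u1 x\<bar> powr s" for x
      using powr_le_one_add[of "\<bar>u1 x\<bar>" "p - 1" s] p s by simp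
    have b2: "norm (g1 x) powr (p - 1) \<le> 1 + norm (g1 x) powr p" for x
      using powr_le_one_add[of "norm (g1 x)" "p - 1" p] p by simp
    \<comment> \<open>The exponent (p - 1) N / (N - p) is below s, so the added constant absorbs the
      difference.\<close>
    have b3: "\<bar>f1 x\<bar> * \<bar>u1 x\<bar> powr (p - 1) \<le> \<bar>f1 x\<bar> powr (N / p) + (1 + \<bar>u1 x\<bar> powr s)" for x
    proof -
      have "\<bar>f1 x\<bar> * \<bar>u1 x\<bar> powr (p - 1) \<le> \<bar>f1 x\<bar> powr (N / p) + (\<bar>u1 x\<bar> powr (p - 1)) powr (N / (N - p))"
        using p by (intro young_critical) auto
      also have "(\<bar>u1 x\<bar> powr (p - 1)) powr (N / (N - p)) \<le> 1 + \<bar>u1 x\<bar> powr s"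
        unfolding powr_powr
        by (rule powr_le_one_add) (use p in \<open>auto simp: s_def field_simps\<close>)
      finally show ?thesis by simp
    qed
    \<comment> \<open>The hypothesis compares two Bochner integrals; merging them under one integral
      sign requires both integrands to be integrable.\<close>
    have i1: "integrable lborel ?L1"
    proof (rule Bochner_Integration.integrable_bound)
      let ?b = "\<lambda>x. B2 * (1 * indicator (cball 0 (R + 1)) x + norm (g1 x) powr p)
        + \<mu> * B1 * (1 * indicator (cball 0 (R + 1)) x + \<bar>u1 x\<bar> powr s)"
      show "integrable lborel ?b"
        by (intro Bochner_Integration.integrable_add integrable_mult_right integrable_const_cball g1i u1i)
      show "AE x in lborel. norm (?L1 x) \<le> norm (?b x)"
      proof (rule AE_I2)
        fix x :: 'a
        have b0: "0 \<le> ?b x" using B1(1) B2(1) \<mu> by simp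
        show "norm (?L1 x) \<le> norm (?b x)"
        proof (cases "a < norm x \<and> norm x \<le> R + 1")
          case True
          have "\<bar>flux p (g1 x) \<bullet> grad \<phi> x\<bar> \<le> norm (g1 x) powr (p - 1) * norm (grad \<phi> x)"
            using Cauchy_Schwarz_ineq2[of "flux p (g1 x)" "grad \<phi> x"] by (simp add: norm_flux)
          also have "\<dots> \<le> (1 + norm (g1 x) powr p) * B2"
            using b2 B2 by (intro mult_mono) auto
          finally have k1: "\<bar>flux p (g1 x) \<bullet> grad \<phi> x\<bar> \<le> B2 * (1 + norm (g1 x) powr p)"
            by (simp add: mult.commute)
          have n1: "norm x powr (- p) \<le> 1"
            using True a p powr_mono2'[of "- p" 1 "norm x"] by simp
          have "\<bar>\<mu> * norm x powr (- p) * (\<bar>u1 x\<bar> powr (p - 2) * u1 x) * \<phi> x\<bar>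
              = \<mu> * norm x powr (- p) * \<bar>u1 x\<bar> powr (p - 1) * \<bar>\<phi> x\<bar>"
            unfolding abs_mult[of _ "\<phi> x"] abs_mult[of _ "\<bar>u1 x\<bar> powr (p - 2) * u1 x"] abs_u
            using \<mu> by simp
          also have "\<dots> \<le> (\<mu> * 1) * (1 + \<bar>u1 x\<bar> powr s) * B1"
            using n1 b1 B1 \<mu> by (intro mult_mono mult_left_mono) auto
          finally have k2: "\<bar>\<mu> * norm x powr (- p) * (\<bar>u1 x\<bar> powr (p - 2) * u1 x) * \<phi> x\<bar>
              \<le> \<mu> * B1 * (1 + \<bar>u1 x\<bar> powr s)" by (simp add: mult_ac)
          have "\<bar>?L1 x\<bar> \<le> B2 * (1 + norm (g1 x) powr p) + \<mu> * B1 * (1 + \<bar>u1 x\<bar> powr s)"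
            using order_trans[OF abs_triangle_ineq4 add_mono[OF k1 k2]] .
          then show ?thesis using b0 True by simp
        next
          case False
          have "\<phi> x = 0" "grad \<phi> x = 0" using False t(3,4)[of x] R[of x] gR[of x] by auto
          then show ?thesis using b0 by simp
        qed
      qed
      show "?L1 \<in> borel_measurable lborel" by measurable
    qed
    have i2: "integrable lborel ?L2"
    proof (rule Bochner_Integration.integrable_bound)
      let ?b = "\<lambda>x. B1 * (\<bar>f1 x\<bar> powr (N / p) + (1 * indicator (cball 0 (R + 1)) x + \<bar>u1 x\<bar> powr s))"
      show "integrable lborel ?b"
        by (intro Bochner_Integration.integrable_add integrable_mult_right integrable_const_cball f1i u1i)
      show "AE x in lborel. norm (?L2 x) \<le> norm (?b x)"
      proof (rule AE_I2)
        fix x :: 'a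
        have b0: "0 \<le> ?b x" using B1(1) by simp
        show "norm (?L2 x) \<le> norm (?b x)"
        proof (cases "norm x \<le> R + 1")
          case True
          have "\<bar>?L2 x\<bar> = (\<bar>f1 x\<bar> * \<bar>u1 x\<bar> powr (p - 1)) * \<bar>\<phi> x\<bar>"
            unfolding abs_mult[of _ "\<phi> x"] abs_mult[of _ "\<bar>u1 x\<bar> powr (p - 2) * u1 x"] abs_u ..
          also have "\<dots> \<le> (\<bar>f1 x\<bar> powr (N / p) + (1 + \<bar>u1 x\<bar> powr s)) * B1"
            using b3 B1 by (intro mult_mono) auto
          finally show ?thesis using b0 True by (simp add: mult.commute)
        next
          case False
          then show ?thesis using R[of x] b0 by simp
        qed
      qed
      show "?L2 \<in> borel_measurable lborel" by measurable
    qed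
    have "\<phi> \<in> test_functions \<Omega>" using \<phi> test_functions_mono[OF S\<Omega>] by (auto simp: S_def)
    then have "integral\<^sup>L (lebesgue_on \<Omega>) ?F1 \<le> integral\<^sup>L (lebesgue_on \<Omega>) ?F2"
      using sub nn unfolding weak_subsolution_def g_def by blast
    then have "integral\<^sup>L lborel ?L1 - integral\<^sup>L lborel ?L2 \<le> 0" unfolding 1 2 by simp
    also have "integral\<^sup>L lborel ?L1 - integral\<^sup>L lborel ?L2 = (\<integral>x. ?L1 x - ?L2 x \<partial>lborel)"
      by (rule Bochner_Integration.integral_diff[OF i1 i2, symmetric])
    also have "(\<lambda>x. ?L1 x - ?L2 x) = (\<lambda>x. flux p (g1 x) \<bullet> grad \<phi> x
        + - ((\<mu> * norm x powr (- p) + f1 x) * (\<bar>u1 x\<bar> powr (p - 2) * u1 x)) * \<phi> x)"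
      by (auto simp: algebra_simps)
    finally show ?thesis .
  qed
  have u1e: "AE x in lborel. a < norm x \<longrightarrow> u1 x = u x"
    using AE1 by eventually_elim (auto simp: S_def)
  show thesis
    by (rule that[OF u1e g1i f1le m u1i[unfolded s_def] f1i wk sb])
qed

section \<open>Values near the sphere and of the upper semicontinuous representative\<close>

lemma AE_lebesgue_on_iff:
  "S \<in> sets lebesgue \<Longrightarrow> (AE x in lebesgue_on S. P x) \<longleftrightarrow> (AE x in lborel. x \<in> S \<longrightarrow> P x)"
  by (simp add: AE_restrict_space_iff AE_completion_iff)

text \<open>Each point of the sphere has a ball on which c is an essential bound. Compactness leaves
  finitely many of them, so the exceptional sets stay null, and their union contains a full
  neighbourhood of the sphere.\<close>

lemma AE_near_sphere:
  fixes u :: "'a::euclidean_space \<Rightarrow> real"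
  assumes \<Omega>: "open \<Omega>" "- \<Omega> \<subseteq> ball 0 a" and a: "0 < a"
    and usc: "\<And>y. norm y = a \<Longrightarrow> usc_rep \<Omega> u y < ereal c"
  obtains \<delta> where "0 < \<delta>" "AE x in lborel. a < norm x \<and> norm x < a + \<delta> \<longrightarrow> u x \<le> c"
proof -
  have "\<forall>y\<in>sphere 0 a. \<exists>r>0. AE x in lborel. x \<in> ball y r \<and> x \<in> \<Omega> \<longrightarrow> u x \<le> c"
  proof
    fix y :: 'a assume "y \<in> sphere 0 a"
    then have "usc_rep \<Omega> u y < ereal c" using usc by simp
    then obtain r where r: "0 < r" "esssup (lebesgue_on (ball y r \<inter> \<Omega>)) (\<lambda>y. ereal (u y)) < ereal c"
      unfolding usc_rep_def INF_less_iff by auto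
    have m: "ball y r \<inter> \<Omega> \<in> sets lebesgue" using \<Omega>(1) by (simp add: lborelD open_Int)
    have "AE x in lborel. x \<in> ball y r \<inter> \<Omega> \<longrightarrow>
        ereal (u x) \<le> esssup (lebesgue_on (ball y r \<inter> \<Omega>)) (\<lambda>y. ereal (u y))"
      using esssup_AE[where M = "lebesgue_on (ball y r \<inter> \<Omega>)" and f = "\<lambda>y. ereal (u y)"]
      unfolding AE_lebesgue_on_iff[OF m] .
    then have "AE x in lborel. x \<in> ball y r \<and> x \<in> \<Omega> \<longrightarrow> u x \<le> c"
      by eventually_elim (use r(2) in \<open>auto dest!: le_less_trans\<close>)
    with r(1) show "\<exists>r>0. AE x in lborel. x \<in> ball y r \<and> x \<in> \<Omega> \<longrightarrow> u x \<le> c" by blast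
  qed
  then obtain \<rho> where \<rho>: "\<And>y. y \<in> sphere 0 a \<Longrightarrow> 0 < \<rho> y"
    "\<And>y. y \<in> sphere 0 a \<Longrightarrow> AE x in lborel. x \<in> ball y (\<rho> y) \<and> x \<in> \<Omega> \<longrightarrow> u x \<le> c"
    by metis
  have "compact (sphere (0::'a) a)" by simp
  then obtain T where T: "T \<subseteq> sphere 0 a" "finite T" "sphere 0 a \<subseteq> (\<Union>y\<in>T. ball y (\<rho> y))"
    by (rule compactE_image[where C = "sphere 0 a" and f = "\<lambda>y. ball y (\<rho> y)"]) (use \<rho>(1) in force)+
  obtain \<delta> where \<delta>: "0 < \<delta>" "(\<Union>y\<in>sphere 0 a. ball y \<delta>) \<subseteq> (\<Union>y\<in>T. ball y (\<rho> y))"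
    by (rule compact_subset_open_imp_ball_epsilon_subset[of "sphere (0::'a) a" "\<Union>y\<in>T. ball y (\<rho> y)"])
      (use T in auto)
  have "AE x in lborel. \<forall>y\<in>T. x \<in> ball y (\<rho> y) \<and> x \<in> \<Omega> \<longrightarrow> u x \<le> c"
    using T \<rho>(2) by (intro AE_finite_allI) auto
  then have "AE x in lborel. a < norm x \<and> norm x < a + \<delta> \<longrightarrow> u x \<le> c"
  proof (eventually_elim, intro impI)
    fix x assume x: "\<forall>y\<in>T. x \<in> ball y (\<rho> y) \<and> x \<in> \<Omega> \<longrightarrow> u x \<le> c" "a < norm x \<and> norm x < a + \<delta>"
    \<comment> \<open>The radial projection onto the sphere, at distance |x| - a < \<delta> from
      x.\<close>
    define z where "z = (a / norm x) *\<^sub>R x"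
    have x0: "0 < norm x" using x a by linarith
    have z: "z \<in> sphere 0 a" using x0 a by (simp add: z_def)
    have "z - x = (a / norm x - 1) *\<^sub>R x" by (simp add: z_def scaleR_diff_left)
    then have "norm (z - x) = \<bar>a / norm x - 1\<bar> * norm x" by simp
    also have "\<dots> = norm x - a" using x x0 by (simp add: abs_if field_simps)
    finally have "x \<in> ball z \<delta>" using x by (simp add: dist_norm)
    then obtain y where y: "y \<in> T" "x \<in> ball y (\<rho> y)" using \<delta>(2) z by blast
    have "x \<in> \<Omega>" using \<Omega>(2) x(2) by force
    with x(1) y show "u x \<le> c" by blast
  qed
  with \<delta>(1) show thesis by (rule that)
qed

lemma usc_rep_le_of_AE_le:
  fixes u :: "'a::euclidean_space \<Rightarrow> real"
  assumes \<Omega>: "\<Omega> \<in> sets lebesgue" and u: "u \<in> borel_measurable (lebesgue_on \<Omega>)" and r: "0 < r"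
    and le: "AE y in lborel. y \<in> ball x r \<longrightarrow> u y \<le> c"
  shows "usc_rep \<Omega> u x \<le> ereal c"
proof -
  have m: "ball x r \<inter> \<Omega> \<in> sets lebesgue" using \<Omega> by (intro sets.Int) auto
  have "usc_rep \<Omega> u x \<le> esssup (lebesgue_on (ball x r \<inter> \<Omega>)) (\<lambda>y. ereal (u y))"
    unfolding usc_rep_def using r by (intro INF_lower) simp
  also have "\<dots> \<le> ereal c"
  proof (rule esssup_I)
    have "u \<in> borel_measurable (lebesgue_on (ball x r \<inter> \<Omega>))"
      by (rule measurable_restrict_mono[OF u]) auto
    then show "(\<lambda>y. ereal (u y)) \<in> borel_measurable (lebesgue_on (ball x r \<inter> \<Omega>))" by simp
    show "AE y in lebesgue_on (ball x r \<inter> \<Omega>). ereal (u y) \<le> ereal c"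
      unfolding AE_lebesgue_on_iff[OF m] using le by eventually_elim auto
  qed
  finally show ?thesis .
qed

text \<open>The barrier is scaled to the value m + 2 e on the sphere. Nearby u is essentially at
  most m + e, and the second e leaves room for the continuous barrier to stay above m + e on a
  shell.\<close>

lemma exterior_bound:
  fixes f u :: "'a::euclidean_space \<Rightarrow> real" and N p \<mu> a A \<alpha> \<gamma> k m e :: real
  assumes N: "N = DIM('a)" and p: "1 < p" "p < N" and \<mu>: "0 \<le> \<mu>" and \<alpha>: "p < \<alpha>" and k: "0 < k"
    and a: "1 < a"
    and slope: "\<And>r. a \<le> r \<Longrightarrow> 0 < slope \<gamma> k (\<alpha> - p) r" "\<And>r. a \<le> r \<Longrightarrow> slope \<gamma> k (\<alpha> - p) r \<le> \<gamma>"
    and super: "\<And>r. a \<le> r \<Longrightarrow> barrier \<gamma> k (\<alpha> - p) r powr (p - 1) * (\<mu> * r powr (- p) + A * r powr (- \<alpha>))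
      \<le> r * barrier_flux' p \<gamma> k (\<alpha> - p) r + N * barrier_flux p \<gamma> k (\<alpha> - p) r"
    and \<Omega>: "open \<Omega>" "- \<Omega> \<subseteq> ball 0 a"
    and f: "f \<in> Lp_on (N / p) \<Omega>" and f_le: "AE x in lebesgue_on \<Omega>. f x \<le> A * norm x powr (- \<alpha>)"
    and u: "u \<in> D1p p \<Omega>" and sub: "weak_subsolution p \<mu> f \<Omega> u"
    and usc: "\<And>y. norm y = a \<Longrightarrow> usc_rep \<Omega> u y \<le> ereal m" and m: "0 \<le> m" and e: "0 < e"
  shows "AE x in lborel. a < norm x \<longrightarrow>
    u x \<le> (m + 2 * e) / barrier \<gamma> k (\<alpha> - p) a * barrier \<gamma> k (\<alpha> - p) (norm x)"
proof -
  define \<beta> where "\<beta> = \<alpha> - p"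
  have \<beta>: "\<beta> \<noteq> 0" using \<alpha> by (simp add: \<beta>_def)
  let ?b = "barrier \<gamma> k \<beta>"
  define C where "C = (m + 2 * e) / ?b a"
  have C: "0 < C" using m e a barrier_pos[of a \<gamma> k \<beta>] by (simp add: C_def)
  obtain \<delta>1 where \<delta>1: "0 < \<delta>1" "AE x in lborel. a < norm x \<and> norm x < a + \<delta>1 \<longrightarrow> u x \<le> m + e"
  proof (rule AE_near_sphere[OF \<Omega>, of u "m + e"])
    show "usc_rep \<Omega> u y < ereal (m + e)" if "norm y = a" for y
      by (rule le_less_trans[OF usc[OF that]]) (use e in simp)
  qed (use a in auto)
  have vd: "((\<lambda>r. C * ?b r) has_real_derivative C * barrier' \<gamma> k \<beta> r) (at r)" if "a \<le> r" for r
    using DERIV_cmult[OF DERIV_barrier[of r \<beta> \<gamma> k], of C] that a \<beta> by simp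
  obtain \<delta>2 where \<delta>2: "0 < \<delta>2" "\<And>r. a < r \<Longrightarrow> r < a + \<delta>2 \<Longrightarrow> m + e \<le> C * ?b r"
  proof -
    have "isCont (\<lambda>r. C * ?b r) a" using vd[of a] by (intro DERIV_isCont) auto
    moreover have "m + e < C * ?b a" using e a barrier_pos[of a \<gamma> k \<beta>] by (simp add: C_def)
    ultimately have "\<forall>\<^sub>F r in at a. m + e < C * ?b r"
      unfolding isCont_def by (rule order_tendstoD(1))
    then obtain d where d: "0 < d" "\<And>r. r \<noteq> a \<Longrightarrow> dist r a < d \<Longrightarrow> m + e < C * ?b r"
      unfolding eventually_at by blast
    show thesis
    proof (rule that[OF d(1)])
      show "m + e \<le> C * ?b r" if "a < r" "r < a + d" for r
        using d(2)[of r] that by (simp add: dist_real_def)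
    qed
  qed
  define \<delta> where "\<delta> = min \<delta>1 \<delta>2"
  obtain u1 g1 f1 where
    u1e: "AE x in lborel. a < norm x \<longrightarrow> u1 x = u x"
    and g1i: "integrable lborel (\<lambda>x. norm (g1 x) powr p)"
    and f1le: "AE x in lborel. a < norm x \<longrightarrow> f1 x \<le> A * norm x powr (- \<alpha>)"
    and 1: "u1 \<in> borel_measurable borel" "g1 \<in> borel_measurable borel" "f1 \<in> borel_measurable borel"
    and u1i: "integrable lborel (\<lambda>x. \<bar>u1 x\<bar> powr (N * p / (N - p)))"
    and f1i: "integrable lborel (\<lambda>x. \<bar>f1 x\<bar> powr (N / p))"
    and wk: "\<And>\<phi> i. \<phi> \<in> test_functions {x. a < norm x} \<Longrightarrow> i \<in> Basis \<Longrightarrow>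
      (\<integral>x. u1 x * frechet_derivative \<phi> (at x) i \<partial>lborel) = - (\<integral>x. (g1 x \<bullet> i) * \<phi> x \<partial>lborel)"
    and sb: "\<And>\<phi>. \<phi> \<in> test_functions {x. a < norm x} \<Longrightarrow> (\<forall>x. 0 \<le> \<phi> x) \<Longrightarrow>
      (\<integral>x. flux p (g1 x) \<bullet> grad \<phi> x + - ((\<mu> * norm x powr (- p) + f1 x) * (\<bar>u1 x\<bar> powr (p - 2) * u1 x)) * \<phi> x
        \<partial>lborel) \<le> 0"
    by (rule subsolution_on_exterior[OF N p \<mu> a \<Omega> f f_le u sub], rule that)
  have near: "AE x in lborel. a < norm x \<and> norm x < a + \<delta> \<longrightarrow> u1 x \<le> m + e"
    using \<delta>1(2) u1e by eventually_elim (auto simp: \<delta>_def)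
  \<comment> \<open>The equation is homogeneous of degree p - 1: multiplying the barrier by C
    multiplies its flux by C^(p-1).\<close>
  have Cp: "C powr (p - 1) * b powr (p - 1) = (C * b) powr (p - 1)" if "0 < b" for b
    using C that by (simp add: powr_mult)
  interpret comparison a "N * p / (N - p)" p u1 g1 f1 N \<mu> A \<alpha> \<gamma> \<delta> "m + e" "\<lambda>r. C * ?b r"
    "\<lambda>r. C * barrier' \<gamma> k \<beta> r" "slope \<gamma> k \<beta>" "\<lambda>r. C powr (p - 1) * barrier_flux p \<gamma> k \<beta> r"
    "\<lambda>r. C powr (p - 1) * barrier_flux' p \<gamma> k \<beta> r"
  \<comment> \<open>The numbered goals are 1 < s, continuity of v', the derivative of h,
    \<open>h_eq\<close> and \<open>supersol\<close>; the last two rest on the homogeneity just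
    noted.\<close>
  proof (unfold_locales, goal_cases)
    case 2
    have "N - p < N * p" using p mult_strict_mono[of 1 N 1 p] by (smt (verit) mult_less_cancel_left1)
    then show ?case using p by (simp add: less_divide_eq)
  next
    case 25
    show ?case
      using a by (intro continuous_on_mult continuous_on_const continuous_on_barrier') auto
  next
    case (26 r)
    then show ?case
      using DERIV_cmult[OF DERIV_barrier_flux[of r \<beta> \<gamma> k p], of "C powr (p - 1)"] a \<beta> slope(1)[of r]
      by (simp add: \<beta>_def)
  next
    case (31 r)
    then have "0 < slope \<gamma> k \<beta> r * ?b r"
      using slope(1)[of r] a by (auto simp: \<beta>_def intro!: mult_pos_pos barrier_pos)
    from Cp[OF this] show ?case by (simp add: barrier_flux_def mult_ac)
  next
    case (32 r)
    then have b: "0 < ?b r" using a by (intro barrier_pos) simp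
    have "C powr (p - 1) * (?b r powr (p - 1) * (\<mu> * r powr (- p) + A * r powr (- \<alpha>)))
        \<le> C powr (p - 1) * (r * barrier_flux' p \<gamma> k \<beta> r + N * barrier_flux p \<gamma> k \<beta> r)"
      using super[OF 32] by (intro mult_left_mono) (auto simp: \<beta>_def)
    then show ?case using Cp[OF b] by (simp add: algebra_simps)
  qed (use a p 1 u1i g1i f1i f1le wk sb N \<mu> near \<delta>1 \<delta>2 vd slope C \<beta> in
    \<open>auto simp: \<delta>_def \<beta>_def barrier'_def intro!: mult_pos_pos barrier_pos
      continuous_on_mult continuous_on_const continuous_on_barrier' continuous_on_barrier_flux'\<close>)
  show ?thesis
    using u_le_v u1e by eventually_elim (simp add: C_def \<beta>_def)
qed

text \<open>The order of the quantifiers encodes the dependence of the constants: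
  \<open>R\<^sub>0\<close> and C are fixed before the domain, f and u, and C may vary with
  \<open>R\<^sub>1\<close>. As the complement of \<Omega> lies in the open ball, the sphere is
  contained in \<Omega>.\<close>

theorem theorem1p5:
  fixes p \<mu> A \<alpha> \<gamma>\<^sub>1 \<gamma>\<^sub>2 N :: real
  assumes "N = real CARD('n::finite)"
    and "1 < p" and "p < N"
    and "0 \<le> \<mu>" and "\<mu> < ((N - p) / p) powr p"
    and "0 < A" and "p < \<alpha>"
    and "\<gamma>\<^sub>1 < \<gamma>\<^sub>2"
    and "{\<gamma>. 0 \<le> \<gamma> \<and> \<gamma> powr (p - 2) * ((p - 1) * \<gamma>\<^sup>2 - (N - p) * \<gamma>) + \<mu> = 0} = {\<gamma>\<^sub>1, \<gamma>\<^sub>2}"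
  shows "\<exists>R\<^sub>0>1. \<forall>R\<^sub>1\<ge>R\<^sub>0. \<exists>C>0.
           \<forall>(\<Omega> :: (real ^ 'n) set) (f :: real ^ 'n \<Rightarrow> real) (u :: real ^ 'n \<Rightarrow> real).
             open \<Omega> \<and> connected \<Omega> \<and> bounded (- \<Omega>) \<and> - \<Omega> \<subseteq> ball 0 R\<^sub>1
             \<and> f \<in> Lp_on (N / p) \<Omega>
             \<and> (AE x in lebesgue_on \<Omega>. f x \<le> A * norm x powr (- \<alpha>))
             \<and> u \<in> D1p p \<Omega> \<and> weak_subsolution p \<mu> f \<Omega> u
             \<longrightarrow> (let M = (SUP y\<in>sphere 0 R\<^sub>1. max (usc_rep \<Omega> u y) 0) in
                  \<forall>x\<in>UNIV - ball 0 R\<^sub>1.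
                    usc_rep \<Omega> u x \<le> ereal C * M * ereal (norm x powr (- \<gamma>\<^sub>2)))"
proof -
  have "\<gamma>\<^sub>1 \<in> {\<gamma>. 0 \<le> \<gamma> \<and> \<gamma> powr (p - 2) * ((p - 1) * \<gamma>\<^sup>2 - (N - p) * \<gamma>) + \<mu> = 0}"
    "\<gamma>\<^sub>2 \<in> {\<gamma>. 0 \<le> \<gamma> \<and> \<gamma> powr (p - 2) * ((p - 1) * \<gamma>\<^sup>2 - (N - p) * \<gamma>) + \<mu> = 0}"
    unfolding assms(9) by auto
  then have roots: "0 \<le> \<gamma>\<^sub>1"
    "\<gamma>\<^sub>1 powr (p - 2) * ((p - 1) * \<gamma>\<^sub>1\<^sup>2 - (N - p) * \<gamma>\<^sub>1) + \<mu> = 0"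
    "\<gamma>\<^sub>2 powr (p - 2) * ((p - 1) * \<gamma>\<^sub>2\<^sup>2 - (N - p) * \<gamma>\<^sub>2) + \<mu> = 0"
    by auto
  define \<beta> where "\<beta> = \<alpha> - p"
  obtain k R\<^sub>0 where k: "0 < k" and R0: "1 < R\<^sub>0"
    and slope: "\<And>r. R\<^sub>0 \<le> r \<Longrightarrow> 0 < slope \<gamma>\<^sub>2 k (\<alpha> - p) r"
      "\<And>r. R\<^sub>0 \<le> r \<Longrightarrow> slope \<gamma>\<^sub>2 k (\<alpha> - p) r \<le> \<gamma>\<^sub>2"
    and super: "\<And>r. R\<^sub>0 \<le> r \<Longrightarrow> barrier \<gamma>\<^sub>2 k (\<alpha> - p) r powr (p - 1) * (\<mu> * r powr (- p) + A * r powr (- \<alpha>))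
      \<le> r * barrier_flux' p \<gamma>\<^sub>2 k (\<alpha> - p) r + N * barrier_flux p \<gamma>\<^sub>2 k (\<alpha> - p) r"
    using barrier_supersolution[OF assms(2,6,7) roots(1) assms(8) roots(2,3)] by metis
  show ?thesis
  proof (intro exI[of _ R\<^sub>0] conjI R0, intro allI impI)
    fix R\<^sub>1 assume R1: "R\<^sub>0 \<le> R\<^sub>1"
    have a: "1 < R\<^sub>1" using R0 R1 by simp
    \<comment> \<open>The reciprocal normalises the barrier to 1 at \<open>R\<^sub>1\<close>; its
      exponential factor, at most 1, is dropped in \<open>b_le\<close>.\<close>
    define C where "C = 1 / barrier \<gamma>\<^sub>2 k \<beta> R\<^sub>1"
    have C: "0 < C" using barrier_pos[of R\<^sub>1 \<gamma>\<^sub>2 k \<beta>] a by (simp add: C_def)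
    have b_le: "barrier \<gamma>\<^sub>2 k \<beta> r \<le> r powr (- \<gamma>\<^sub>2)" for r
      using k assms(7) by (simp add: barrier_def \<beta>_def mult_left_le)
    show "\<exists>C>0. \<forall>(\<Omega> :: (real ^ 'n) set) f u.
             open \<Omega> \<and> connected \<Omega> \<and> bounded (- \<Omega>) \<and> - \<Omega> \<subseteq> ball 0 R\<^sub>1
             \<and> f \<in> Lp_on (N / p) \<Omega>
             \<and> (AE x in lebesgue_on \<Omega>. f x \<le> A * norm x powr (- \<alpha>))
             \<and> u \<in> D1p p \<Omega> \<and> weak_subsolution p \<mu> f \<Omega> u
             \<longrightarrow> (let M = (SUP y\<in>sphere 0 R\<^sub>1. max (usc_rep \<Omega> u y) 0) in
                  \<forall>x\<in>UNIV - ball 0 R\<^sub>1.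
                    usc_rep \<Omega> u x \<le> ereal C * M * ereal (norm x powr (- \<gamma>\<^sub>2)))"
    proof (intro exI[of _ C] conjI C allI impI, unfold Let_def, intro ballI)
      fix \<Omega> :: "(real ^ 'n) set" and f u :: "real ^ 'n \<Rightarrow> real" and x :: "real ^ 'n"
      assume H: "open \<Omega> \<and> connected \<Omega> \<and> bounded (- \<Omega>) \<and> - \<Omega> \<subseteq> ball 0 R\<^sub>1
             \<and> f \<in> Lp_on (N / p) \<Omega>
             \<and> (AE x in lebesgue_on \<Omega>. f x \<le> A * norm x powr (- \<alpha>))
             \<and> u \<in> D1p p \<Omega> \<and> weak_subsolution p \<mu> f \<Omega> u"
        and "x \<in> UNIV - ball 0 R\<^sub>1"
      then have x: "R\<^sub>1 \<le> norm x" by simp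
      define M where "M = (SUP y\<in>sphere (0::real ^ 'n) R\<^sub>1. max (usc_rep \<Omega> u y) 0)"
      have M_ge: "usc_rep \<Omega> u y \<le> M" "0 \<le> M" if "norm y = R\<^sub>1" for y
        unfolding M_def using that
        by (auto intro!: SUP_upper2[of y])
      \<comment> \<open>A point of the sphere yields M >= 0; a supremum over the empty set would be
        minus infinity.\<close>
      obtain z :: "real ^ 'n" where z: "norm z = R\<^sub>1"
        using vector_choose_size[of R\<^sub>1] a by auto
      have M0: "0 \<le> M" using M_ge(2)[OF z] .
      have "usc_rep \<Omega> u x \<le> ereal C * M * ereal (norm x powr (- \<gamma>\<^sub>2))"
      proof (cases M)
        case PInf
        have "0 < norm x" using x a by linarith
        then have inf: "ereal C * M * ereal (norm x powr (- \<gamma>\<^sub>2)) = \<infinity>" using PInf C by simp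
        show ?thesis unfolding inf by simp
      next
        case MInf
        then show ?thesis using M0 by simp
      next
        case (real m)
        have m: "0 \<le> m" using M0 real by simp
        have usc: "usc_rep \<Omega> u y \<le> ereal m" if "norm y = R\<^sub>1" for y
          using M_ge(1)[OF that] real by simp
        have goal: "ereal C * M * ereal (norm x powr (- \<gamma>\<^sub>2)) = ereal (m * C * norm x powr (- \<gamma>\<^sub>2))"
          by (simp add: real mult.commute)
        show ?thesis
        \<comment> \<open>The comparison speaks only of points beyond the sphere. On the sphere
          itself the definition of M suffices, because C times the power is at least 1
          there.\<close>
        proof (cases "norm x = R\<^sub>1")
          case True
          have "1 \<le> C * R\<^sub>1 powr (- \<gamma>\<^sub>2)"
            using b_le[of R\<^sub>1] barrier_pos[of R\<^sub>1 \<gamma>\<^sub>2 k \<beta>] a by (simp add: C_def)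
          then have "m * 1 \<le> m * (C * R\<^sub>1 powr (- \<gamma>\<^sub>2))" using m by (intro mult_left_mono)
          then have "ereal m \<le> ereal (m * C * norm x powr (- \<gamma>\<^sub>2))" using True by (simp add: mult.assoc)
          then show ?thesis unfolding goal using usc[OF True] order_trans by blast
        next
          case False
          then have xa: "R\<^sub>1 < norm x" using x by simp
          \<comment> \<open>The parameter t is both the radius of the ball for the essential
            supremum and the slack e of the comparison; finally t tends to 0.\<close>
          let ?F = "\<lambda>t. (m + 2 * t) * C * (norm x - t) powr (- \<gamma>\<^sub>2)"
          have \<Omega>m: "\<Omega> \<in> sets lebesgue" using H by (simp add: lborelD)
          have um: "u \<in> borel_measurable (lebesgue_on \<Omega>)" using H by (simp add: D1p_def Lp_on_def)
          have le: "usc_rep \<Omega> u x \<le> ereal (?F t)" if t: "0 < t" "t < norm x - R\<^sub>1" for t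
          proof (rule usc_rep_le_of_AE_le[OF \<Omega>m um t(1)])
            have "AE y in lborel. R\<^sub>1 < norm y \<longrightarrow>
                u y \<le> (m + 2 * t) / barrier \<gamma>\<^sub>2 k (\<alpha> - p) R\<^sub>1 * barrier \<gamma>\<^sub>2 k (\<alpha> - p) (norm y)"
              by (rule exterior_bound[where \<Omega> = \<Omega> and f = f and \<mu> = \<mu> and A = A and p = p and N = N])
                (use assms k a slope super R1 H usc m t in auto)
            then show "AE y in lborel. y \<in> ball x t \<longrightarrow> u y \<le> ?F t"
            proof (eventually_elim, intro impI)
              fix y assume y: "y \<in> ball x t" and u: "R\<^sub>1 < norm y \<longrightarrow>
                u y \<le> (m + 2 * t) / barrier \<gamma>\<^sub>2 k (\<alpha> - p) R\<^sub>1 * barrier \<gamma>\<^sub>2 k (\<alpha> - p) (norm y)"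
              have ny: "norm x - t < norm y"
                using y norm_triangle_ineq2[of x y] by (simp add: dist_norm)
              then have "u y \<le> (m + 2 * t) * C * barrier \<gamma>\<^sub>2 k \<beta> (norm y)"
                using u t by (simp add: C_def \<beta>_def)
              also have "\<dots> \<le> (m + 2 * t) * C * (norm x - t) powr (- \<gamma>\<^sub>2)"
              proof (intro mult_left_mono)
                have "barrier \<gamma>\<^sub>2 k \<beta> (norm y) \<le> norm y powr (- \<gamma>\<^sub>2)" by (rule b_le)
                also have "\<dots> \<le> (norm x - t) powr (- \<gamma>\<^sub>2)"
                  using ny t a roots(1) assms(8) by (intro powr_mono2') auto
                finally show "barrier \<gamma>\<^sub>2 k \<beta> (norm y) \<le> (norm x - t) powr (- \<gamma>\<^sub>2)" .
              qed (use m t C in auto)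
              finally show "u y \<le> ?F t" .
            qed
          qed
          have x0: "norm x \<noteq> 0" using xa a by linarith
          have "((\<lambda>t. ?F t) \<longlongrightarrow> (m + 2 * 0) * C * (norm x - 0) powr (- \<gamma>\<^sub>2)) (at_right 0)"
            using x0 by (intro tendsto_intros) auto
          then have "((\<lambda>t. ereal (?F t)) \<longlongrightarrow> ereal (m * C * norm x powr (- \<gamma>\<^sub>2))) (at_right 0)"
            by simp
          moreover have "\<forall>\<^sub>F t in at_right 0. usc_rep \<Omega> u x \<le> ereal (?F t)"
            using xa le unfolding eventually_at_right_field by (intro exI[of _ "norm x - R\<^sub>1"]) auto
          ultimately show ?thesis
            unfolding goal by (rule tendsto_lowerbound) simp
        qed
      qed
      then show "usc_rep \<Omega> u x \<le> ereal C * (SUP y\<in>sphere 0 R\<^sub>1. max (usc_rep \<Omega> u y) 0)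
          * ereal (norm x powr (- \<gamma>\<^sub>2))"
        unfolding M_def .
    qed
  qed
qed

end
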